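(* Let $k$ be a nonzero integer and let $b:\mathbb R\to\mathbb R$ satisfy: (i) there is $0<c_m<1$ with $c_m\le b'(y)\le c_m^{-1}$ for all $y\in\mathbb R$; (ii) $b''\in H^4(\mathbb R)$; (iii) the Rayleigh operator $\mathcal R_{b,k}$ has a single embedded eigenvalue and has no other eigenvalues. Then for any $M>0$ there exist $\omega_{\rm in}$ and $T$ such that $$\|\omega_{\rm in}\|_{L^\infty(\mathbb R)}+\|\omega_{\rm in}\|_{L^2(\mathbb R)}=1,$$ and the solution $\omega(t,y)$ of $$\partial_t\omega(t,y)+ik\,\mathcal R_{b,k}\omega(t,y)=0,\qquad \omega(0,y)=\omega_{\rm in}(y),$$ satisfies $$\|\omega(T,\cdot)\|_{L^\infty(\mathbb R)}\ge M,\qquad \|\omega(T,\cdot)\|_{L^2(\mathbb R)}\ge M.$$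
   Context: The Rayleigh operator is $\mathcal R_{b,k}\omega=b\,\omega-b''\,(\partial_y^2-k^2)^{-1}\omega$, acting on complex-valued functions on $\mathbb R$ (in $L^2(\mathbb R)$, where $(\partial_y^2-k^2)^{-1}\omega$ denotes the solution $\psi\in H^2(\mathbb R)$ of $\psi''-k^2\psi=\omega$). Its continuous spectrum is $\mathrm{Ran}\,b=\mathbb R$. A number $c\in\mathbb C$ is an eigenvalue if $\mathcal R_{b,k}\omega=c\,\omega$ for some nonzero $\omega\in L^2(\mathbb R)$, equivalently if $(b-c)(\psi''-k^2\psi)-b''\psi=0$ for some nonzero $\psi\in H^2(\mathbb R)$; an eigenvalue $c\in\mathbb R$ is called an embedded eigenvalue. The solution of the evolution equation is $\omega(t)=e^{-ikt\mathcal R_{b,k}}\omega_{\rm in}$. *)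

theory Defs
  imports "HOL-Analysis.Analysis" "HOL-Probability.Essential_Supremum"
begin

text \<open>Elements of \<open>L\<^sup>2\<close> are represented by Borel functions; equality between them is
  always almost everywhere.\<close>

definition Ltwo :: "(real \<Rightarrow> 'a::{banach, second_countable_topology}) set" where
  "Ltwo = {f. f \<in> borel_measurable lborel \<and> integrable lborel (\<lambda>y. (norm (f y))\<^sup>2)}"

definition Ltwo_norm :: "(real \<Rightarrow> 'a::{banach, second_countable_topology}) \<Rightarrow> real" where
  "Ltwo_norm f = sqrt (LINT y|lborel. (norm (f y))\<^sup>2)"

definition Linf_norm :: "(real \<Rightarrow> 'a::{banach, second_countable_topology}) \<Rightarrow> ereal" where
  "Linf_norm f = esssup lborel (\<lambda>y. ereal (norm (f y)))"

definition test_function :: "(real \<Rightarrow> real) \<Rightarrow> bool" where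
  "test_function \<phi> \<longleftrightarrow>
     (\<forall>n y. (deriv ^^ n) \<phi> differentiable (at y)) \<and> (\<exists>r. \<forall>y. \<bar>y\<bar> > r \<longrightarrow> \<phi> y = 0)"

definition locally_integrable :: "(real \<Rightarrow> 'a::{banach, second_countable_topology}) \<Rightarrow> bool" where
  "locally_integrable f \<longleftrightarrow> (\<forall>a b. set_integrable lborel {a..b} f)"

definition has_weak_deriv ::
  "nat \<Rightarrow> (real \<Rightarrow> 'a::{banach, second_countable_topology}) \<Rightarrow> (real \<Rightarrow> 'a) \<Rightarrow> bool" where
  "has_weak_deriv n f g \<longleftrightarrow> locally_integrable f \<and> locally_integrable g \<and>
     (\<forall>\<phi>. test_function \<phi> \<longrightarrow>
        (LINT y|lborel. (deriv ^^ n) \<phi> y *\<^sub>R f y) = (-1) ^ n *\<^sub>R (LINT y|lborel. \<phi> y *\<^sub>R g y))"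

definition sobolev_H :: "nat \<Rightarrow> (real \<Rightarrow> 'a::{banach, second_countable_topology}) set" where
  "sobolev_H m = {f \<in> Ltwo. \<forall>n\<le>m. \<exists>g\<in>Ltwo. has_weak_deriv n f g}"

text \<open>\<open>(\<partial>\<^sub>y\<^sup>2 - k\<^sup>2)\<^sup>-\<^sup>1 \<omega>\<close>: for \<open>k \<noteq> 0\<close> and \<open>\<omega> \<in> L\<^sup>2\<close> the solution in \<open>H\<^sup>2\<close> exists and is unique
  up to null sets; the choice operator only selects a representative of it.\<close>

definition helmholtz_inv :: "int \<Rightarrow> (real \<Rightarrow> complex) \<Rightarrow> (real \<Rightarrow> complex)" where
  "helmholtz_inv k \<omega> = (SOME \<psi>. \<psi> \<in> sobolev_H 2 \<and>
     (\<exists>\<psi>2. has_weak_deriv 2 \<psi> \<psi>2 \<and> (AE y in lborel. \<psi>2 y - (of_int k)\<^sup>2 * \<psi> y = \<omega> y)))"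

definition rayleigh :: "(real \<Rightarrow> real) \<Rightarrow> int \<Rightarrow> (real \<Rightarrow> complex) \<Rightarrow> (real \<Rightarrow> complex)" where
  "rayleigh b k \<omega> =
     (\<lambda>y. of_real (b y) * \<omega> y - of_real (deriv (deriv b) y) * helmholtz_inv k \<omega> y)"

text \<open>The eigenvalue equation forces \<open>b \<omega> \<in> L\<^sup>2\<close> when \<open>b''\<close> is bounded, so there is no separate
  domain condition.\<close>

definition rayleigh_eigenvalue :: "(real \<Rightarrow> real) \<Rightarrow> int \<Rightarrow> complex \<Rightarrow> bool" where
  "rayleigh_eigenvalue b k c \<longleftrightarrow>
     (\<exists>\<omega>\<in>Ltwo. \<not> (AE y in lborel. \<omega> y = 0) \<and> (AE y in lborel. rayleigh b k \<omega> y = c * \<omega> y))"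

definition embedded_eigenvalue :: "(real \<Rightarrow> real) \<Rightarrow> int \<Rightarrow> complex \<Rightarrow> bool" where
  "embedded_eigenvalue b k c \<longleftrightarrow> rayleigh_eigenvalue b k c \<and> c \<in> \<real>"

text \<open>\<open>\<omega>(t) = e\<^sup>-\<^sup>i\<^sup>k\<^sup>t\<^sup>R \<omega>\<^sub>i\<^sub>n\<close> for arbitrary \<open>\<omega>\<^sub>i\<^sub>n \<in> L\<^sup>2\<close>. As \<open>b\<close> may be unbounded, \<open>rayleigh b k (\<omega> t)\<close> need
  not lie in \<open>L\<^sup>2\<close>, but it is locally integrable for continuous \<open>b\<close> and \<open>b''\<close>. Hence the solution
  is a continuous curve in \<open>L\<^sup>2\<close> along which the equation holds in the sense of distributions
  in \<open>y\<close>.\<close>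

definition rayleigh_solution ::
  "(real \<Rightarrow> real) \<Rightarrow> int \<Rightarrow> (real \<Rightarrow> complex) \<Rightarrow> (real \<Rightarrow> real \<Rightarrow> complex) \<Rightarrow> bool" where
  "rayleigh_solution b k \<omega>in \<omega> \<longleftrightarrow>
     (\<forall>t\<ge>0. \<omega> t \<in> Ltwo) \<and>
     (\<forall>t\<ge>0. ((\<lambda>s. Ltwo_norm (\<lambda>y. \<omega> s y - \<omega> t y)) \<longlongrightarrow> 0) (at t within {0..})) \<and>
     (AE y in lborel. \<omega> 0 y = \<omega>in y) \<and>
     (\<forall>\<phi>. test_function \<phi> \<longrightarrow> (\<forall>t\<ge>0.
        ((\<lambda>s. LINT y|lborel. \<phi> y *\<^sub>R \<omega> s y) has_vector_derivative
          - (\<i> * of_int k * (LINT y|lborel. \<phi> y *\<^sub>R rayleigh b k (\<omega> t) y))) (at t within {0..})))"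

end

theory Submission
  imports Defs "HOL-Probability.Sinc_Integral" "HOL-Probability.Characteristic_Functions"
begin

text \<open>Let \<open>\<psi>\<close> be the stream function of the eigenfunction, \<open>c = b y\<^sub>c\<close> the eigenvalue and \<open>\<beta> = b''\<close>.
  An energy identity gives \<open>\<psi> y\<^sub>c \<noteq> 0\<close>, and then square integrability of \<open>\<beta> \<psi> / (b - c)\<close> gives
  \<open>\<beta> y\<^sub>c = 0\<close>. For a solution \<open>\<omega>\<close>, the pairing \<open>F t\<close> of \<open>\<omega> t\<close> with \<open>\<psi> / (b - c - \<i> \<epsilon>)\<close> satisfies
  \<open>F' = (k \<epsilon> - \<i> k c) F - k \<epsilon> G\<close>, where \<open>G\<close> is bounded, uniformly in \<open>\<epsilon>\<close>, by the smaller of the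
  \<open>L\<^sup>\<infinity>\<close> and the \<open>L\<^sup>2\<close> norm of \<open>\<omega> t\<close>. If at each positive time one of the two norms were below \<open>M\<close>, then,
  for \<open>k \<epsilon> > 0\<close>, \<open>F\<close> would stay bounded, which forces \<open>\<bar>F 0\<bar>\<close> to be at most a constant independent
  of \<open>\<epsilon>\<close>. But for a step at \<open>y\<^sub>c\<close> as initial datum \<open>\<bar>F 0\<bar>\<close> grows like \<open>ln (1 / \<bar>\<epsilon>\<bar>)\<close>.\<close>

section \<open>Smooth functions and test functions\<close>

text \<open>The multiplier comes from duality. The transpose of the Rayleigh operator sends \<eta>
  to \<open>b \<eta> - green \<kappa> (\<beta> \<eta>)\<close>, and \<open>\<psi> / (b - c)\<close>
  is formally an eigenfunction of it: \<beta> times it is the original eigenfunction, whose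
  potential is \<psi>, and b times it is \<psi> plus c times it. Since \<psi> does not vanish at
  \<open>y\<^sub>c\<close>, it is not square integrable; this missing dual vector is where the
  growth comes from. The shift by \<i> \<epsilon> makes it square integrable at the price of the
  term with G. Both norms are to be large at the same time, so each estimate of F and of G has to
  work under a bound on either norm alone; for F this uses that \<psi> is integrable. Two obstacles
  lie in the notion of solution. Multiplication by b is unbounded and the equation is tested only
  against smooth functions of bounded support, so it must first be extended by density to all \<eta>
  such that \<eta> and b \<eta> are square integrable. And T is found by contradiction for one
  solution, while the conclusion concerns all of them; this is why existence and uniqueness are
  proved.\<close>

definition smooth :: "(real \<Rightarrow> real) \<Rightarrow> bool" where
  "smooth f \<longleftrightarrow> (\<forall>n y. (deriv ^^ n) f differentiable (at y))"

lemma test_function_iff: "test_function \<phi> \<longleftrightarrow> smooth \<phi> \<and> (\<exists>r. \<forall>y. \<bar>y\<bar> > r \<longrightarrow> \<phi> y = 0)"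
  by (simp add: test_function_def smooth_def)

text \<open>By induction on \<open>n\<close> every iterated derivative lies in \<open>P\<close>, so
  only closure under a single differentiation has to be shown. Each application chooses for
  \<open>P\<close> a class of formulas large enough to contain its own derivatives.\<close>

lemma smooth_coinduct:
  assumes "P f" and step: "\<And>f. P f \<Longrightarrow> \<exists>f'. (\<forall>y. (f has_real_derivative f' y) (at y)) \<and> P f'"
  shows "smooth f"
proof -
  have "P ((deriv ^^ n) f)" for n
  proof (induction n)
    case (Suc n)
    then obtain f' where "\<forall>y. ((deriv ^^ n) f has_real_derivative f' y) (at y)" "P f'"
      using step by blast
    moreover from this have "deriv ((deriv ^^ n) f) = f'"
      by (intro ext DERIV_imp_deriv) auto
    ultimately show ?case by simp
  qed (simp add: assms(1))
  then show ?thesis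
    unfolding smooth_def using step real_differentiable_def by metis
qed

lemma smooth_has_deriv: "smooth f \<Longrightarrow> (f has_real_derivative deriv f y) (at y)"
  by (metis DERIV_deriv_iff_real_differentiable funpow_0 smooth_def)

lemma smooth_deriv: "smooth f \<Longrightarrow> smooth (deriv f)"
  unfolding smooth_def by (metis comp_apply funpow_Suc_right)

lemma smooth_continuous: "smooth f \<Longrightarrow> continuous_on A f"
  by (meson DERIV_isCont continuous_at_imp_continuous_on smooth_has_deriv)

lemma smooth_measurable [measurable_dest]: "smooth f \<Longrightarrow> f \<in> borel_measurable borel"
  by (simp add: borel_measurable_continuous_onI smooth_continuous)

lemma smooth_const: "smooth (\<lambda>x. c)"
  by (rule smooth_coinduct[where P = "\<lambda>f. \<exists>c. f = (\<lambda>x. c)"]) (auto intro!: exI[of _ "\<lambda>x. 0"])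

lemma smooth_add:
  assumes "smooth f" "smooth g" shows "smooth (\<lambda>x. f x + g x)"
proof (rule smooth_coinduct[where P = "\<lambda>h. \<exists>f g. smooth f \<and> smooth g \<and> h = (\<lambda>x. f x + g x)"])
  fix h assume "\<exists>f g. smooth f \<and> smooth g \<and> h = (\<lambda>x. f x + g x)"
  then obtain f g where h: "smooth f" "smooth g" "h = (\<lambda>x. f x + g x)" by blast
  have "\<forall>y. (h has_real_derivative deriv f y + deriv g y) (at y)"
    unfolding h(3) using h(1,2) by (auto intro!: derivative_intros smooth_has_deriv)
  then show "\<exists>h'. (\<forall>y. (h has_real_derivative h' y) (at y)) \<and>
      (\<exists>f g. smooth f \<and> smooth g \<and> h' = (\<lambda>x. f x + g x))"
    using h(1,2) smooth_deriv by (intro exI[of _ "\<lambda>y. deriv f y + deriv g y"]) blast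
qed (use assms in blast)

text \<open>Products are not closed under differentiation, but finite sums of products are, by the
  Leibniz rule; this is the class given to \<open>smooth_coinduct\<close>.\<close>

inductive product_sum :: "(real \<Rightarrow> real) \<Rightarrow> bool" where
  "smooth f \<Longrightarrow> smooth g \<Longrightarrow> product_sum (\<lambda>x. f x * g x)"
| "product_sum f \<Longrightarrow> product_sum g \<Longrightarrow> product_sum (\<lambda>x. f x + g x)"

lemma smooth_mult:
  assumes "smooth f" "smooth g" shows "smooth (\<lambda>x. f x * g x)"
proof (rule smooth_coinduct[where P = product_sum])
  fix h assume "product_sum h"
  then show "\<exists>h'. (\<forall>y. (h has_real_derivative h' y) (at y)) \<and> product_sum h'"
  proof induction
    case (1 f g)
    have "\<forall>y. ((\<lambda>x. f x * g x) has_real_derivative deriv f y * g y + f y * deriv g y) (at y)"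
      using 1 by (auto intro!: derivative_eq_intros smooth_has_deriv)
    moreover have "product_sum (\<lambda>y. deriv f y * g y + f y * deriv g y)"
      using 1 by (intro product_sum.intros smooth_deriv)
    ultimately show ?case by (intro exI[of _ "\<lambda>y. deriv f y * g y + f y * deriv g y"]) blast
  next
    case (2 f g)
    then obtain f' g' where
      "\<forall>y. (f has_real_derivative f' y) (at y)" "product_sum f'"
      "\<forall>y. (g has_real_derivative g' y) (at y)" "product_sum g'" by blast
    then have "(\<forall>y. ((\<lambda>x. f x + g x) has_real_derivative f' y + g' y) (at y)) \<and>
        product_sum (\<lambda>y. f' y + g' y)"
      by (auto intro!: derivative_intros product_sum.intros)
    then show ?case by (intro exI[of _ "\<lambda>y. f' y + g' y"])
  qed
qed (use assms product_sum.intros in auto)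

lemma has_real_derivative_affine:
  assumes "\<And>y. (f has_real_derivative f' y) (at y)"
  shows "((\<lambda>x. f (a * x + c)) has_real_derivative a * f' (a * y + c)) (at y)"
proof -
  have "((\<lambda>x. a * x + c) has_real_derivative a) (at y)"
    by (auto intro!: derivative_eq_intros)
  from DERIV_chain2[OF assms this] show ?thesis by (simp add: mult.commute)
qed

lemma smooth_affine:
  assumes "smooth f" shows "smooth (\<lambda>x. f (a * x + c))"
proof (rule smooth_coinduct[where P = "\<lambda>h. \<exists>f r. smooth f \<and> h = (\<lambda>x. r * f (a * x + c))"])
  fix h assume "\<exists>f r. smooth f \<and> h = (\<lambda>x. r * f (a * x + c))"
  then obtain f r where h: "smooth f" "h = (\<lambda>x. r * f (a * x + c))" by blast
  have "\<forall>y. (h has_real_derivative (r * a) * deriv f (a * y + c)) (at y)"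
    unfolding h(2) using DERIV_cmult[OF has_real_derivative_affine[OF smooth_has_deriv[OF h(1)]], of r a c]
    by (simp add: mult.assoc)
  then show "\<exists>h'. (\<forall>y. (h has_real_derivative h' y) (at y)) \<and>
      (\<exists>f r. smooth f \<and> h' = (\<lambda>x. r * f (a * x + c)))"
    using smooth_deriv[OF h(1)] by (intro exI[of _ "\<lambda>y. (r * a) * deriv f (a * y + c)"]) blast
qed (use assms in \<open>auto intro!: exI[of _ f] exI[of _ 1]\<close>)

lemma smooth_polynomial:
  fixes p :: "real \<Rightarrow> real"
  assumes "real_polynomial_function p" shows "smooth p"
  using assms
proof induction
  case (linear f)
  then obtain a where "f = (\<lambda>x. x * a)" using real_bounded_linear by blast
  moreover have "smooth (\<lambda>x. a * x)"
  proof (rule smooth_coinduct[where P = "\<lambda>f. \<exists>a c. f = (\<lambda>x. a * x + c)"])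
    show "\<exists>b c. (\<lambda>x. a * x) = (\<lambda>x. b * x + c)" by (rule exI[of _ a], rule exI[of _ 0]) simp
    fix f :: "real \<Rightarrow> real" assume "\<exists>a c. f = (\<lambda>x. a * x + c)"
    then obtain a c where "f = (\<lambda>x. a * x + c)" by blast
    then have "\<forall>y. (f has_real_derivative a) (at y)" by (auto intro!: derivative_eq_intros)
    moreover have "(\<lambda>x. a) = (\<lambda>x. 0 * x + a)" by simp
    ultimately show "\<exists>f'. (\<forall>y. (f has_real_derivative f' y) (at y)) \<and> (\<exists>a c. f' = (\<lambda>x. a * x + c))"
      by (intro exI[of _ "\<lambda>x. a"]) blast
  qed
  ultimately show ?case by (simp add: mult.commute)
qed (auto intro: smooth_const smooth_add smooth_mult)

section \<open>Flat functions and bumps of bounded support\<close>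

definition flat :: "nat \<Rightarrow> real \<Rightarrow> real" where
  "flat m x = (if x > 0 then exp (- (1 / x)) / x ^ m else 0)"

inductive flat_span :: "(real \<Rightarrow> real) \<Rightarrow> bool" where
  "flat_span (\<lambda>x. c * flat m x)"
| "flat_span f \<Longrightarrow> flat_span g \<Longrightarrow> flat_span (\<lambda>x. f x + g x)"

lemma flat_tendsto_0: "(flat m \<longlongrightarrow> 0) (at 0)"
proof -
  have "((\<lambda>x::real. inverse x ^ m / exp (inverse x)) \<longlongrightarrow> 0) (at_right 0)"
    using filterlim_compose[OF tendsto_power_div_exp_0 filterlim_inverse_at_top_right] by simp
  then have "(flat m \<longlongrightarrow> 0) (at_right 0)"
    by (rule tendsto_cong[THEN iffD1, rotated])
      (auto simp: eventually_at_filter flat_def exp_minus field_simps power_inverse)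
  moreover have "(flat m \<longlongrightarrow> 0) (at_left 0)"
    by (rule tendsto_eventually) (auto simp: eventually_at_filter flat_def)
  ultimately show ?thesis by (simp add: filterlim_split_at)
qed

text \<open>The powers in the denominator make the span of all \<open>flat m\<close> closed under
  differentiation. At the origin the difference quotient of \<open>flat m\<close> is
  \<open>flat (m + 1)\<close>, which tends to 0.\<close>

lemma flat_has_deriv: "(flat m has_real_derivative flat (m + 2) y - real m * flat (m + 1) y) (at y)"
proof (cases y "0::real" rule: linorder_cases)
  case less
  have "((\<lambda>x. 0) has_real_derivative 0) (at y)" by simp
  then have "(flat m has_real_derivative 0) (at y)"
    by (rule has_field_derivative_transform_within_open[where S = "{..<0}"]) (use less in \<open>auto simp: flat_def\<close>)
  then show ?thesis using less by (simp add: flat_def)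
next
  case equal
  have "((\<lambda>h. flat (m + 1) h) \<longlongrightarrow> 0) (at 0)" by (rule flat_tendsto_0)
  then have "((\<lambda>h. (flat m (0 + h) - flat m 0) / h) \<longlongrightarrow> 0) (at 0)"
    by (rule tendsto_cong[THEN iffD1, rotated]) (auto simp: eventually_at_filter flat_def)
  then have "(flat m has_real_derivative 0) (at 0)" by (simp add: DERIV_def)
  then show ?thesis using equal by (simp add: flat_def)
next
  case greater
  have "((\<lambda>x. exp (- (1 / x)) / x ^ m) has_real_derivative
      ((exp (- (1 / y)) * (1 / y^2)) * y ^ m - exp (- (1 / y)) * (real m * y ^ (m - 1))) / (y ^ m * y ^ m)) (at y)"
    using greater by (auto intro!: derivative_eq_intros simp: power2_eq_square)
  also have "((exp (- (1 / y)) * (1 / y^2)) * y ^ m - exp (- (1 / y)) * (real m * y ^ (m - 1))) / (y ^ m * y ^ m)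
      = exp (- (1 / y)) / y ^ (m + 2) - real m * (exp (- (1 / y)) / y ^ (m + 1))"
    using greater by (cases m) (auto simp: field_simps power2_eq_square)
  finally have "(flat m has_real_derivative
      exp (- (1 / y)) / y ^ (m + 2) - real m * (exp (- (1 / y)) / y ^ (m + 1))) (at y)"
    by (rule has_field_derivative_transform_within_open[where S = "{0<..}"])
      (use greater in \<open>auto simp: flat_def\<close>)
  then show ?thesis using greater by (simp add: flat_def)
qed

lemma smooth_flat: "smooth (flat m)"
proof (rule smooth_coinduct[where P = flat_span])
  show "flat_span (flat m)" using flat_span.intros(1)[of 1 m] by simp
  fix f assume "flat_span f"
  then show "\<exists>f'. (\<forall>y. (f has_real_derivative f' y) (at y)) \<and> flat_span f'"
  proof induction
    case (1 c m)
    have "\<forall>y. ((\<lambda>x. c * flat m x) has_real_derivative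
        c * flat (m + 2) y + (- (c * real m)) * flat (m + 1) y) (at y)"
      using DERIV_cmult[OF flat_has_deriv, of c m] by (auto simp: algebra_simps)
    moreover have "flat_span (\<lambda>y. c * flat (m + 2) y + (- (c * real m)) * flat (m + 1) y)"
      by (intro flat_span.intros)
    ultimately show ?case by (intro exI[of _ "\<lambda>y. c * flat (m + 2) y + (- (c * real m)) * flat (m + 1) y"]) blast
  next
    case (2 f g)
    then obtain f' g' where
      "\<forall>y. (f has_real_derivative f' y) (at y)" "flat_span f'"
      "\<forall>y. (g has_real_derivative g' y) (at y)" "flat_span g'" by blast
    then have "(\<forall>y. ((\<lambda>x. f x + g x) has_real_derivative f' y + g' y) (at y)) \<and>
        flat_span (\<lambda>y. f' y + g' y)"
      by (auto intro!: derivative_intros flat_span.intros)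
    then show ?case by (intro exI[of _ "\<lambda>y. f' y + g' y"])
  qed
qed

text \<open>One factor vanishes to the left of \<open>- R\<close>, the other to the right of
  \<open>R\<close>; the arguments have the shape \<open>a * y + c\<close> of
  \<open>smooth_affine\<close>. Nothing is normalised: for \<open>R > 0\<close> the value at the
  centre is positive but below 1.\<close>

definition bump :: "real \<Rightarrow> real \<Rightarrow> real" where
  "bump R y = flat 0 (1 * y + R) * flat 0 ((- 1) * y + R)"

lemma smooth_bump: "smooth (bump R)"
  unfolding bump_def[abs_def] by (intro smooth_mult smooth_affine smooth_flat)

lemma bump_zero: "\<bar>y\<bar> \<ge> R \<Longrightarrow> bump R y = 0"
  by (auto simp: bump_def flat_def)

lemma bump_pos: "\<bar>y\<bar> < R \<Longrightarrow> bump R y > 0"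
  by (auto simp: bump_def flat_def)

lemma bump_le_1: "bump R y \<le> 1"
  by (auto simp: bump_def flat_def mult_le_one)

lemma bump_nonneg: "bump R y \<ge> 0"
  by (auto simp: bump_def flat_def)

lemma test_function_smooth: "test_function \<phi> \<Longrightarrow> smooth \<phi>"
  by (simp add: test_function_iff)

lemma test_function_mult:
  assumes "smooth f" "test_function g" shows "test_function (\<lambda>x. f x * g x)"
  using assms smooth_mult by (auto simp: test_function_iff)

lemma test_function_mult_left:
  assumes "smooth f" "test_function g" shows "test_function (\<lambda>x. g x * f x)"
  using test_function_mult[OF assms] by (simp add: mult.commute)

lemma test_function_bump: "test_function (bump R)"
  unfolding test_function_iff using smooth_bump bump_zero by (auto intro!: exI[of _ R])

lemma test_function_deriv:
  assumes "test_function \<phi>" shows "test_function (deriv \<phi>)"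
proof -
  obtain r where r: "\<And>y. \<bar>y\<bar> > r \<Longrightarrow> \<phi> y = 0" using assms by (auto simp: test_function_def)
  have "deriv \<phi> y = 0" if "\<bar>y\<bar> > r" for y
  proof -
    have "open {y::real. \<bar>y\<bar> > r}" by (intro open_Collect_less continuous_intros)
    have "((\<lambda>x. 0) has_real_derivative 0) (at y)" by simp
    then have "(\<phi> has_real_derivative 0) (at y)"
      by (rule has_field_derivative_transform_within_open[OF _ \<open>open {y. \<bar>y\<bar> > r}\<close>]) (use that r in auto)
    then show ?thesis by (rule DERIV_imp_deriv)
  qed
  then show ?thesis using assms smooth_deriv by (auto simp: test_function_iff)
qed

lemma test_function_funpow_deriv: "test_function \<phi> \<Longrightarrow> test_function ((deriv ^^ n) \<phi>)"
  by (induction n) (auto intro: test_function_deriv)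

lemma test_function_bounded_support:
  assumes "test_function \<phi>"
  obtains r K where "r > 0" "K > 0" "\<And>y. \<bar>\<phi> y\<bar> \<le> K * indicator {-r..r} y"
    "\<And>y. \<bar>y\<bar> \<ge> r \<Longrightarrow> \<phi> y = 0"
proof -
  obtain r where r: "\<And>y. \<bar>y\<bar> > r \<Longrightarrow> \<phi> y = 0" using assms by (auto simp: test_function_def)
  define R where "R = \<bar>r\<bar> + 1"
  have "compact (\<phi> ` {-R..R})"
    by (intro compact_continuous_image smooth_continuous test_function_smooth assms) auto
  then obtain K where K: "K > 0" "\<And>y. y \<in> {-R..R} \<Longrightarrow> \<bar>\<phi> y\<bar> \<le> K"
    by (auto dest!: compact_imp_bounded simp: bounded_pos)
  show ?thesis
    by (rule that[of R K]) (use K r in \<open>auto simp: R_def indicator_def\<close>)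
qed

section \<open>Density of test functions in weighted square integrable functions\<close>

text \<open>Integrability is part of the notion because the Bochner integral of a non-integrable
  function is 0. Two weights occur later: 1, and \<open>1 + (b y)\<^sup>2\<close> for the graph norm
  of multiplication by the shear.\<close>

definition wnear :: "(real \<Rightarrow> real) \<Rightarrow> real \<Rightarrow> (real \<Rightarrow> real) \<Rightarrow> (real \<Rightarrow> real) \<Rightarrow> bool" where
  "wnear w e f g \<longleftrightarrow> integrable lborel (\<lambda>y. w y * (f y - g y)\<^sup>2) \<and> (LINT y|lborel. w y * (f y - g y)\<^sup>2) < e"

lemma wnear_trans:
  assumes "wnear w e1 f g" "wnear w e2 g h"
    and [measurable]: "w \<in> borel_measurable borel" "f \<in> borel_measurable borel" "h \<in> borel_measurable borel"
    and w: "\<And>y. w y \<ge> 0"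
  shows "wnear w (2 * e1 + 2 * e2) f h"
proof -
  let ?d = "\<lambda>y. 2 * (w y * (f y - g y)\<^sup>2) + 2 * (w y * (g y - h y)\<^sup>2)"
  have bnd: "w y * (f y - h y)\<^sup>2 \<le> ?d y" for y
  proof -
    have "(f y - h y)\<^sup>2 \<le> 2 * (f y - g y)\<^sup>2 + 2 * (g y - h y)\<^sup>2"
      using zero_le_power2[of "(f y - g y) - (g y - h y)"] by (simp add: power2_eq_square algebra_simps)
    from mult_left_mono[OF this w[of y]] show ?thesis by (simp add: algebra_simps)
  qed
  have int: "integrable lborel ?d"
    using assms(1,2) unfolding wnear_def by (intro Bochner_Integration.integrable_add integrable_mult_right) auto
  have int': "integrable lborel (\<lambda>y. w y * (f y - h y)\<^sup>2)"
    by (rule Bochner_Integration.integrable_bound[OF int]) (use bnd w in \<open>auto intro!: AE_I2 order_trans[OF bnd]\<close>)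
  have "(LINT y|lborel. w y * (f y - h y)\<^sup>2) \<le> (LINT y|lborel. ?d y)"
    by (rule integral_mono[OF int' int]) (rule bnd)
  also have "\<dots> = 2 * (LINT y|lborel. w y * (f y - g y)\<^sup>2) + 2 * (LINT y|lborel. w y * (g y - h y)\<^sup>2)"
    using assms(1,2) unfolding wnear_def by (subst Bochner_Integration.integral_add) auto
  also have "\<dots> < 2 * e1 + 2 * e2"
    using assms(1,2) unfolding wnear_def by linarith
  finally show ?thesis using int' by (simp add: wnear_def)
qed

lemma wnear_limit:
  assumes [measurable]: "w \<in> borel_measurable borel" "\<And>n. f n \<in> borel_measurable borel" "u \<in> borel_measurable borel"
    and int: "integrable lborel g"
    and bnd: "\<And>n y. \<bar>w y * (f n y - u y)\<^sup>2\<bar> \<le> g y"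
    and lim: "AE y in lborel. (\<lambda>n. f n y) \<longlonglongrightarrow> u y"
    and "e > 0"
  shows "\<exists>n. wnear w e (f n) u"
proof -
  have lim': "AE y in lborel. (\<lambda>n. w y * (f n y - u y)\<^sup>2) \<longlonglongrightarrow> 0"
    using lim
  proof eventually_elim
    case (elim y)
    have "(\<lambda>n. w y * (f n y - u y)\<^sup>2) \<longlonglongrightarrow> w y * (u y - u y)\<^sup>2"
      using elim by (intro tendsto_intros)
    then show ?case by simp
  qed
  have *: "integrable lborel (\<lambda>y. w y * (f n y - u y)\<^sup>2)" for n
    by (rule integrable_dominated_convergence2[OF _ _ int]; fact?)
      (use bnd int in auto)
  have "(\<lambda>n. LINT y|lborel. w y * (f n y - u y)\<^sup>2) \<longlonglongrightarrow> (LINT y::real|lborel. (0::real))"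
    using bnd by (intro integral_dominated_convergence[where w = g] int lim') auto
  then have "\<forall>\<^sub>F n in sequentially. (LINT y|lborel. w y * (f n y - u y)\<^sup>2) < e"
    using \<open>e > 0\<close> by (auto intro: order_tendstoD)
  then obtain n where "(LINT y|lborel. w y * (f n y - u y)\<^sup>2) < e"
    by (auto simp: eventually_sequentially)
  then show ?thesis using * by (auto simp: wnear_def)
qed

text \<open>No mollification: \<open>g\<close> is divided by a bump that is positive on its support,
  the quotient is approximated uniformly by a polynomial, and multiplying the bump back gives a
  smooth function of bounded support.\<close>

lemma wnear_test_continuous:
  assumes w: "continuous_on UNIV w" "\<And>y. w y \<ge> 0"
    and g: "continuous_on UNIV g" "\<And>y. \<bar>y\<bar> \<ge> R \<Longrightarrow> g y = 0" and "R > 0" "e > 0"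
  shows "\<exists>\<phi>. test_function \<phi> \<and> wnear w e \<phi> g"
proof -
  define h where "h = bump (R + 1)"
  have h: "continuous_on A h" for A unfolding h_def by (intro smooth_continuous smooth_bump)
  have "\<exists>x\<in>{-R..R}. \<forall>y\<in>{-R..R}. h x \<le> h y"
    by (rule continuous_attains_inf) (use h \<open>R > 0\<close> in auto)
  then obtain x where x: "x \<in> {-R..R}" "\<And>y. y \<in> {-R..R} \<Longrightarrow> h x \<le> h y" by blast
  have hx: "h x > 0" unfolding h_def by (rule bump_pos) (use x in auto)
  \<comment> \<open>On \<open>{-R..R}\<close> the bump is at least \<open>h x\<close>, so the
    maximum leaves the quotient unchanged there; outside, \<open>g\<close> is 0 and the denominator
    stays positive.\<close>
  define q where "q y = g y / max (h y) (h x)" for y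
  have q: "continuous_on A q" for A
    unfolding q_def using hx by (intro continuous_intros continuous_on_subset[OF g(1)] h) auto
  have hq: "h y * q y = g y" for y
  proof (cases "\<bar>y\<bar> \<le> R")
    case True
    then have "h x \<le> h y" by (intro x(2)) auto
    then show ?thesis using hx by (simp add: q_def max_def)
  qed (simp add: q_def g(2))
  let ?I = "{-(R+1)..R+1}"
  define W where "W = (LINT y|lborel. indicator ?I y *\<^sub>R w y)"
  have Wi: "integrable lborel (\<lambda>y. indicator ?I y *\<^sub>R w y)"
    by (intro borel_integrable_compact continuous_on_subset[OF w(1)]) auto
  have W: "W \<ge> 0" unfolding W_def using w(2) by (intro integral_nonneg_AE AE_I2) auto
  \<comment> \<open>Chosen so that \<open>d\<^sup>2 * W\<close> is at most \<open>e / 4\<close>;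
    \<open>W + 1\<close> stands in for \<open>W\<close>, which may be 0.\<close>
  define d where "d = sqrt (e / (W + 1)) / 2"
  have d: "d > 0" using W \<open>e > 0\<close> by (simp add: d_def)
  obtain p where p: "real_polynomial_function p" "\<And>y. y \<in> ?I \<Longrightarrow> \<bar>q y - p y\<bar> < d"
    using Stone_Weierstrass_real_polynomial_function[of ?I q d] q d by auto
  define \<phi> where "\<phi> y = h y * p y" for y
  have t: "test_function \<phi>"
    unfolding \<phi>_def h_def by (intro test_function_mult_left smooth_polynomial p test_function_bump)
  have b: "w y * (\<phi> y - g y)\<^sup>2 \<le> d\<^sup>2 * (indicator ?I y *\<^sub>R w y)" for y
  proof (cases "y \<in> ?I")
    case True
    have "\<bar>\<phi> y - g y\<bar> = h y * \<bar>q y - p y\<bar>"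
      unfolding \<phi>_def hq[symmetric] using bump_nonneg[of "R + 1" y]
      by (simp add: abs_mult h_def abs_minus_commute flip: right_diff_distrib)
    also have "\<dots> \<le> 1 * d"
      using p(2)[OF True] bump_le_1[of "R + 1" y] bump_nonneg[of "R + 1" y] unfolding h_def by (intro mult_mono) auto
    finally have "(\<phi> y - g y)\<^sup>2 \<le> d\<^sup>2" by (simp add: power2_le_iff_abs_le d less_imp_le)
    from mult_left_mono[OF this w(2)[of y]] show ?thesis using True by (simp add: mult.commute)
  next
    case False
    then have "\<bar>y\<bar> \<ge> R + 1" by auto
    then show ?thesis using False bump_zero[of "R + 1" y] g(2)[of y] by (simp add: \<phi>_def h_def)
  qed
  have [measurable]: "w \<in> borel_measurable borel" "g \<in> borel_measurable borel" "\<phi> \<in> borel_measurable borel"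
    using w(1) g(1) smooth_measurable[OF test_function_smooth[OF t]] by (auto intro: borel_measurable_continuous_onI)
  have int: "integrable lborel (\<lambda>y. w y * (\<phi> y - g y)\<^sup>2)"
    by (rule Bochner_Integration.integrable_bound[OF integrable_mult_right[OF Wi, of "d\<^sup>2"]])
      (use b w(2) in \<open>auto intro!: AE_I2 order_trans[OF b]\<close>)
  have "(LINT y|lborel. w y * (\<phi> y - g y)\<^sup>2) \<le> (LINT y|lborel. d\<^sup>2 * (indicator ?I y *\<^sub>R w y))"
    by (rule integral_mono[OF int integrable_mult_right[OF Wi]]) (rule b)
  also have "\<dots> = d\<^sup>2 * W" by (simp add: W_def)
  also have "\<dots> = e / 4 * (W / (W + 1))" using W \<open>e > 0\<close> by (simp add: d_def power_divide)
  also have "\<dots> \<le> e / 4 * 1" using W \<open>e > 0\<close> by (intro mult_left_mono) auto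
  also have "\<dots> < e" using \<open>e > 0\<close> by simp
  finally show ?thesis using t int by (auto simp: wnear_def)
qed

text \<open>Truncation makes \<open>u\<close> bounded with bounded support, the truncation is an
  almost everywhere limit of continuous functions, and those are covered by
  \<open>wnear_test_continuous\<close>. The errors \<open>e / 8\<close>, \<open>e / 16\<close> and
  \<open>e / 16\<close> combine to \<open>3 / 4 * e\<close> because every triangle step of
  \<open>wnear_trans\<close> doubles.\<close>

theorem wnear_test_dense:
  assumes w: "continuous_on UNIV w" "\<And>y. w y \<ge> 0"
    and u[measurable]: "u \<in> borel_measurable borel" and int: "integrable lborel (\<lambda>y. w y * (u y)\<^sup>2)" and "e > 0"
  shows "\<exists>\<phi>. test_function \<phi> \<and> wnear w e \<phi> u"
proof -
  have [measurable]: "w \<in> borel_measurable borel" using w(1) by (rule borel_measurable_continuous_onI)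
  define v where "v n y = (if \<bar>y\<bar> \<le> real n \<and> \<bar>u y\<bar> \<le> real n then u y else 0)" for n y
  have [measurable]: "v n \<in> borel_measurable borel" for n unfolding v_def by measurable
  have "\<exists>n. wnear w (e / 8) (v n) u"
  proof (rule wnear_limit[OF _ _ _ int])
    show "\<bar>w y * (v n y - u y)\<^sup>2\<bar> \<le> w y * (u y)\<^sup>2" for n y
      using w(2)[of y] by (auto simp: v_def abs_mult)
    show "AE y in lborel. (\<lambda>n. v n y) \<longlonglongrightarrow> u y"
    proof (rule AE_I2)
      fix y
      obtain N where N: "\<bar>y\<bar> \<le> real N" "\<bar>u y\<bar> \<le> real N"
        using real_arch_simple[of "max \<bar>y\<bar> \<bar>u y\<bar>"] by auto
      show "(\<lambda>n. v n y) \<longlonglongrightarrow> u y"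
        by (rule tendsto_eventually, rule eventually_sequentiallyI[of N]) (use N in \<open>auto simp: v_def\<close>)
    qed
  qed (use \<open>e > 0\<close> in auto)
  then obtain n where n: "wnear w (e / 8) (v n) u" by blast
  define K R where "K = real n" and "R = real n + 1"
  have K: "K \<ge> 0" and R: "R > 0" and vK: "\<And>y. \<bar>v n y\<bar> \<le> K" and vR: "\<And>y. \<bar>y\<bar> > R - 1 \<Longrightarrow> v n y = 0"
    by (auto simp: K_def R_def v_def)
  have "v n \<in> borel_measurable lebesgue" by (rule measurable_completion) simp
  then have "v n measurable_on UNIV" by (rule lebesgue_measurable_imp_measurable_on_real) simp
  then obtain N f where N: "negligible N" and fc: "\<And>m. continuous_on UNIV (f m)"
    and fl: "\<And>x. x \<notin> N \<Longrightarrow> (\<lambda>m. f m x) \<longlonglongrightarrow> v n x"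
    unfolding measurable_on_def by auto
  \<comment> \<open>The cutoff is 1 up to \<open>R - 1\<close> and 0 from \<open>R\<close> on, and
    values are clamped to \<open>{-K..K}\<close>. Neither affects the limit \<open>v n\<close>, and
    together they supply the dominating function.\<close>
  define \<tau> where "\<tau> y = max 0 (min 1 (R - \<bar>y\<bar>))" for y
  define g where "g m y = \<tau> y * max (- K) (min K (f m y))" for m y
  have g: "continuous_on UNIV (g m)" for m
    unfolding g_def \<tau>_def by (intro continuous_intros fc)
  have gR: "g m y = 0" if "\<bar>y\<bar> \<ge> R" for m y using that by (simp add: g_def \<tau>_def)
  have gK: "\<bar>g m y\<bar> \<le> K" for m y
  proof -
    have "\<bar>g m y\<bar> \<le> 1 * K" unfolding g_def abs_mult using K by (intro mult_mono) (auto simp: \<tau>_def)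
    then show ?thesis by simp
  qed
  have gl: "(\<lambda>m. g m y) \<longlonglongrightarrow> v n y" if "y \<notin> N" for y
  proof -
    have "(\<lambda>m. g m y) \<longlonglongrightarrow> \<tau> y * max (- K) (min K (v n y))"
      unfolding g_def using fl[OF that] by (intro tendsto_intros)
    also have "max (- K) (min K (v n y)) = v n y" using vK[of y] by auto
    also have "\<tau> y * v n y = v n y" using vR[of y] by (cases "\<bar>y\<bar> > R - 1") (auto simp: \<tau>_def)
    finally show ?thesis .
  qed
  have [measurable]: "g m \<in> borel_measurable borel" for m using g by (rule borel_measurable_continuous_onI)
  have "\<exists>m. wnear w (e / 16) (g m) (v n)"
  proof (rule wnear_limit)
    show "integrable lborel (\<lambda>y. (2 * K)\<^sup>2 * (indicator {-R..R} y *\<^sub>R w y))"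
      by (intro integrable_mult_right borel_integrable_compact continuous_on_subset[OF w(1)]) auto
    show "\<bar>w y * (g m y - v n y)\<^sup>2\<bar> \<le> (2 * K)\<^sup>2 * (indicator {-R..R} y *\<^sub>R w y)" for m y
    proof (cases "\<bar>y\<bar> \<le> R")
      case True
      have "\<bar>g m y - v n y\<bar> \<le> 2 * K" using gK[of m y] vK[of y] by linarith
      then have "(g m y - v n y)\<^sup>2 \<le> (2 * K)\<^sup>2" using K by (intro abs_le_square_iff[THEN iffD1]) auto
      from mult_left_mono[OF this w(2)[of y]] show ?thesis
        using True w(2)[of y] by (simp add: abs_mult abs_le_iff mult.commute indicator_def)
    qed (use gR[of y m] vR[of y] w(2)[of y] in \<open>auto simp: abs_mult\<close>)
    have "N \<in> null_sets lebesgue" using N by (simp add: negligible_iff_null_sets)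
    then have "AE y in lebesgue. (\<lambda>m. g m y) \<longlonglongrightarrow> v n y"
      by (rule AE_I'[of N]) (use gl in auto)
    then show "AE y in lborel. (\<lambda>m. g m y) \<longlonglongrightarrow> v n y" by (simp add: AE_completion_iff)
  qed (use \<open>e > 0\<close> in auto)
  then obtain m where m: "wnear w (e / 16) (g m) (v n)" by blast
  obtain \<phi> where \<phi>: "test_function \<phi>" "wnear w (e / 16) \<phi> (g m)"
    using wnear_test_continuous[OF w g gR R, of "e / 16"] \<open>e > 0\<close> by auto
  have [measurable]: "\<phi> \<in> borel_measurable borel" using \<phi>(1) test_function_smooth smooth_measurable by blast
  have "wnear w (2 * (e / 16) + 2 * (e / 16)) \<phi> (v n)" by (rule wnear_trans[OF \<phi>(2) m _ _ _ w(2)]) auto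
  from wnear_trans[OF this n _ _ _ w(2)] have "wnear w (2 * (2 * (e / 16) + 2 * (e / 16)) + 2 * (e / 8)) \<phi> u" by auto
  then have "wnear w (3 / 4 * e) \<phi> u" by (simp add: algebra_simps)
  then show ?thesis using \<phi>(1) \<open>e > 0\<close> by (auto simp: wnear_def intro!: exI[of _ \<phi>])
qed

section \<open>Square integrable functions and convolution with exponential kernels\<close>

lemma mult_le_sum_squares: "a * b \<le> a\<^sup>2 + (b\<^sup>2 :: real)"
  using sum_squares_bound[of a b] zero_le_power2[of a] zero_le_power2[of b] by linarith

lemma Ltwo_measurable [measurable_dest]: "f \<in> Ltwo \<Longrightarrow> f \<in> borel_measurable borel"
  by (simp add: Ltwo_def)

lemma Ltwo_integrable: "f \<in> Ltwo \<Longrightarrow> integrable lborel (\<lambda>y. (norm (f y))\<^sup>2)"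
  by (simp add: Ltwo_def)

lemma LtwoI:
  "f \<in> borel_measurable borel \<Longrightarrow> integrable lborel (\<lambda>y. (norm (f y))\<^sup>2) \<Longrightarrow> f \<in> Ltwo"
  by (simp add: Ltwo_def)

lemma Ltwo_bound:
  assumes [measurable]: "f \<in> borel_measurable borel" and g: "g \<in> Ltwo"
    and "AE y in lborel. norm (f y) \<le> norm (g y)"
  shows "f \<in> Ltwo"
proof (rule LtwoI)
  show "integrable lborel (\<lambda>y. (norm (f y))\<^sup>2)"
    by (rule Bochner_Integration.integrable_bound[OF Ltwo_integrable[OF g]])
      (use assms(3) in \<open>auto elim!: eventually_mono intro: power_mono\<close>)
qed fact

lemma Ltwo_scaleR: "f \<in> Ltwo \<Longrightarrow> (\<lambda>y. c *\<^sub>R f y) \<in> Ltwo"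
  by (rule LtwoI) (auto simp: power_mult_distrib Ltwo_integrable)

lemma Ltwo_add:
  assumes f[measurable]: "f \<in> Ltwo" and g[measurable]: "g \<in> Ltwo"
  shows "(\<lambda>y. f y + g y) \<in> Ltwo"
proof (rule LtwoI)
  have "integrable lborel (\<lambda>y. 2 * (norm (f y))\<^sup>2 + 2 * (norm (g y))\<^sup>2)"
    using f g by (intro Bochner_Integration.integrable_add integrable_mult_right Ltwo_integrable)
  moreover have "(norm (f y + g y))\<^sup>2 \<le> 2 * (norm (f y))\<^sup>2 + 2 * (norm (g y))\<^sup>2" for y
  proof -
    have "(norm (f y + g y))\<^sup>2 \<le> (norm (f y) + norm (g y))\<^sup>2" by (intro power_mono norm_triangle_ineq) simp
    also have "\<dots> \<le> 2 * (norm (f y))\<^sup>2 + 2 * (norm (g y))\<^sup>2"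
      using zero_le_power2[of "norm (f y) - norm (g y)"] by (simp add: power2_eq_square algebra_simps)
    finally show ?thesis .
  qed
  ultimately show "integrable lborel (\<lambda>y. (norm (f y + g y))\<^sup>2)"
    by (elim Bochner_Integration.integrable_bound) (auto intro!: AE_I2)
qed measurable

lemma Ltwo_diff: "f \<in> Ltwo \<Longrightarrow> g \<in> Ltwo \<Longrightarrow> (\<lambda>y. f y - g y) \<in> Ltwo"
  using Ltwo_add[of f "\<lambda>y. (-1) *\<^sub>R g y"] Ltwo_scaleR[of g "-1"] by simp

lemma Ltwo_norm_nonneg [simp]: "0 \<le> Ltwo_norm f"
  by (simp add: Ltwo_norm_def)

lemma Ltwo_norm_sq: "(Ltwo_norm f)\<^sup>2 = (LINT y|lborel. (norm (f y))\<^sup>2)"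
  by (simp add: Ltwo_norm_def)

lemma Ltwo_norm_scaleR: "Ltwo_norm (\<lambda>y. c *\<^sub>R f y) = \<bar>c\<bar> * Ltwo_norm f"
  by (simp add: Ltwo_norm_def power_mult_distrib real_sqrt_mult)

lemma Ltwo_norm_mono:
  assumes f: "f \<in> borel_measurable borel" and g: "g \<in> Ltwo"
    and le: "AE y in lborel. norm (f y) \<le> norm (g y)"
  shows "Ltwo_norm f \<le> Ltwo_norm g"
  unfolding Ltwo_norm_def
proof (intro real_sqrt_le_mono integral_mono_AE Ltwo_integrable Ltwo_bound[OF f g le] g)
  show "AE x in lborel. (norm (f x))\<^sup>2 \<le> (norm (g x))\<^sup>2"
    using le by eventually_elim (auto intro: power_mono)
qed

lemma Ltwo_norm_cong_AE:
  assumes "f \<in> borel_measurable borel" "g \<in> borel_measurable borel" "AE y in lborel. f y = g y"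
  shows "Ltwo_norm f = Ltwo_norm g"
  unfolding Ltwo_norm_def using assms by (intro arg_cong[where f = sqrt] integral_cong_AE) auto

text \<open>Cauchy-Schwarz from the non-negative quadratic
  \<open>s\<^sup>2 * A - 2 * s * C + B\<close>, evaluated at \<open>C / A\<close> or, if
  \<open>A = 0\<close>, at a point where it would equal -1.\<close>

lemma Ltwo_product:
  assumes f[measurable]: "f \<in> Ltwo" and g[measurable]: "g \<in> Ltwo"
  shows "integrable lborel (\<lambda>y. norm (f y) * norm (g y))" (is ?int)
    and "(LINT y|lborel. norm (f y) * norm (g y)) \<le> Ltwo_norm f * Ltwo_norm g"
proof -
  show i: ?int
  proof (rule Bochner_Integration.integrable_bound)
    show "integrable lborel (\<lambda>y. (norm (f y))\<^sup>2 + (norm (g y))\<^sup>2)"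
      using f g by (intro Bochner_Integration.integrable_add Ltwo_integrable)
    show "AE y in lborel. norm (norm (f y) * norm (g y)) \<le> norm ((norm (f y))\<^sup>2 + (norm (g y))\<^sup>2)"
      using mult_le_sum_squares by auto
  qed measurable
  define A B C where "A = (LINT y|lborel. (norm (f y))\<^sup>2)" and "B = (LINT y|lborel. (norm (g y))\<^sup>2)"
    and "C = (LINT y|lborel. norm (f y) * norm (g y))"
  have A: "A \<ge> 0" and B: "B \<ge> 0" and C: "C \<ge> 0" by (auto simp: A_def B_def C_def)
  have q: "s\<^sup>2 * A - 2 * s * C + B \<ge> 0" for s
  proof -
    have "0 \<le> (LINT y|lborel. (s * norm (f y) - norm (g y))\<^sup>2)" by simp
    also have "\<dots> = (LINT y|lborel. s\<^sup>2 * (norm (f y))\<^sup>2 - (2 * s) * (norm (f y) * norm (g y)) + (norm (g y))\<^sup>2)"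
      by (intro Bochner_Integration.integral_cong) (auto simp: power2_eq_square algebra_simps)
    also have "\<dots> = s\<^sup>2 * A - 2 * s * C + B"
      using i Ltwo_integrable[OF f] Ltwo_integrable[OF g] by (simp add: A_def B_def C_def)
    finally show ?thesis .
  qed
  have "C\<^sup>2 \<le> A * B"
  proof (cases "A = 0")
    case True
    have "C = 0"
    proof (rule ccontr)
      assume "C \<noteq> 0"
      then show False using q[of "(B + 1) / (2 * C)"] True C by (simp add: field_simps)
    qed
    then show ?thesis using A B by simp
  next
    case False
    then show ?thesis using q[of "C / A"] A by (simp add: field_simps power2_eq_square)
  qed
  then have "C \<le> sqrt (A * B)" using real_le_rsqrt by blast
  then show "C \<le> Ltwo_norm f * Ltwo_norm g" by (simp add: Ltwo_norm_def A_def B_def real_sqrt_mult)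
qed

lemma Ltwo_norm_triangle:
  assumes f: "f \<in> Ltwo" and g: "g \<in> Ltwo"
  shows "Ltwo_norm (\<lambda>y. f y + g y) \<le> Ltwo_norm f + Ltwo_norm g"
proof (rule power2_le_imp_le)
  have "(Ltwo_norm (\<lambda>y. f y + g y))\<^sup>2 = (LINT y|lborel. (norm (f y + g y))\<^sup>2)" by (rule Ltwo_norm_sq)
  also have "\<dots> \<le> (LINT y|lborel. (norm (f y))\<^sup>2 + 2 * (norm (f y) * norm (g y)) + (norm (g y))\<^sup>2)"
  proof (rule integral_mono)
    show "integrable lborel (\<lambda>y. (norm (f y))\<^sup>2 + 2 * (norm (f y) * norm (g y)) + (norm (g y))\<^sup>2)"
      using f g by (intro Bochner_Integration.integrable_add integrable_mult_right Ltwo_integrable Ltwo_product)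
    show "(norm (f y + g y))\<^sup>2 \<le> (norm (f y))\<^sup>2 + 2 * (norm (f y) * norm (g y)) + (norm (g y))\<^sup>2" for y
      using power_mono[OF norm_triangle_ineq[of "f y" "g y"], of 2] by (simp add: power2_eq_square algebra_simps)
  qed (intro Ltwo_integrable Ltwo_add f g)
  also have "\<dots> = (Ltwo_norm f)\<^sup>2 + 2 * (LINT y|lborel. norm (f y) * norm (g y)) + (Ltwo_norm g)\<^sup>2"
    using f g by (simp add: Ltwo_norm_sq Ltwo_integrable Ltwo_product)
  also have "\<dots> \<le> (Ltwo_norm f + Ltwo_norm g)\<^sup>2"
    using Ltwo_product(2)[OF f g] by (simp add: power2_eq_square algebra_simps)
  finally show "(Ltwo_norm (\<lambda>y. f y + g y))\<^sup>2 \<le> (Ltwo_norm f + Ltwo_norm g)\<^sup>2" .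
qed simp

lemma Ltwo_norm_triangle_diff:
  assumes f: "f \<in> Ltwo" and g: "g \<in> Ltwo"
  shows "\<bar>Ltwo_norm f - Ltwo_norm g\<bar> \<le> Ltwo_norm (\<lambda>y. f y - g y)"
proof -
  have "Ltwo_norm f \<le> Ltwo_norm (\<lambda>y. f y - g y) + Ltwo_norm g"
    using Ltwo_norm_triangle[OF Ltwo_diff[OF f g] g] by simp
  moreover have "Ltwo_norm g \<le> Ltwo_norm (\<lambda>y. f y - g y) + Ltwo_norm f"
    using Ltwo_norm_triangle[OF Ltwo_diff[OF g f] f] by (simp add: Ltwo_norm_def norm_minus_commute)
  ultimately show ?thesis by linarith
qed

lemma Ltwo_norm_eq_0:
  assumes "f \<in> Ltwo" "Ltwo_norm f = 0" shows "AE y in lborel. f y = 0"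
proof -
  have "(LINT y|lborel. (norm (f y))\<^sup>2) = 0" using assms(2) by (simp add: Ltwo_norm_def)
  then have "AE y in lborel. (norm (f y))\<^sup>2 = 0"
    using integral_nonneg_eq_0_iff_AE[OF Ltwo_integrable[OF assms(1)]] by auto
  then show ?thesis by eventually_elim simp
qed

text \<open>Kept general in \<open>p\<close> because scaling by a real function and the complex
  product both serve as pairings below.\<close>

lemma Ltwo_bilinear:
  assumes "bounded_bilinear p" and f[measurable]: "f \<in> Ltwo" and g[measurable]: "g \<in> Ltwo"
  shows "integrable lborel (\<lambda>y. p (f y) (g y) :: 'c :: {banach, second_countable_topology})"
proof -
  interpret bounded_bilinear p by fact
  obtain K where K: "K > 0" "\<And>a b. norm (p a b) \<le> norm a * norm b * K" using pos_bounded by blast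
  have [measurable]: "(\<lambda>y. p (f y) (g y)) \<in> borel_measurable borel"
    by (rule borel_measurable_continuous_Pair) (auto intro!: continuous_on continuous_intros)
  show ?thesis
    by (rule Bochner_Integration.integrable_bound[OF integrable_mult_left[OF Ltwo_product(1)[OF f g], of K]])
      (use K in \<open>auto intro!: AE_I2 order_trans[OF K(2)]\<close>)
qed

lemma Ltwo_mult:
  fixes f g :: "real \<Rightarrow> complex"
  assumes "f \<in> Ltwo" "g \<in> Ltwo"
  shows "integrable lborel (\<lambda>y. f y * g y)" "norm (LINT y|lborel. f y * g y) \<le> Ltwo_norm f * Ltwo_norm g"
proof -
  show "integrable lborel (\<lambda>y. f y * g y)" by (rule Ltwo_bilinear[OF bounded_bilinear_mult assms])
  have "norm (LINT y|lborel. f y * g y) \<le> (LINT y|lborel. norm (f y * g y))" by (rule integral_norm_bound)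
  also have "\<dots> \<le> Ltwo_norm f * Ltwo_norm g" using Ltwo_product(2)[OF assms] by (simp add: norm_mult)
  finally show "norm (LINT y|lborel. f y * g y) \<le> Ltwo_norm f * Ltwo_norm g" .
qed

lemma indicator_Ltwo:
  assumes "A \<in> sets lborel" "emeasure lborel A < \<infinity>" shows "indicat_real A \<in> Ltwo"
proof (rule LtwoI)
  have "(norm (indicat_real A y))\<^sup>2 = indicator A y" for y by (simp add: indicator_def)
  then show "integrable lborel (\<lambda>y. (norm (indicat_real A y))\<^sup>2)" using assms by simp
qed (use assms in auto)

lemma Ltwo_locally_integrable:
  assumes "f \<in> Ltwo" shows "locally_integrable f"
  unfolding locally_integrable_def set_integrable_def
proof (intro allI)
  fix a b :: real
  have "indicat_real {a..b} \<in> Ltwo" by (rule indicator_Ltwo) (auto simp: emeasure_lborel_Icc_eq)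
  from Ltwo_bilinear[OF bounded_bilinear_scaleR this assms]
  show "integrable lborel (\<lambda>y. indicat_real {a..b} y *\<^sub>R f y)" .
qed

lemma Ltwo_set_integrable: "f \<in> Ltwo \<Longrightarrow> set_integrable lborel {p..q} f"
  using Ltwo_locally_integrable by (auto simp: locally_integrable_def)

section \<open>Convolution with exponentially decaying kernels\<close>

definition expk :: "real \<Rightarrow> real \<Rightarrow> real" where
  "expk \<kappa> x = exp (- (\<kappa> * \<bar>x\<bar>))"

lemma expk_measurable [measurable]: "expk \<kappa> \<in> borel_measurable borel"
  unfolding expk_def[abs_def] by measurable

lemma expk_pos [simp]: "0 < expk \<kappa> x" and expk_nonneg [simp]: "0 \<le> expk \<kappa> x"
  by (auto simp: expk_def)

lemma expk_le_1: "\<kappa> > 0 \<Longrightarrow> expk \<kappa> x \<le> 1"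
  by (auto simp: expk_def)

lemma expk_minus: "expk \<kappa> (- x) = expk \<kappa> x"
  by (auto simp: expk_def)

lemma expk_commute: "expk \<kappa> (x - y) = expk \<kappa> (y - x)"
  by (auto simp: expk_def)

lemma integrable_expk:
  assumes "\<kappa> > 0" shows "integrable lborel (expk \<kappa>)"
proof -
  let ?e = "\<lambda>x::real. exp (- x) * indicator {0..} x"
  have e: "integrable lborel ?e"
    using has_bochner_integral_I0i_power_exp_m'[of 0] by (auto simp: has_bochner_integral_iff)
  have "integrable lborel (\<lambda>x. ?e (0 + \<kappa> * x) + ?e (0 + (- \<kappa>) * x))"
    using assms by (intro Bochner_Integration.integrable_add lborel_integrable_real_affine e) auto
  then show ?thesis
    by (rule Bochner_Integration.integrable_bound)
      (use assms in \<open>auto simp: expk_def indicator_def zero_le_mult_iff mult_le_0_iff abs_if intro!: AE_I2\<close>)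
qed

lemma integrable_reflect:
  fixes f :: "real \<Rightarrow> 'a :: {banach, second_countable_topology}"
  shows "integrable lborel f \<Longrightarrow> integrable lborel (\<lambda>z. f (y - z))"
  using lborel_integrable_real_affine[of f "-1" y] by simp

lemma integral_reflect:
  fixes f :: "real \<Rightarrow> 'a :: {banach, second_countable_topology}"
  shows "(LINT z|lborel. f (y - z)) = (LINT z|lborel. f z)"
  using lborel_integral_real_affine[of "-1" f y] by simp

lemma Ltwo_reflect:
  assumes "f \<in> Ltwo" shows "(\<lambda>z. f (y - z)) \<in> Ltwo"
proof (rule LtwoI)
  have [measurable]: "f \<in> borel_measurable borel" using assms by (rule Ltwo_measurable)
  show "(\<lambda>z. f (y - z)) \<in> borel_measurable borel" by measurable
qed (rule integrable_reflect[OF Ltwo_integrable[OF assms]])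

lemma Ltwo_norm_reflect: "Ltwo_norm (\<lambda>z. f (y - z)) = Ltwo_norm f"
  by (simp add: Ltwo_norm_def integral_reflect[of "\<lambda>z. (norm (f z))\<^sup>2"])

text \<open>One majorant covers \<open>expk\<close>, its discontinuous companion \<open>sgnk\<close>
  and their reflections, so convolution needs to be studied only once.\<close>

definition exp_kernel :: "real \<Rightarrow> (real \<Rightarrow> real) \<Rightarrow> bool" where
  "exp_kernel \<kappa> k \<longleftrightarrow> 0 < \<kappa> \<and> k \<in> borel_measurable borel \<and> (\<forall>x. \<bar>k x\<bar> \<le> expk \<kappa> x)"

lemma exp_kernel_expk: "\<kappa> > 0 \<Longrightarrow> exp_kernel \<kappa> (expk \<kappa>)"
  by (simp add: exp_kernel_def)

lemma exp_kernel_measurable [measurable_dest]: "exp_kernel \<kappa> k \<Longrightarrow> k \<in> borel_measurable borel"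
  by (simp add: exp_kernel_def)

lemma exp_kernel_reflect: "exp_kernel \<kappa> k \<Longrightarrow> exp_kernel \<kappa> (\<lambda>x. k (- x))"
proof -
  assume k: "exp_kernel \<kappa> k"
  then have [measurable]: "k \<in> borel_measurable borel" by measurable
  have "\<bar>k (- x)\<bar> \<le> expk \<kappa> x" for x using k expk_minus[of \<kappa> x] unfolding exp_kernel_def by metis
  then show ?thesis using k by (simp add: exp_kernel_def)
qed

lemma expk_Ltwo: "\<kappa> > 0 \<Longrightarrow> expk \<kappa> \<in> Ltwo"
proof (rule LtwoI)
  assume "\<kappa> > 0"
  show "integrable lborel (\<lambda>y. (norm (expk \<kappa> y))\<^sup>2)"
    by (rule Bochner_Integration.integrable_bound[OF integrable_expk[OF \<open>\<kappa> > 0\<close>]])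
      (use expk_le_1[OF \<open>\<kappa> > 0\<close>] in \<open>auto simp: power2_eq_square mult_left_le\<close>)
qed simp

lemma exp_kernel_Ltwo: "exp_kernel \<kappa> k \<Longrightarrow> k \<in> Ltwo"
  by (rule Ltwo_bound[OF _ expk_Ltwo[of \<kappa>]]) (auto simp: exp_kernel_def)

definition conv :: "(real \<Rightarrow> real) \<Rightarrow> (real \<Rightarrow> 'a) \<Rightarrow> real \<Rightarrow> 'a::{banach, second_countable_topology}" where
  "conv k \<omega> y = (LINT z|lborel. k (y - z) *\<^sub>R \<omega> z)"

lemma conv_integrable:
  assumes "exp_kernel \<kappa> k" "\<omega> \<in> Ltwo" shows "integrable lborel (\<lambda>z. k (y - z) *\<^sub>R \<omega> z)"
  by (rule Ltwo_bilinear[OF bounded_bilinear_scaleR Ltwo_reflect[OF exp_kernel_Ltwo[OF assms(1)]] assms(2)])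

lemma conv_le_expk:
  assumes "exp_kernel \<kappa> k" "\<omega> \<in> Ltwo"
  shows "norm (conv k \<omega> y) \<le> (LINT z|lborel. expk \<kappa> (y - z) * norm (\<omega> z))"
proof -
  have "norm (conv k \<omega> y) \<le> (LINT z|lborel. norm (k (y - z) *\<^sub>R \<omega> z))"
    unfolding conv_def by (rule integral_norm_bound)
  also have "\<dots> \<le> (LINT z|lborel. expk \<kappa> (y - z) * norm (\<omega> z))"
  proof (rule integral_mono)
    have "integrable lborel (\<lambda>z. norm (expk \<kappa> (y - z) *\<^sub>R \<omega> z))"
      using assms by (intro integrable_norm conv_integrable[of \<kappa>] exp_kernel_expk) (auto simp: exp_kernel_def)
    then show "integrable lborel (\<lambda>z. expk \<kappa> (y - z) * norm (\<omega> z))" by simp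
    show "integrable lborel (\<lambda>z. norm (k (y - z) *\<^sub>R \<omega> z))"
      by (intro integrable_norm conv_integrable[OF assms])
  qed (use assms in \<open>auto simp: exp_kernel_def intro!: mult_right_mono\<close>)
  finally show ?thesis .
qed

text \<open>Cauchy-Schwarz. The integral on the left is the form in which the size of \<omega>
  enters the pointwise estimates of the potential. \<open>expk_integral_le_AE\<close> bounds it
  through a supremum instead, and so either norm can be used later.\<close>

lemma expk_integral_le_Ltwo:
  assumes "\<kappa> > 0" "\<omega> \<in> Ltwo"
  shows "(LINT z|lborel. expk \<kappa> (y - z) * norm (\<omega> z)) \<le> Ltwo_norm (expk \<kappa>) * Ltwo_norm \<omega>"
  using Ltwo_product(2)[OF Ltwo_reflect[OF expk_Ltwo[OF assms(1)], of y] assms(2)]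
  by (simp add: Ltwo_norm_reflect)

lemma conv_measurable [measurable]:
  assumes [measurable]: "k \<in> borel_measurable borel" "\<omega> \<in> borel_measurable borel"
  shows "conv k \<omega> \<in> borel_measurable borel"
proof -
  have "(\<lambda>y. LINT z|lborel. k (y - z) *\<^sub>R \<omega> z) \<in> borel_measurable borel" by measurable
  then show ?thesis by (simp add: conv_def[abs_def])
qed

lemma integrable_expk_pair:
  assumes "\<kappa> > 0" and [measurable]: "f \<in> borel_measurable borel" and f: "integrable lborel f" and f0: "\<And>y. f y \<ge> (0::real)"
  shows "integrable (lborel \<Otimes>\<^sub>M lborel) (\<lambda>(y, z). expk \<kappa> (y - z) * f y)"
    and "integrable (lborel \<Otimes>\<^sub>M lborel) (\<lambda>(y, z). expk \<kappa> (y - z) * f z)"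
proof -
  show *: "integrable (lborel \<Otimes>\<^sub>M lborel) (\<lambda>(y, z). expk \<kappa> (y - z) * f y)"
  proof (rule lborel_pair.Fubini_integrable)
    have "(LINT z|lborel. norm (case (y, z) of (y, z) \<Rightarrow> expk \<kappa> (y - z) * f y)) = f y * integral\<^sup>L lborel (expk \<kappa>)" for y
      using f0 by (simp add: abs_mult integral_reflect)
    then show "integrable lborel (\<lambda>y. LINT z|lborel. norm (case (y, z) of (y, z) \<Rightarrow> expk \<kappa> (y - z) * f y))"
      using f by simp
    show "AE y in lborel. integrable lborel (\<lambda>z. case (y, z) of (y, z) \<Rightarrow> expk \<kappa> (y - z) * f y)"
      using integrable_reflect[OF integrable_expk[OF \<open>\<kappa> > 0\<close>]] by auto
  qed measurable
  from lborel_pair.integrable_product_swap[OF *]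
  show "integrable (lborel \<Otimes>\<^sub>M lborel) (\<lambda>(y, z). expk \<kappa> (y - z) * f z)"
    by (simp add: expk_commute split_beta')
qed

text \<open>Schur's test: the kernel is split into two square roots, Cauchy-Schwarz in
  \<open>z\<close> bounds the square of the convolution by \<open>C\<close> times the convolution of
  the squared norm of \<omega>, and the latter is integrable by Fubini.\<close>

lemma conv_Ltwo:
  assumes k: "exp_kernel \<kappa> k" and \<omega>[measurable]: "\<omega> \<in> Ltwo" shows "conv k \<omega> \<in> Ltwo"
proof (rule LtwoI)
  have \<kappa>: "\<kappa> > 0" and [measurable]: "k \<in> borel_measurable borel" using k by (auto simp: exp_kernel_def)
  show "conv k \<omega> \<in> borel_measurable borel" by measurable
  define C where "C = integral\<^sup>L lborel (expk \<kappa>)"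
  have "C \<ge> 0" by (simp add: C_def)
  let ?g = "\<lambda>y. LINT z|lborel. expk \<kappa> (y - z) * (norm (\<omega> z))\<^sup>2"
  have "integrable lborel ?g"
    using lborel_pair.integrable_fst'[OF integrable_expk_pair(2)[OF \<kappa> _ Ltwo_integrable[OF \<omega>]]] by simp
  then have g: "integrable lborel (\<lambda>y. C * ?g y)" by simp
  have le: "(norm (conv k \<omega> y))\<^sup>2 \<le> C * ?g y" if y: "integrable lborel (\<lambda>z. expk \<kappa> (y - z) * (norm (\<omega> z))\<^sup>2)" for y
  proof -
    let ?s = "\<lambda>z. sqrt (expk \<kappa> (y - z))"
    have 1: "?s \<in> Ltwo" by (rule LtwoI) (use integrable_reflect[OF integrable_expk[OF \<kappa>], of y] in auto)
    have 2: "(\<lambda>z. ?s z * norm (\<omega> z)) \<in> Ltwo"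
      by (rule LtwoI) (use y in \<open>auto simp: power_mult_distrib\<close>)
    have "norm (conv k \<omega> y) \<le> (LINT z|lborel. norm (?s z) * norm (?s z * norm (\<omega> z)))"
      using conv_le_expk[OF k \<omega>, of y] by (simp add: abs_mult flip: mult.assoc)
    also have "\<dots> \<le> Ltwo_norm ?s * Ltwo_norm (\<lambda>z. ?s z * norm (\<omega> z))" by (rule Ltwo_product(2)[OF 1 2])
    finally have "(norm (conv k \<omega> y))\<^sup>2 \<le> (Ltwo_norm ?s * Ltwo_norm (\<lambda>z. ?s z * norm (\<omega> z)))\<^sup>2"
      by (intro power_mono) auto
    also have "\<dots> = C * ?g y" by (simp add: power_mult_distrib Ltwo_norm_sq C_def integral_reflect)
    finally show ?thesis .
  qed
  have "AE y in lborel. integrable lborel (\<lambda>z. expk \<kappa> (y - z) * (norm (\<omega> z))\<^sup>2)"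
    using lborel_pair.AE_integrable_fst'[OF integrable_expk_pair(2)[OF \<kappa> _ Ltwo_integrable[OF \<omega>]]] by simp
  then have "AE y in lborel. norm ((norm (conv k \<omega> y))\<^sup>2) \<le> norm (C * ?g y)"
    by eventually_elim (use le in \<open>auto intro!: order_trans[OF le]\<close>)
  then show "integrable lborel (\<lambda>y. (norm (conv k \<omega> y))\<^sup>2)"
    by (rule Bochner_Integration.integrable_bound[OF g, rotated]) simp
qed

text \<open>Fubini, with the reflected kernel as the adjoint. The product of the norms is at most
  the sum of their squares, which reduces absolute integrability to
  \<open>integrable_expk_pair\<close>.\<close>

lemma conv_swap:
  assumes p: "bounded_bilinear p" and k: "exp_kernel \<kappa> k" and u[measurable]: "u \<in> Ltwo" and \<omega>[measurable]: "\<omega> \<in> Ltwo"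
  shows "(LINT y|lborel. p (u y) (conv k \<omega> y)) =
    (LINT z|lborel. p (conv (\<lambda>x. k (- x)) u z) (\<omega> z) :: 'c :: {banach, second_countable_topology})"
proof -
  interpret bounded_bilinear p by fact
  obtain K where K: "K > 0" "\<And>a b. norm (p a b) \<le> norm a * norm b * K" using pos_bounded by blast
  have \<kappa>: "\<kappa> > 0" and [measurable]: "k \<in> borel_measurable borel" using k by (auto simp: exp_kernel_def)
  let ?f = "\<lambda>y z. k (y - z) *\<^sub>R p (u y) (\<omega> z)"
  have [measurable]: "u \<in> borel_measurable borel" "\<omega> \<in> borel_measurable borel"
    using u \<omega> by (auto dest: Ltwo_measurable)
  have [measurable]: "(\<lambda>x. p (u (fst x)) (\<omega> (snd x))) \<in> borel_measurable (borel \<Otimes>\<^sub>M borel)"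
  proof (rule borel_measurable_continuous_Pair[where H = p])
    show "(\<lambda>x. u (fst x)) \<in> borel_measurable (borel \<Otimes>\<^sub>M borel)" by measurable
    show "(\<lambda>x. \<omega> (snd x)) \<in> borel_measurable (borel \<Otimes>\<^sub>M borel)" by measurable
  qed (auto intro!: continuous_on continuous_intros)
  have int: "integrable (lborel \<Otimes>\<^sub>M lborel) (\<lambda>(y, z). ?f y z)"
  proof (rule Bochner_Integration.integrable_bound)
    show "integrable (lborel \<Otimes>\<^sub>M lborel)
        (\<lambda>x. K * ((case x of (y, z) \<Rightarrow> expk \<kappa> (y - z) * (norm (u y))\<^sup>2) + (case x of (y, z) \<Rightarrow> expk \<kappa> (y - z) * (norm (\<omega> z))\<^sup>2)))"
      by (intro integrable_mult_right Bochner_Integration.integrable_add integrable_expk_pair \<kappa> Ltwo_integrable u \<omega>) auto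
    show "(\<lambda>(y, z). ?f y z) \<in> borel_measurable (lborel \<Otimes>\<^sub>M lborel)"
      unfolding split_beta' by measurable
    have "norm (?f y z) \<le> K * (expk \<kappa> (y - z) * (norm (u y))\<^sup>2 + expk \<kappa> (y - z) * (norm (\<omega> z))\<^sup>2)" for y z
    proof -
      have "norm (u y) * norm (\<omega> z) \<le> (norm (u y))\<^sup>2 + (norm (\<omega> z))\<^sup>2" by (rule mult_le_sum_squares)
      then have "norm (p (u y) (\<omega> z)) \<le> ((norm (u y))\<^sup>2 + (norm (\<omega> z))\<^sup>2) * K"
        using K(1) by (intro order_trans[OF K(2)] mult_right_mono) auto
      moreover have "\<bar>k (y - z)\<bar> \<le> expk \<kappa> (y - z)" using k by (simp add: exp_kernel_def)
      ultimately have "norm (?f y z) \<le> expk \<kappa> (y - z) * (((norm (u y))\<^sup>2 + (norm (\<omega> z))\<^sup>2) * K)"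
        by (simp add: mult_mono)
      then show ?thesis by (simp add: algebra_simps)
    qed
    then show "AE x in lborel \<Otimes>\<^sub>M lborel. norm (case x of (y, z) \<Rightarrow> ?f y z) \<le>
        norm (K * ((case x of (y, z) \<Rightarrow> expk \<kappa> (y - z) * (norm (u y))\<^sup>2) + (case x of (y, z) \<Rightarrow> expk \<kappa> (y - z) * (norm (\<omega> z))\<^sup>2)))"
      by (intro AE_I2) (auto intro!: order_trans[OF _ abs_ge_self])
  qed
  have "p (u y) (conv k \<omega> y) = (LINT z|lborel. ?f y z)" for y
    unfolding conv_def using integral_bounded_linear[OF bounded_linear_right[of "u y"] conv_integrable[OF k \<omega>, of y]]
    by (simp add: scaleR_right)
  moreover have "p (conv (\<lambda>x. k (- x)) u z) (\<omega> z) = (LINT y|lborel. ?f y z)" for z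
    unfolding conv_def using integral_bounded_linear[OF bounded_linear_left[of "\<omega> z"] conv_integrable[OF exp_kernel_reflect[OF k] u, of z]]
    by (simp add: scaleR_left)
  ultimately show ?thesis using lborel_pair.Fubini_integral[OF int] by simp
qed

section \<open>The Green function of the Helmholtz operator\<close>

text \<open>Away from 0, \<open>expk\<close> and \<open>sgnk\<close> are each other's derivative up
  to the factor \<open>- \<kappa>\<close>. The jump of \<open>sgnk\<close> at 0 is 2.\<close>

definition sgnk :: "real \<Rightarrow> real \<Rightarrow> real" where
  "sgnk \<kappa> x = (if 0 \<le> x then expk \<kappa> x else - expk \<kappa> x)"

lemma sgnk_measurable [measurable]: "sgnk \<kappa> \<in> borel_measurable borel"
  unfolding sgnk_def[abs_def] by measurable

lemma exp_kernel_sgnk: "\<kappa> > 0 \<Longrightarrow> exp_kernel \<kappa> (sgnk \<kappa>)"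
  by (simp add: exp_kernel_def) (simp add: sgnk_def)

lemma test_function_Ltwo:
  assumes "test_function \<phi>" shows "\<phi> \<in> Ltwo"
proof -
  obtain r K where rK: "r > 0" "K > 0" "\<And>y. \<bar>\<phi> y\<bar> \<le> K * indicator {-r..r} y"
    by (rule test_function_bounded_support[OF assms]) blast
  have "(\<lambda>y. K *\<^sub>R indicat_real {-r..r} y) \<in> Ltwo"
    by (intro Ltwo_scaleR indicator_Ltwo) (auto simp: emeasure_lborel_Icc_eq)
  then show ?thesis
    by (rule Ltwo_bound[rotated]) (use rK smooth_measurable[OF test_function_smooth[OF assms]] in auto)
qed

text \<open>The gauge integral tolerates finitely many exceptional points, so a kernel with a kink
  can be integrated by parts in one go; the assumed integrability carries the result over to the
  Lebesgue integral.\<close>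

lemma lborel_integral_FTC:
  fixes H g :: "real \<Rightarrow> real"
  assumes "integrable lborel g" "finite S" "a \<le> b" "\<And>y. y \<notin> {a..b} \<Longrightarrow> g y = 0"
    and "\<And>y. y \<notin> S \<Longrightarrow> (H has_real_derivative g y) (at y)" "continuous_on {a..b} H"
  shows "(LINT y|lborel. g y) = H b - H a"
proof -
  have "(g has_integral (H b - H a)) {a..b}"
    using assms(2,3,5,6)
    by (intro fundamental_theorem_of_calculus_strong) (auto simp: has_real_derivative_iff_has_vector_derivative)
  then have "(g has_integral (H b - H a)) UNIV"
    by (rule has_integral_on_superset) (use assms(4) in auto)
  then show ?thesis using has_integral_integral_lborel[OF assms(1)] has_integral_unique by blast
qed

lemma expk_has_deriv:
  assumes "y \<noteq> z"
  shows "((\<lambda>y. expk \<kappa> (y - z)) has_real_derivative - \<kappa> * sgnk \<kappa> (y - z)) (at y)"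
proof (cases "y > z")
  case True
  have "((\<lambda>y. exp (- (\<kappa> * (y - z)))) has_real_derivative - \<kappa> * exp (- (\<kappa> * (y - z)))) (at y)"
    by (auto intro!: derivative_eq_intros)
  then have "((\<lambda>y. expk \<kappa> (y - z)) has_real_derivative - \<kappa> * exp (- (\<kappa> * (y - z)))) (at y)"
    by (rule has_field_derivative_transform_within_open[where S = "{z<..}"]) (use True in \<open>auto simp: expk_def\<close>)
  then show ?thesis using True by (simp add: sgnk_def expk_def)
next
  case False
  have "((\<lambda>y. exp (\<kappa> * (y - z))) has_real_derivative \<kappa> * exp (\<kappa> * (y - z))) (at y)"
    by (auto intro!: derivative_eq_intros)
  then have "((\<lambda>y. expk \<kappa> (y - z)) has_real_derivative \<kappa> * exp (\<kappa> * (y - z))) (at y)"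
    by (rule has_field_derivative_transform_within_open[where S = "{..<z}"]) (use False assms in \<open>auto simp: expk_def algebra_simps\<close>)
  moreover have "- \<kappa> * sgnk \<kappa> (y - z) = \<kappa> * exp (\<kappa> * (y - z))"
    using False assms by (simp add: sgnk_def expk_def abs_if algebra_simps)
  ultimately show ?thesis by (simp only:)
qed

lemma sgnk_has_deriv:
  assumes "y \<noteq> z"
  shows "((\<lambda>y. sgnk \<kappa> (y - z)) has_real_derivative - \<kappa> * expk \<kappa> (y - z)) (at y)"
proof (cases "y > z")
  case True
  have "((\<lambda>y. sgnk \<kappa> (y - z)) has_real_derivative - \<kappa> * sgnk \<kappa> (y - z)) (at y)"
    by (rule has_field_derivative_transform_within_open[OF expk_has_deriv[OF assms], where S = "{z<..}"])
      (use True in \<open>auto simp: sgnk_def\<close>)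
  then show ?thesis using True by (simp add: sgnk_def)
next
  case False
  have "((\<lambda>y. sgnk \<kappa> (y - z)) has_real_derivative - (- \<kappa> * sgnk \<kappa> (y - z))) (at y)"
    by (rule has_field_derivative_transform_within_open[OF DERIV_minus[OF expk_has_deriv[OF assms]], where S = "{..<z}"])
      (use False assms in \<open>auto simp: sgnk_def\<close>)
  then show ?thesis using False assms by (simp add: sgnk_def)
qed

text \<open>Integration by parts across \<open>z\<close>. The first kernel is continuous there; the
  jump of the second produces \<open>2 * \<phi> z\<close>, the delta term of the Helmholtz
  equation.\<close>

lemma conv_expk_deriv_test:
  assumes "\<kappa> > 0" and \<phi>: "test_function \<phi>"
  shows "conv (expk \<kappa>) (deriv \<phi>) z = \<kappa> * conv (\<lambda>x. sgnk \<kappa> (- x)) \<phi> z"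
    and "conv (\<lambda>x. sgnk \<kappa> (- x)) (deriv \<phi>) z = \<kappa> * conv (expk \<kappa>) \<phi> z - 2 * \<phi> z"
proof -
  obtain r where r: "r > 0" "\<And>y. \<bar>y\<bar> \<ge> r \<Longrightarrow> \<phi> y = 0"
    using test_function_bounded_support[OF \<phi>] by metis
  obtain r' where r': "r' > 0" "\<And>y. \<bar>y\<bar> \<ge> r' \<Longrightarrow> deriv \<phi> y = 0"
    using test_function_bounded_support[OF test_function_deriv[OF \<phi>]] by metis
  define R where "R = max (max r r') (\<bar>z\<bar> + 1)"
  have R: "- R < z" "z < R" "r \<le> R" "r' \<le> R" "R > 0" using r r' by (auto simp: R_def)
  note d = smooth_has_deriv[OF test_function_smooth[OF \<phi>]]
  note L = test_function_Ltwo[OF \<phi>] test_function_Ltwo[OF test_function_deriv[OF \<phi>]]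
  note ke = exp_kernel_expk[OF \<open>\<kappa> > 0\<close>] and ks = exp_kernel_reflect[OF exp_kernel_sgnk[OF \<open>\<kappa> > 0\<close>]]
  have c\<phi>: "continuous_on A \<phi>" for A by (intro smooth_continuous test_function_smooth \<phi>)
  have i: "integrable lborel (\<lambda>y. expk \<kappa> (y - z) * deriv \<phi> y)" "integrable lborel (\<lambda>y. expk \<kappa> (y - z) * \<phi> y)"
      "integrable lborel (\<lambda>y. sgnk \<kappa> (y - z) * deriv \<phi> y)" "integrable lborel (\<lambda>y. sgnk \<kappa> (y - z) * \<phi> y)"
    using conv_integrable[OF ke L(2), of z] conv_integrable[OF ke L(1), of z]
      conv_integrable[OF ks L(2), of z] conv_integrable[OF ks L(1), of z] by (simp_all add: expk_commute[of \<kappa> z])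
  have "(LINT y|lborel. expk \<kappa> (y - z) * deriv \<phi> y + (- \<kappa>) * (sgnk \<kappa> (y - z) * \<phi> y))
      = expk \<kappa> (R - z) * \<phi> R - expk \<kappa> (- R - z) * \<phi> (- R)"
  proof (rule lborel_integral_FTC[where S = "{z}" and H = "\<lambda>y. expk \<kappa> (y - z) * \<phi> y"])
    show "((\<lambda>y. expk \<kappa> (y - z) * \<phi> y) has_real_derivative
        expk \<kappa> (y - z) * deriv \<phi> y + (- \<kappa>) * (sgnk \<kappa> (y - z) * \<phi> y)) (at y)" if "y \<notin> {z}" for y
      using that by (auto intro!: derivative_eq_intros expk_has_deriv d)
    show "continuous_on {- R..R} (\<lambda>y. expk \<kappa> (y - z) * \<phi> y)"
      unfolding expk_def by (intro continuous_intros c\<phi>)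
    show "expk \<kappa> (y - z) * deriv \<phi> y + (- \<kappa>) * (sgnk \<kappa> (y - z) * \<phi> y) = 0" if "y \<notin> {- R..R}" for y
      using that r(2)[of y] r'(2)[of y] R by auto
  qed (use R i in auto)
  also have "\<dots> = 0" using r R by auto
  also have "(LINT y|lborel. expk \<kappa> (y - z) * deriv \<phi> y + (- \<kappa>) * (sgnk \<kappa> (y - z) * \<phi> y)) =
      (LINT y|lborel. expk \<kappa> (y - z) * deriv \<phi> y) + (- \<kappa>) * (LINT y|lborel. sgnk \<kappa> (y - z) * \<phi> y)"
    using i by (subst Bochner_Integration.integral_add) auto
  finally show "conv (expk \<kappa>) (deriv \<phi>) z = \<kappa> * conv (\<lambda>x. sgnk \<kappa> (- x)) \<phi> z"
    by (simp add: conv_def expk_commute[of \<kappa> z])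
  \<comment> \<open>On each side of \<open>z\<close> this differs from
    \<open>sgnk \<kappa> (y - z) * \<phi> y\<close> by a constant only, and subtracting
    \<open>\<phi> z\<close> makes it continuous at \<open>z\<close>. The two ends then contribute
    \<open>- \<phi> z\<close> each.\<close>
  let ?H = "\<lambda>y. sgn (y - z) * (expk \<kappa> (y - z) * \<phi> y - \<phi> z)"
  have "(LINT y|lborel. sgnk \<kappa> (y - z) * deriv \<phi> y + (- \<kappa>) * (expk \<kappa> (y - z) * \<phi> y)) = ?H R - ?H (- R)"
  proof (rule lborel_integral_FTC[where S = "{z}" and H = ?H])
    show "(?H has_real_derivative
        sgnk \<kappa> (y - z) * deriv \<phi> y + (- \<kappa>) * (expk \<kappa> (y - z) * \<phi> y)) (at y)" if "y \<notin> {z}" for y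
    proof -
      have *: "((\<lambda>y. sgnk \<kappa> (y - z) * \<phi> y - c) has_real_derivative
          sgnk \<kappa> (y - z) * deriv \<phi> y + (- \<kappa>) * (expk \<kappa> (y - z) * \<phi> y)) (at y)" for c
        using that by (auto intro!: derivative_eq_intros sgnk_has_deriv d)
      show ?thesis
      proof (cases "y > z")
        case True
        show ?thesis
          by (rule has_field_derivative_transform_within_open[OF *[of "\<phi> z"], where S = "{z<..}"])
            (use True in \<open>auto simp: sgnk_def\<close>)
      next
        case False
        show ?thesis
          by (rule has_field_derivative_transform_within_open[OF *[of "- \<phi> z"], where S = "{..<z}"])
            (use False that in \<open>auto simp: sgnk_def\<close>)
      qed
    qed
    show "continuous_on {- R..R} ?H"
    proof (rule continuous_at_imp_continuous_on, rule ballI)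
      fix y
      show "isCont ?H y"
      proof (cases "y = z")
        case False
        have "isCont (\<lambda>y. sgn (y - z)) y" using False by (intro isCont_sgn continuous_intros) auto
        moreover have "isCont \<phi> y" using d by (rule DERIV_isCont)
        ultimately show ?thesis using False unfolding expk_def by (auto intro!: continuous_intros)
      next
        case True
        have "isCont \<phi> z" using d by (rule DERIV_isCont)
        then have "isCont (\<lambda>y. expk \<kappa> (y - z) * \<phi> y - \<phi> z) z" unfolding expk_def by (intro continuous_intros)
        then have "((\<lambda>y. \<bar>expk \<kappa> (y - z) * \<phi> y - \<phi> z\<bar>) \<longlongrightarrow> 0) (at z)"
          by (auto simp: isCont_def expk_def intro: tendsto_rabs_zero)
        then have "(?H \<longlongrightarrow> 0) (at z)"
          by (rule Lim_null_comparison[rotated]) (auto simp: abs_mult abs_sgn_eq)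
        then show ?thesis using True by (simp add: isCont_def)
      qed
    qed
    show "sgnk \<kappa> (y - z) * deriv \<phi> y + (- \<kappa>) * (expk \<kappa> (y - z) * \<phi> y) = 0" if "y \<notin> {- R..R}" for y
      using that r(2)[of y] r'(2)[of y] R by auto
  qed (use R i in auto)
  also have "\<dots> = - 2 * \<phi> z" using r R by (auto simp: sgn_if)
  also have "(LINT y|lborel. sgnk \<kappa> (y - z) * deriv \<phi> y + (- \<kappa>) * (expk \<kappa> (y - z) * \<phi> y)) =
      (LINT y|lborel. sgnk \<kappa> (y - z) * deriv \<phi> y) + (- \<kappa>) * (LINT y|lborel. expk \<kappa> (y - z) * \<phi> y)"
    using i by (subst Bochner_Integration.integral_add) auto
  finally show "conv (\<lambda>x. sgnk \<kappa> (- x)) (deriv \<phi>) z = \<kappa> * conv (expk \<kappa>) \<phi> z - 2 * \<phi> z"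
    by (simp add: conv_def expk_commute[of \<kappa> z])
qed

text \<open>\<open>- expk \<kappa> / (2 * \<kappa>)\<close> is the decaying fundamental solution of
  the Helmholtz operator with constant \<open>\<kappa>\<^sup>2\<close>. In contrast to
  \<open>helmholtz_inv\<close>, the value is determined at every point.\<close>

definition green :: "real \<Rightarrow> (real \<Rightarrow> 'a) \<Rightarrow> real \<Rightarrow> 'a::{banach, second_countable_topology}" where
  "green \<kappa> \<omega> y = (- 1 / (2 * \<kappa>)) *\<^sub>R conv (expk \<kappa>) \<omega> y"

definition green1 :: "real \<Rightarrow> (real \<Rightarrow> 'a) \<Rightarrow> real \<Rightarrow> 'a::{banach, second_countable_topology}" where
  "green1 \<kappa> \<omega> y = (1 / 2) *\<^sub>R conv (sgnk \<kappa>) \<omega> y"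

lemma green_Ltwo: "\<kappa> > 0 \<Longrightarrow> \<omega> \<in> Ltwo \<Longrightarrow> green \<kappa> \<omega> \<in> Ltwo"
  unfolding green_def[abs_def] by (intro Ltwo_scaleR conv_Ltwo[OF exp_kernel_expk])

lemma green1_Ltwo: "\<kappa> > 0 \<Longrightarrow> \<omega> \<in> Ltwo \<Longrightarrow> green1 \<kappa> \<omega> \<in> Ltwo"
  unfolding green1_def[abs_def] by (intro Ltwo_scaleR conv_Ltwo[OF exp_kernel_sgnk])

lemma green_cong_AE:
  assumes "f \<in> borel_measurable borel" "g \<in> borel_measurable borel" "AE y in lborel. f y = g y"
  shows "green \<kappa> f = green \<kappa> g"
  unfolding green_def conv_def using assms
  by (intro ext arg_cong[where f = "\<lambda>x. _ *\<^sub>R x"] integral_cong_AE) auto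

lemma green_measurable [measurable]:
  "\<omega> \<in> borel_measurable borel \<Longrightarrow> green \<kappa> \<omega> \<in> borel_measurable borel"
  unfolding green_def[abs_def] by measurable

lemma green_pair:
  fixes u v :: "real \<Rightarrow> complex"
  assumes "\<kappa> > 0" "u \<in> Ltwo" "v \<in> Ltwo"
  shows "(LINT y|lborel. u y * green \<kappa> v y) = (LINT y|lborel. green \<kappa> u y * v y)"
  using conv_swap[OF bounded_bilinear_mult exp_kernel_expk[OF assms(1)] assms(2,3)]
  by (simp add: green_def expk_minus)

lemma has_weak_deriv_0: "f \<in> Ltwo \<Longrightarrow> has_weak_deriv 0 f f"
  by (simp add: has_weak_deriv_def Ltwo_locally_integrable)

lemma conv_test_scale:
  assumes "exp_kernel \<kappa> k" "\<phi> \<in> Ltwo" "\<omega> \<in> Ltwo"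
  shows "integrable lborel (\<lambda>z. conv k \<phi> z *\<^sub>R \<omega> z)" "integrable lborel (\<lambda>y. \<phi> y *\<^sub>R conv k \<omega> y)" "integrable lborel (\<lambda>y. \<phi> y *\<^sub>R \<omega> y)"
  using assms by (auto intro!: Ltwo_bilinear[OF bounded_bilinear_scaleR] conv_Ltwo)

lemma integral_scaleR_commute:
  fixes f :: "real \<Rightarrow> 'a :: {banach, second_countable_topology}"
  shows "(LINT y|lborel. a y *\<^sub>R (c *\<^sub>R f y)) = c *\<^sub>R (LINT y|lborel. a y *\<^sub>R f y)"
  by (simp only: scaleR_left_commute[of _ c] integral_scaleR_right)

text \<open>\<open>conv_swap\<close> moves the convolution onto the test function,
  \<open>conv_expk_deriv_test\<close> differentiates there, and a second swap moves it back. The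
  second derivative below is treated in the same way, its delta term giving \<omega>.\<close>

lemma green_weak_deriv_1:
  assumes \<kappa>: "\<kappa> > 0" and \<omega>: "\<omega> \<in> Ltwo"
  shows "has_weak_deriv 1 (green \<kappa> \<omega>) (green1 \<kappa> \<omega>)"
  unfolding has_weak_deriv_def
proof (intro conjI allI impI)
  show "locally_integrable (green \<kappa> \<omega>)" "locally_integrable (green1 \<kappa> \<omega>)"
    by (intro Ltwo_locally_integrable green_Ltwo green1_Ltwo assms)+
  fix \<phi> assume \<phi>: "test_function \<phi>"
  note L = test_function_Ltwo[OF \<phi>] test_function_Ltwo[OF test_function_deriv[OF \<phi>]]
  have "(LINT y|lborel. deriv \<phi> y *\<^sub>R conv (expk \<kappa>) \<omega> y) = (LINT z|lborel. conv (expk \<kappa>) (deriv \<phi>) z *\<^sub>R \<omega> z)"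
    using conv_swap[OF bounded_bilinear_scaleR exp_kernel_expk[OF \<kappa>] L(2) \<omega>] by (simp add: expk_minus)
  also have "\<dots> = (LINT z|lborel. \<kappa> *\<^sub>R (conv (\<lambda>x. sgnk \<kappa> (- x)) \<phi> z *\<^sub>R \<omega> z))"
    by (simp add: conv_expk_deriv_test[OF \<kappa> \<phi>])
  also have "\<dots> = \<kappa> *\<^sub>R (LINT z|lborel. conv (\<lambda>x. sgnk \<kappa> (- x)) \<phi> z *\<^sub>R \<omega> z)"
    by (intro integral_scaleR_right conv_test_scale[OF exp_kernel_reflect[OF exp_kernel_sgnk[OF \<kappa>]] L(1) \<omega>])
  also have "(LINT z|lborel. conv (\<lambda>x. sgnk \<kappa> (- x)) \<phi> z *\<^sub>R \<omega> z) = (LINT y|lborel. \<phi> y *\<^sub>R conv (sgnk \<kappa>) \<omega> y)"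
    using conv_swap[OF bounded_bilinear_scaleR exp_kernel_sgnk[OF \<kappa>] L(1) \<omega>] by simp
  finally show "(LINT y|lborel. (deriv ^^ 1) \<phi> y *\<^sub>R green \<kappa> \<omega> y) = (- 1) ^ 1 *\<^sub>R (LINT y|lborel. \<phi> y *\<^sub>R green1 \<kappa> \<omega> y)"
    unfolding green_def green1_def integral_scaleR_commute using \<kappa> by simp
qed

lemma green_weak_deriv_2:
  assumes \<kappa>: "\<kappa> > 0" and \<omega>: "\<omega> \<in> Ltwo"
  shows "has_weak_deriv 2 (green \<kappa> \<omega>) (\<lambda>y. \<kappa>\<^sup>2 *\<^sub>R green \<kappa> \<omega> y + \<omega> y)"
  unfolding has_weak_deriv_def
proof (intro conjI allI impI)
  show "locally_integrable (green \<kappa> \<omega>)" "locally_integrable (\<lambda>y. \<kappa>\<^sup>2 *\<^sub>R green \<kappa> \<omega> y + \<omega> y)"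
    by (intro Ltwo_locally_integrable Ltwo_add Ltwo_scaleR green_Ltwo assms)+
  fix \<phi> assume \<phi>: "test_function \<phi>"
  note L = test_function_Ltwo[OF \<phi>] test_function_Ltwo[OF test_function_deriv[OF test_function_deriv[OF \<phi>]]]
  note ke = exp_kernel_expk[OF \<kappa>]
  note i = conv_test_scale[OF ke L(1) \<omega>]
  have "conv (expk \<kappa>) (deriv (deriv \<phi>)) z = \<kappa>\<^sup>2 * conv (expk \<kappa>) \<phi> z - 2 * \<kappa> * \<phi> z" for z
    unfolding conv_expk_deriv_test(1)[OF \<kappa> test_function_deriv[OF \<phi>]] conv_expk_deriv_test(2)[OF \<kappa> \<phi>]
    by (simp add: power2_eq_square algebra_simps)
  then have "(LINT y|lborel. deriv (deriv \<phi>) y *\<^sub>R conv (expk \<kappa>) \<omega> y) =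
      (LINT z|lborel. \<kappa>\<^sup>2 *\<^sub>R (conv (expk \<kappa>) \<phi> z *\<^sub>R \<omega> z) - (2 * \<kappa>) *\<^sub>R (\<phi> z *\<^sub>R \<omega> z))"
    using conv_swap[OF bounded_bilinear_scaleR ke L(2) \<omega>] by (simp add: expk_minus scaleR_left_diff_distrib)
  also have "\<dots> = \<kappa>\<^sup>2 *\<^sub>R (LINT z|lborel. conv (expk \<kappa>) \<phi> z *\<^sub>R \<omega> z) - (2 * \<kappa>) *\<^sub>R (LINT z|lborel. \<phi> z *\<^sub>R \<omega> z)"
    using i by (simp only: Bochner_Integration.integral_diff integrable_scaleR_right integral_scaleR_right)
  also have "(LINT z|lborel. conv (expk \<kappa>) \<phi> z *\<^sub>R \<omega> z) = (LINT y|lborel. \<phi> y *\<^sub>R conv (expk \<kappa>) \<omega> y)"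
    using conv_swap[OF bounded_bilinear_scaleR ke L(1) \<omega>] by (simp add: expk_minus)
  finally have *: "(LINT y|lborel. deriv (deriv \<phi>) y *\<^sub>R conv (expk \<kappa>) \<omega> y) =
      \<kappa>\<^sup>2 *\<^sub>R (LINT y|lborel. \<phi> y *\<^sub>R conv (expk \<kappa>) \<omega> y) - (2 * \<kappa>) *\<^sub>R (LINT z|lborel. \<phi> z *\<^sub>R \<omega> z)" .
  have "(LINT y|lborel. \<phi> y *\<^sub>R (\<kappa>\<^sup>2 *\<^sub>R green \<kappa> \<omega> y + \<omega> y)) =
      (LINT y|lborel. (- \<kappa> / 2) *\<^sub>R (\<phi> y *\<^sub>R conv (expk \<kappa>) \<omega> y) + \<phi> y *\<^sub>R \<omega> y)"
    using \<kappa> by (simp add: green_def power2_eq_square algebra_simps)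
  also have "\<dots> = (- \<kappa> / 2) *\<^sub>R (LINT y|lborel. \<phi> y *\<^sub>R conv (expk \<kappa>) \<omega> y) + (LINT y|lborel. \<phi> y *\<^sub>R \<omega> y)"
    using i by (simp only: Bochner_Integration.integral_add integrable_scaleR_right integral_scaleR_right)
  also have "\<dots> = (- 1 / (2 * \<kappa>)) *\<^sub>R (LINT y|lborel. deriv (deriv \<phi>) y *\<^sub>R conv (expk \<kappa>) \<omega> y)"
    unfolding * using \<kappa> by (simp add: power2_eq_square algebra_simps)
  also have "\<dots> = (LINT y|lborel. deriv (deriv \<phi>) y *\<^sub>R green \<kappa> \<omega> y)"
    by (simp only: green_def integral_scaleR_commute)
  finally show "(LINT y|lborel. (deriv ^^ 2) \<phi> y *\<^sub>R green \<kappa> \<omega> y) =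
      (- 1) ^ 2 *\<^sub>R (LINT y|lborel. \<phi> y *\<^sub>R (\<kappa>\<^sup>2 *\<^sub>R green \<kappa> \<omega> y + \<omega> y))"
    by (simp add: numeral_2_eq_2)
qed

lemma green_sobolev:
  assumes "\<kappa> > 0" "\<omega> \<in> Ltwo" shows "green \<kappa> \<omega> \<in> sobolev_H 2"
proof -
  have "\<exists>g\<in>Ltwo. has_weak_deriv n (green \<kappa> \<omega>) g" if "n \<le> 2" for n
  proof -
    from that consider "n = 0" | "n = 1" | "n = 2" by linarith
    then show ?thesis
    proof cases
      case 1 then show ?thesis using has_weak_deriv_0 green_Ltwo[OF assms] by blast
    next
      case 2 then show ?thesis using green_weak_deriv_1[OF assms] green1_Ltwo[OF assms] by blast
    next
      case 3 then show ?thesis using green_weak_deriv_2[OF assms]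
        by (metis Ltwo_add Ltwo_scaleR green_Ltwo[OF assms] assms(2))
    qed
  qed
  then show ?thesis using green_Ltwo[OF assms] by (simp add: sobolev_H_def)
qed

section \<open>Classical derivatives of the potential\<close>

lemma has_vector_derivative_set_integral_atMost:
  fixes h :: "real \<Rightarrow> 'a :: euclidean_space"
  assumes int: "\<And>x. set_integrable lborel {..x} h" and cont: "isCont h y"
  shows "((\<lambda>x. LINT z:{..x}|lborel. h z) has_vector_derivative h y) (at y)"
proof -
  let ?a = "y - 1" and ?b = "y + 1"
  have i: "set_integrable lborel {?a..x} h" for x
    by (rule set_integrable_subset[OF int[of x]]) auto
  have "((\<lambda>u. integral {?a..u} h) has_vector_derivative h y) (at y within {?a..?b} - {})"
    by (rule integral_has_vector_derivative_continuous_at)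
      (use set_borel_integral_eq_integral(1)[OF i] cont in \<open>auto simp: continuous_at_imp_continuous_at_within\<close>)
  then have "((\<lambda>u. integral {?a..u} h) has_vector_derivative h y) (at y)"
    by (simp add: at_within_Icc_at)
  then have "((\<lambda>u. (LINT z:{..<?a}|lborel. h z) + integral {?a..u} h) has_vector_derivative 0 + h y) (at y)"
    by (intro derivative_intros)
  then have "((\<lambda>x. LINT z:{..x}|lborel. h z) has_vector_derivative 0 + h y) (at y)"
  proof (rule has_vector_derivative_transform_within_open[where S = "{?a<..<?b}"])
    fix x assume x: "x \<in> {?a<..<?b}"
    then have "{..x} = {..<?a} \<union> {?a..x}" "{..<?a} \<inter> {?a..x} = {}" by auto
    moreover have "set_integrable lborel {..<?a} h"
      by (rule set_integrable_subset[OF int[of ?a]]) auto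
    ultimately show "(LINT z:{..<?a}|lborel. h z) + integral {?a..x} h = (LINT z:{..x}|lborel. h z)"
      using i[of x] by (simp add: set_integral_Un set_borel_integral_eq_integral(2)[OF i])
  qed auto
  then show ?thesis by simp
qed

lemma has_vector_derivative_set_integral_greaterThan:
  fixes h :: "real \<Rightarrow> 'a :: euclidean_space"
  assumes int: "\<And>x. set_integrable lborel {x<..} h" and cont: "isCont h y"
  shows "((\<lambda>x. LINT z:{x<..}|lborel. h z) has_vector_derivative - h y) (at y)"
proof -
  let ?a = "y - 1" and ?b = "y + 1"
  have i: "set_integrable lborel {?a..x} h" for x
    by (rule set_integrable_subset[OF int[of "?a - 1"]]) auto
  have "((\<lambda>u. integral {?a..u} h) has_vector_derivative h y) (at y within {?a..?b} - {})"
    by (rule integral_has_vector_derivative_continuous_at)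
      (use set_borel_integral_eq_integral(1)[OF i] cont in \<open>auto simp: continuous_at_imp_continuous_at_within\<close>)
  then have "((\<lambda>u. integral {?a..u} h) has_vector_derivative h y) (at y)"
    by (simp add: at_within_Icc_at)
  then have "((\<lambda>u. (LINT z:{?a..}|lborel. h z) - integral {?a..u} h) has_vector_derivative 0 - h y) (at y)"
    by (intro derivative_intros)
  then have "((\<lambda>x. LINT z:{x<..}|lborel. h z) has_vector_derivative 0 - h y) (at y)"
  proof (rule has_vector_derivative_transform_within_open[where S = "{?a<..<?b}"])
    fix x assume x: "x \<in> {?a<..<?b}"
    then have "{?a..} = {?a..x} \<union> {x<..}" "{?a..x} \<inter> {x<..} = {}" by auto
    then show "(LINT z:{?a..}|lborel. h z) - integral {?a..x} h = (LINT z:{x<..}|lborel. h z)"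
      using i[of x] int[of x] by (simp add: set_integral_Un set_borel_integral_eq_integral(2)[OF i])
  qed auto
  then show ?thesis by simp
qed

text \<open>On each side of \<open>x\<close> the kernel factors into an exponential of
  \<open>x\<close> and one of \<open>z\<close>. Both convolutions are therefore combinations of two
  half-line integrals with moving end point, as in variation of parameters, and only continuity of
  \<omega> at the point of differentiation enters.\<close>

lemma conv_has_deriv:
  fixes \<omega> :: "real \<Rightarrow> 'a :: euclidean_space"
  assumes \<kappa>: "\<kappa> > 0" and \<omega>: "\<omega> \<in> Ltwo" and cont: "isCont \<omega> y"
  shows "(conv (expk \<kappa>) \<omega> has_vector_derivative - \<kappa> *\<^sub>R conv (sgnk \<kappa>) \<omega> y) (at y)"
    and "(conv (sgnk \<kappa>) \<omega> has_vector_derivative 2 *\<^sub>R \<omega> y - \<kappa> *\<^sub>R conv (expk \<kappa>) \<omega> y) (at y)"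
proof -
  define p q where "p z = exp (\<kappa> * z) *\<^sub>R \<omega> z" and "q z = exp (- \<kappa> * z) *\<^sub>R \<omega> z" for z
  define P Q where "P x = (LINT z:{..x}|lborel. p z)" and "Q x = (LINT z:{x<..}|lborel. q z)" for x
  have i: "integrable lborel (\<lambda>z. indicator A z *\<^sub>R (expk \<kappa> (x - z) *\<^sub>R \<omega> z))" if "A \<in> sets lborel" for x A
    using conv_integrable[OF exp_kernel_expk[OF \<kappa>] \<omega>, of x] that by (rule integrable_mult_indicator[rotated])
  have p: "indicator {..x} z *\<^sub>R p z = exp (\<kappa> * x) *\<^sub>R (indicator {..x} z *\<^sub>R (expk \<kappa> (x - z) *\<^sub>R \<omega> z))" for x z
    by (auto simp: p_def expk_def indicator_def algebra_simps simp flip: exp_add)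
  have q: "indicator {x<..} z *\<^sub>R q z = exp (- \<kappa> * x) *\<^sub>R (indicator {x<..} z *\<^sub>R (expk \<kappa> (x - z) *\<^sub>R \<omega> z))" for x z
    by (auto simp: q_def expk_def indicator_def algebra_simps simp flip: exp_add)
  have ip: "set_integrable lborel {..x} p" and iq: "set_integrable lborel {x<..} q" for x
    unfolding set_integrable_def p q by (intro integrable_scaleR_right i; simp)+
  have "isCont p y" "isCont q y" unfolding p_def q_def using cont by (auto intro!: continuous_intros)
  then have dP: "(P has_vector_derivative p y) (at y)" and dQ: "(Q has_vector_derivative - q y) (at y)"
    unfolding P_def[abs_def] Q_def[abs_def]
    by (auto intro: has_vector_derivative_set_integral_atMost has_vector_derivative_set_integral_greaterThan ip iq)
  have P: "exp (- \<kappa> * x) *\<^sub>R P x = (LINT z|lborel. indicator {..x} z *\<^sub>R (expk \<kappa> (x - z) *\<^sub>R \<omega> z))" for x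
    unfolding P_def set_lebesgue_integral_def p integral_scaleR_right scaleR_scaleR[of "exp (- \<kappa> * x)"]
    by (simp flip: exp_add del: scaleR_scaleR)
  have Q: "exp (\<kappa> * x) *\<^sub>R Q x = (LINT z|lborel. indicator {x<..} z *\<^sub>R (expk \<kappa> (x - z) *\<^sub>R \<omega> z))" for x
    unfolding Q_def set_lebesgue_integral_def q integral_scaleR_right scaleR_scaleR[of "exp (\<kappa> * x)"]
    by (simp flip: exp_add del: scaleR_scaleR)
  have cE: "conv (expk \<kappa>) \<omega> = (\<lambda>x. exp (- \<kappa> * x) *\<^sub>R P x + exp (\<kappa> * x) *\<^sub>R Q x)"
    unfolding P Q conv_def
    by (intro ext) (subst Bochner_Integration.integral_add[symmetric, OF i i],
      auto intro!: Bochner_Integration.integral_cong simp: indicator_def)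
  have cS: "conv (sgnk \<kappa>) \<omega> = (\<lambda>x. exp (- \<kappa> * x) *\<^sub>R P x - exp (\<kappa> * x) *\<^sub>R Q x)"
    unfolding P Q conv_def
    by (intro ext) (subst Bochner_Integration.integral_diff[symmetric, OF i i],
      auto intro!: Bochner_Integration.integral_cong simp: indicator_def sgnk_def)
  have e: "((\<lambda>x. exp (c * x)) has_real_derivative c * exp (c * y)) (at y)" for c :: real
    by (auto intro!: derivative_eq_intros)
  note d1 = has_vector_derivative_scaleR[OF e[of "- \<kappa>"] dP]
  note d2 = has_vector_derivative_scaleR[OF e[of \<kappa>] dQ]
  have pq: "exp (- \<kappa> * y) *\<^sub>R p y = \<omega> y" "exp (\<kappa> * y) *\<^sub>R q y = \<omega> y"
    by (simp_all add: p_def q_def flip: exp_add)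
  show "(conv (expk \<kappa>) \<omega> has_vector_derivative - \<kappa> *\<^sub>R conv (sgnk \<kappa>) \<omega> y) (at y)"
    unfolding cE cS using has_vector_derivative_add[OF d1 d2] pq by (simp add: algebra_simps)
  show "(conv (sgnk \<kappa>) \<omega> has_vector_derivative 2 *\<^sub>R \<omega> y - \<kappa> *\<^sub>R conv (expk \<kappa>) \<omega> y) (at y)"
    unfolding cE cS using has_vector_derivative_diff[OF d1 d2] pq by (simp add: algebra_simps scaleR_2)
qed

lemma green_has_deriv:
  fixes \<omega> :: "real \<Rightarrow> 'a :: euclidean_space"
  assumes "\<kappa> > 0" "\<omega> \<in> Ltwo" "isCont \<omega> y"
  shows "(green \<kappa> \<omega> has_vector_derivative green1 \<kappa> \<omega> y) (at y)"
    and "(green1 \<kappa> \<omega> has_vector_derivative \<kappa>\<^sup>2 *\<^sub>R green \<kappa> \<omega> y + \<omega> y) (at y)"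
proof -
  have "((\<lambda>y. (- 1 / (2 * \<kappa>)) *\<^sub>R conv (expk \<kappa>) \<omega> y) has_vector_derivative
      (- 1 / (2 * \<kappa>)) *\<^sub>R (- \<kappa> *\<^sub>R conv (sgnk \<kappa>) \<omega> y)) (at y)"
    by (intro conv_has_deriv assms
        bounded_linear.has_vector_derivative[OF bounded_linear_scaleR_right])
  then show "(green \<kappa> \<omega> has_vector_derivative green1 \<kappa> \<omega> y) (at y)"
    using assms(1) by (simp add: green_def[abs_def] green1_def)
  have "((\<lambda>y. (1 / 2) *\<^sub>R conv (sgnk \<kappa>) \<omega> y) has_vector_derivative
      (1 / 2) *\<^sub>R (2 *\<^sub>R \<omega> y - \<kappa> *\<^sub>R conv (expk \<kappa>) \<omega> y)) (at y)"
    by (intro conv_has_deriv assms bounded_linear.has_vector_derivative[OF bounded_linear_scaleR_right])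
  then show "(green1 \<kappa> \<omega> has_vector_derivative \<kappa>\<^sup>2 *\<^sub>R green \<kappa> \<omega> y + \<omega> y) (at y)"
    using assms(1) by (simp add: green_def green1_def[abs_def] algebra_simps power2_eq_square)
qed

section \<open>Uniqueness for the Helmholtz equation in the sense of distributions\<close>

lemma weak_zero:
  fixes u :: "real \<Rightarrow> 'a :: euclidean_space"
  assumes u: "u \<in> Ltwo" and z: "\<And>\<phi>. test_function \<phi> \<Longrightarrow> (LINT y|lborel. \<phi> y *\<^sub>R u y) = 0"
  shows "AE y in lborel. u y = 0"
proof -
  have [measurable]: "u \<in> borel_measurable borel" using u by (rule Ltwo_measurable)
  have "AE y in lborel. u y \<bullet> b = 0" if "b \<in> Basis" for b
  proof -
    define f where "f y = u y \<bullet> b" for y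
    have f: "f \<in> Ltwo"
      unfolding f_def[abs_def] by (rule Ltwo_bound[OF _ u]) (use that in \<open>auto simp: Basis_le_norm\<close>)
    have zf: "(LINT y|lborel. \<phi> y * f y) = 0" if "test_function \<phi>" for \<phi>
    proof -
      have "(LINT y|lborel. (\<phi> y *\<^sub>R u y) \<bullet> b) = (LINT y|lborel. \<phi> y *\<^sub>R u y) \<bullet> b"
        by (intro integral_inner_left Ltwo_bilinear[OF bounded_bilinear_scaleR test_function_Ltwo[OF that] u])
      then show ?thesis using z[OF that] by (simp add: f_def)
    qed
    have "Ltwo_norm f = 0"
    proof (rule ccontr)
      assume "Ltwo_norm f \<noteq> 0"
      then have pos: "Ltwo_norm f > 0" by (simp add: order_less_le)
      \<comment> \<open>An error below the norm of \<open>f\<close> itself is enough: pairing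
        \<open>\<phi> - f\<close> with \<open>f\<close> gives minus the square of that norm,
        contrary to Cauchy-Schwarz.\<close>
      obtain \<phi> where \<phi>: "test_function \<phi>" "wnear (\<lambda>_. 1) ((Ltwo_norm f)\<^sup>2) \<phi> f"
        using wnear_test_dense[of "\<lambda>_. 1" f "(Ltwo_norm f)\<^sup>2"] Ltwo_integrable[OF f] Ltwo_measurable[OF f] pos by auto
      have d: "(\<lambda>y. \<phi> y - f y) \<in> Ltwo" by (intro Ltwo_diff test_function_Ltwo \<phi> f)
      have less: "Ltwo_norm (\<lambda>y. \<phi> y - f y) < Ltwo_norm f"
      proof -
        have "(Ltwo_norm (\<lambda>y. \<phi> y - f y))\<^sup>2 < (Ltwo_norm f)\<^sup>2" using \<phi>(2) by (simp add: wnear_def Ltwo_norm_sq)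
        then show ?thesis by (rule power2_less_imp_less) simp
      qed
      have i: "integrable lborel (\<lambda>y. \<phi> y * f y)" "integrable lborel (\<lambda>y. (\<phi> y - f y) * f y)"
        using Ltwo_bilinear[OF bounded_bilinear_mult test_function_Ltwo[OF \<phi>(1)] f]
          Ltwo_bilinear[OF bounded_bilinear_mult d f] by auto
      have "(Ltwo_norm f)\<^sup>2 = (LINT y|lborel. \<phi> y * f y - (\<phi> y - f y) * f y)"
        unfolding Ltwo_norm_sq by (intro Bochner_Integration.integral_cong) (auto simp: power2_eq_square algebra_simps)
      also have "\<dots> = - (LINT y|lborel. (\<phi> y - f y) * f y)"
        using i zf[OF \<phi>(1)] by (subst Bochner_Integration.integral_diff) auto
      also have "\<dots> \<le> (LINT y|lborel. norm ((\<phi> y - f y) * f y))"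
        using integral_norm_bound[of lborel "\<lambda>y. (\<phi> y - f y) * f y"] unfolding real_norm_def by linarith
      also have "\<dots> \<le> Ltwo_norm (\<lambda>y. \<phi> y - f y) * Ltwo_norm f"
        using Ltwo_product(2)[OF d f] by (simp add: abs_mult)
      also have "\<dots> < Ltwo_norm f * Ltwo_norm f" using less pos by simp
      finally show False by (simp add: power2_eq_square)
    qed
    then have "AE y in lborel. f y = 0" by (rule Ltwo_norm_eq_0[OF f])
    then show ?thesis by (simp add: f_def)
  qed
  then have "AE y in lborel. \<forall>b\<in>Basis. u y \<bullet> b = 0" by (intro AE_finite_allI) auto
  then show ?thesis by eventually_elim (simp add: euclidean_all_zero_iff)
qed

text \<open>Combinations of \<open>green\<close>, \<open>green1\<close> and a smooth function form a
  class closed under differentiation, because the derivative of \<open>green1\<close> leads back to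
  \<open>green\<close> plus \<open>h\<close>.\<close>

lemma smooth_green:
  assumes \<kappa>: "\<kappa> > 0" and h: "test_function h"
  shows "smooth (green \<kappa> h)" "deriv (green \<kappa> h) = green1 \<kappa> h"
    "deriv (green1 \<kappa> h) = (\<lambda>y. \<kappa>\<^sup>2 * green \<kappa> h y + h y)"
proof -
  have sh: "smooth h" by (rule test_function_smooth[OF h])
  have c: "isCont h y" for y by (rule DERIV_isCont[OF smooth_has_deriv[OF sh]])
  have d: "(green \<kappa> h has_real_derivative green1 \<kappa> h y) (at y)"
    "(green1 \<kappa> h has_real_derivative \<kappa>\<^sup>2 * green \<kappa> h y + h y) (at y)" for y
    using green_has_deriv[OF \<kappa> test_function_Ltwo[OF h] c, of y] by (auto simp: has_real_derivative_iff_has_vector_derivative)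
  show "smooth (green \<kappa> h)"
  proof (rule smooth_coinduct[where P = "\<lambda>f. \<exists>a b g. smooth g \<and> f = (\<lambda>x. a * green \<kappa> h x + b * green1 \<kappa> h x + g x)"])
    show "\<exists>a b g. smooth g \<and> green \<kappa> h = (\<lambda>x. a * green \<kappa> h x + b * green1 \<kappa> h x + g x)"
      by (rule exI[of _ 1], rule exI[of _ 0], rule exI[of _ "\<lambda>x. 0"]) (simp add: smooth_const)
    fix f assume "\<exists>a b g. smooth g \<and> f = (\<lambda>x. a * green \<kappa> h x + b * green1 \<kappa> h x + g x)"
    then obtain a b g where g: "smooth g" and f: "f = (\<lambda>x. a * green \<kappa> h x + b * green1 \<kappa> h x + g x)" by blast
    have "\<forall>y. (f has_real_derivative (b * \<kappa>\<^sup>2) * green \<kappa> h y + a * green1 \<kappa> h y + (b * h y + deriv g y)) (at y)"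
      unfolding f by (auto intro!: derivative_eq_intros d smooth_has_deriv g simp: algebra_simps)
    moreover have "smooth (\<lambda>y. b * h y + deriv g y)"
      by (intro smooth_add smooth_mult smooth_const sh smooth_deriv g)
    ultimately show "\<exists>f'. (\<forall>y. (f has_real_derivative f' y) (at y)) \<and>
        (\<exists>a b g. smooth g \<and> f' = (\<lambda>x. a * green \<kappa> h x + b * green1 \<kappa> h x + g x))"
      by (intro exI[of _ "\<lambda>y. (b * \<kappa>\<^sup>2) * green \<kappa> h y + a * green1 \<kappa> h y + (b * h y + deriv g y)"]) blast
  qed
  show "deriv (green \<kappa> h) = green1 \<kappa> h" by (intro ext DERIV_imp_deriv d)
  show "deriv (green1 \<kappa> h) = (\<lambda>y. \<kappa>\<^sup>2 * green \<kappa> h y + h y)" by (intro ext DERIV_imp_deriv d)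
qed

lemma test_function_bounded:
  assumes "test_function \<phi>" obtains K where "K > 0" "\<And>y. \<bar>\<phi> y\<bar> \<le> K"
proof -
  obtain r K where K: "K > 0" "\<And>y. \<bar>\<phi> y\<bar> \<le> K * indicator {-r..r} y"
    using test_function_bounded_support[OF assms] by metis
  have "\<bar>\<phi> y\<bar> \<le> K" for y using K(1) order_trans[OF K(2)[of y], of K] by (simp add: indicator_def)
  then show thesis using K(1) that by blast
qed

text \<open>Duality: a test function \<open>h\<close> is the Helmholtz operator applied to
  \<open>v = green \<kappa> h\<close>, so its pairing with \<open>u\<close> would be 0 if
  \<open>v\<close> were a test function. As \<open>v\<close> lacks bounded support, it is multiplied
  by an ever wider bump; the commutator terms carry factors \<open>s n\<close> and vanish in the
  limit.\<close>

lemma weak_helmholtz_unique: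
  fixes u :: "real \<Rightarrow> 'a :: euclidean_space"
  assumes \<kappa>: "\<kappa> > 0" and u: "u \<in> Ltwo" and wd: "has_weak_deriv 2 u (\<lambda>y. \<kappa>\<^sup>2 *\<^sub>R u y)"
  shows "AE y in lborel. u y = 0"
proof (rule weak_zero[OF u])
  fix h assume h: "test_function h"
  define v v1 where "v = green \<kappa> h" and "v1 = green1 \<kappa> h"
  have vL: "v \<in> Ltwo" "v1 \<in> Ltwo" "h \<in> Ltwo"
    unfolding v_def v1_def by (intro green_Ltwo green1_Ltwo test_function_Ltwo h \<kappa>)+
  have vs: "smooth v" and v1s: "smooth v1" and dv: "deriv v = v1" and dv1: "deriv v1 = (\<lambda>y. \<kappa>\<^sup>2 * v y + h y)"
    using smooth_green[OF \<kappa> h] smooth_deriv unfolding v_def v1_def by metis+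
  define B B1 B2 where "B = bump 1" and "B1 = deriv (bump 1)" and "B2 = deriv (deriv (bump 1))"
  have tB: "test_function B" "test_function B1" "test_function B2"
    unfolding B_def B1_def B2_def by (intro test_function_deriv test_function_bump)+
  have dB: "(B has_real_derivative B1 y) (at y)" "(B1 has_real_derivative B2 y) (at y)" for y
    unfolding B_def B1_def B2_def by (intro smooth_has_deriv smooth_deriv smooth_bump)+
  have dBs: "((\<lambda>y. B (c * y)) has_real_derivative c * B1 (c * y)) (at y)"
      "((\<lambda>y. B1 (c * y)) has_real_derivative c * B2 (c * y)) (at y)" for c y
    using has_real_derivative_affine[OF dB(1), of c 0 y] has_real_derivative_affine[OF dB(2), of c 0 y] by simp_all
  define s where "s n = 1 / (real n + 1)" for n
  have s: "s n > 0" for n by (simp add: s_def)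
  define \<phi> where "\<phi> n y = B (s n * y) * v y" for n y
  have t\<phi>: "test_function (\<phi> n)" for n
  proof -
    have "test_function (\<lambda>y. B (s n * y))"
      unfolding test_function_iff
    proof (intro conjI smooth_affine[where c = 0, simplified] test_function_smooth[OF tB(1)] exI[of _ "real n + 1"] allI impI)
      fix y assume "\<bar>y\<bar> > real n + 1"
      then show "B (s n * y) = 0"
        unfolding B_def by (intro bump_zero) (auto simp: s_def abs_mult field_simps)
    qed
    then show ?thesis unfolding \<phi>_def by (intro test_function_mult_left vs)
  qed
  have d1: "deriv (\<phi> n) = (\<lambda>y. s n * B1 (s n * y) * v y + B (s n * y) * v1 y)" for n
    unfolding \<phi>_def dv[symmetric]
    by (intro ext DERIV_imp_deriv) (auto intro!: derivative_eq_intros dBs smooth_has_deriv vs)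
  have d2: "deriv (deriv (\<phi> n)) = (\<lambda>y. \<kappa>\<^sup>2 * \<phi> n y +
      (s n * s n * B2 (s n * y) * v y + 2 * s n * B1 (s n * y) * v1 y + B (s n * y) * h y))" for n
  proof (intro ext DERIV_imp_deriv)
    fix y
    have "(v has_real_derivative v1 y) (at y)" "(v1 has_real_derivative \<kappa>\<^sup>2 * v y + h y) (at y)"
      using smooth_has_deriv[OF vs, of y] smooth_has_deriv[OF v1s, of y] by (auto simp: dv dv1)
    then show "(deriv (\<phi> n) has_real_derivative \<kappa>\<^sup>2 * \<phi> n y +
      (s n * s n * B2 (s n * y) * v y + 2 * s n * B1 (s n * y) * v1 y + B (s n * y) * h y)) (at y)"
      unfolding d1 \<phi>_def
      by (auto intro!: derivative_eq_intros dBs) (simp add: algebra_simps)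
  qed
  let ?r = "\<lambda>n y. s n * s n * B2 (s n * y) * v y + 2 * s n * B1 (s n * y) * v1 y + B (s n * y) * h y"
  have zero: "(LINT y|lborel. ?r n y *\<^sub>R u y) = 0" for n
  proof -
    have 1: "integrable lborel (\<lambda>y. deriv (deriv (\<phi> n)) y *\<^sub>R u y)" "integrable lborel (\<lambda>y. \<phi> n y *\<^sub>R u y)"
      by (intro Ltwo_bilinear[OF bounded_bilinear_scaleR] test_function_Ltwo test_function_deriv t\<phi> u)+
    have "(LINT y|lborel. deriv (deriv (\<phi> n)) y *\<^sub>R u y) = (LINT y|lborel. \<phi> n y *\<^sub>R \<kappa>\<^sup>2 *\<^sub>R u y)"
      using wd t\<phi>[of n] by (auto simp: has_weak_deriv_def numeral_2_eq_2)
    also have "\<dots> = \<kappa>\<^sup>2 *\<^sub>R (LINT y|lborel. \<phi> n y *\<^sub>R u y)" by (rule integral_scaleR_commute)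
    finally have "(LINT y|lborel. deriv (deriv (\<phi> n)) y *\<^sub>R u y - \<kappa>\<^sup>2 *\<^sub>R (\<phi> n y *\<^sub>R u y)) = 0"
      using 1 by (simp only: Bochner_Integration.integral_diff integrable_scaleR_right integral_scaleR_right diff_self)
    also have "(\<lambda>y. deriv (deriv (\<phi> n)) y *\<^sub>R u y - \<kappa>\<^sup>2 *\<^sub>R (\<phi> n y *\<^sub>R u y)) = (\<lambda>y. ?r n y *\<^sub>R u y)"
      unfolding d2 by (simp add: algebra_simps)
    finally show ?thesis .
  qed
  obtain K0 where K0: "K0 > 0" "\<And>y. \<bar>B y\<bar> \<le> K0"
    using test_function_bounded[OF tB(1)] by blast
  obtain K1 where K1: "K1 > 0" "\<And>y. \<bar>B1 y\<bar> \<le> K1"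
    using test_function_bounded[OF tB(2)] by blast
  obtain K2 where K2: "K2 > 0" "\<And>y. \<bar>B2 y\<bar> \<le> K2"
    using test_function_bounded[OF tB(3)] by blast
  have [measurable]: "v \<in> borel_measurable borel" "v1 \<in> borel_measurable borel" "h \<in> borel_measurable borel" "u \<in> borel_measurable borel"
      "B \<in> borel_measurable borel" "B1 \<in> borel_measurable borel" "B2 \<in> borel_measurable borel"
    using vL u Ltwo_measurable tB smooth_measurable test_function_smooth by blast+
  have s0: "s \<longlonglongrightarrow> 0" unfolding s_def using LIMSEQ_inverse_real_of_nat by (simp add: inverse_eq_divide add.commute)
  have s1: "s n \<le> 1" for n by (simp add: s_def)
  have "(\<lambda>n. LINT y|lborel. ?r n y *\<^sub>R u y) \<longlonglongrightarrow> (LINT y|lborel. (B 0 * h y) *\<^sub>R u y)"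
  proof (rule integral_dominated_convergence)
    show "integrable lborel (\<lambda>y. K2 * (norm (v y) * norm (u y)) + 2 * K1 * (norm (v1 y) * norm (u y)) + K0 * (norm (h y) * norm (u y)))"
      by (intro Bochner_Integration.integrable_add integrable_mult_right Ltwo_product vL u)
    show "AE y in lborel. (\<lambda>n. ?r n y *\<^sub>R u y) \<longlonglongrightarrow> (B 0 * h y) *\<^sub>R u y"
    proof (rule AE_I2)
      fix y
      have l: "(\<lambda>n. s n * y) \<longlonglongrightarrow> 0 * y" by (intro tendsto_intros s0)
      have c: "isCont F 0" if "test_function F" for F
        by (rule DERIV_isCont[OF smooth_has_deriv[OF test_function_smooth[OF that]]])
      have "(\<lambda>n. F (s n * y)) \<longlonglongrightarrow> F 0" if "test_function F" for F
        using isCont_tendsto_compose[OF c[OF that]] l by simp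
      note lim = this[OF tB(1)] this[OF tB(2)] this[OF tB(3)]
      have "(\<lambda>n. ?r n y *\<^sub>R u y) \<longlonglongrightarrow> (0 * 0 * B2 0 * v y + 2 * 0 * B1 0 * v1 y + B 0 * h y) *\<^sub>R u y"
        by (intro tendsto_intros s0 lim)
      then show "(\<lambda>n. ?r n y *\<^sub>R u y) \<longlonglongrightarrow> (B 0 * h y) *\<^sub>R u y" by simp
    qed
    fix n
    show "AE y in lborel. norm (?r n y *\<^sub>R u y) \<le>
        K2 * (norm (v y) * norm (u y)) + 2 * K1 * (norm (v1 y) * norm (u y)) + K0 * (norm (h y) * norm (u y))"
    proof (rule AE_I2)
      fix y
      have "\<bar>s n * s n * B2 (s n * y) * v y\<bar> \<le> 1 * 1 * K2 * \<bar>v y\<bar>"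
        unfolding abs_mult using s[of n] s1[of n] K2 by (intro mult_mono) auto
      moreover have "\<bar>2 * s n * B1 (s n * y) * v1 y\<bar> \<le> 2 * 1 * K1 * \<bar>v1 y\<bar>"
        unfolding abs_mult using s[of n] s1[of n] K1 by (intro mult_mono) auto
      moreover have "\<bar>B (s n * y) * h y\<bar> \<le> K0 * \<bar>h y\<bar>"
        unfolding abs_mult using K0 by (intro mult_mono) auto
      ultimately have "\<bar>?r n y\<bar> \<le> K2 * \<bar>v y\<bar> + 2 * K1 * \<bar>v1 y\<bar> + K0 * \<bar>h y\<bar>" by linarith
      from mult_right_mono[OF this norm_ge_zero[of "u y"]]
      show "norm (?r n y *\<^sub>R u y) \<le> K2 * (norm (v y) * norm (u y)) + 2 * K1 * (norm (v1 y) * norm (u y)) + K0 * (norm (h y) * norm (u y))"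
        unfolding norm_scaleR real_norm_def by (simp only: distrib_right mult.assoc)
    qed
  qed measurable
  \<comment> \<open>What survives is the pairing with \<open>h\<close> times the value of the bump
    at its centre, which is positive.\<close>
  then have "0 = (LINT y|lborel. (B 0 * h y) *\<^sub>R u y)" by (simp only: zero LIMSEQ_const_iff)
  then have "B 0 *\<^sub>R (LINT y|lborel. h y *\<^sub>R u y) = 0"
    by (simp only: scaleR_scaleR[symmetric] integral_scaleR_right)
  then show "(LINT y|lborel. h y *\<^sub>R u y) = 0" using bump_pos[of 0 1] by (simp add: B_def)
qed

lemma weak_deriv_2_green:
  fixes \<psi> :: "real \<Rightarrow> 'a :: euclidean_space"
  assumes \<kappa>: "\<kappa> > 0" and \<psi>: "\<psi> \<in> Ltwo" and \<omega>: "\<omega> \<in> Ltwo"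
    and wd: "has_weak_deriv 2 \<psi> (\<lambda>y. \<kappa>\<^sup>2 *\<^sub>R \<psi> y + \<omega> y)"
  shows "AE y in lborel. \<psi> y = green \<kappa> \<omega> y"
proof -
  let ?u = "\<lambda>y. \<psi> y - green \<kappa> \<omega> y"
  have g: "green \<kappa> \<omega> \<in> Ltwo" by (rule green_Ltwo[OF \<kappa> \<omega>])
  have "AE y in lborel. ?u y = 0"
  proof (rule weak_helmholtz_unique[OF \<kappa>])
    show u: "?u \<in> Ltwo" by (intro Ltwo_diff \<psi> g)
    show "has_weak_deriv 2 ?u (\<lambda>y. \<kappa>\<^sup>2 *\<^sub>R ?u y)"
      unfolding has_weak_deriv_def
    proof (intro conjI allI impI Ltwo_locally_integrable Ltwo_scaleR u)
      fix \<phi> assume t: "test_function \<phi>"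
      have i: "integrable lborel (\<lambda>y. \<theta> y *\<^sub>R f y)" if "test_function \<theta>" "f \<in> Ltwo" for \<theta> and f :: "real \<Rightarrow> 'a"
        by (intro Ltwo_bilinear[OF bounded_bilinear_scaleR] test_function_Ltwo that)
      note t2 = test_function_funpow_deriv[OF t, of 2]
      have "(LINT y|lborel. (deriv ^^ 2) \<phi> y *\<^sub>R ?u y) =
          (LINT y|lborel. (deriv ^^ 2) \<phi> y *\<^sub>R \<psi> y) - (LINT y|lborel. (deriv ^^ 2) \<phi> y *\<^sub>R green \<kappa> \<omega> y)"
        unfolding scaleR_right_diff_distrib by (intro Bochner_Integration.integral_diff i t2 \<psi> g)
      also have "\<dots> = (LINT y|lborel. \<phi> y *\<^sub>R (\<kappa>\<^sup>2 *\<^sub>R \<psi> y + \<omega> y)) - (LINT y|lborel. \<phi> y *\<^sub>R (\<kappa>\<^sup>2 *\<^sub>R green \<kappa> \<omega> y + \<omega> y))"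
        using wd green_weak_deriv_2[OF \<kappa> \<omega>] t by (simp add: has_weak_deriv_def)
      also have "\<dots> = (LINT y|lborel. \<phi> y *\<^sub>R (\<kappa>\<^sup>2 *\<^sub>R \<psi> y + \<omega> y) - \<phi> y *\<^sub>R (\<kappa>\<^sup>2 *\<^sub>R green \<kappa> \<omega> y + \<omega> y))"
        by (intro Bochner_Integration.integral_diff[symmetric] i t Ltwo_add Ltwo_scaleR \<psi> g \<omega>)
      also have "\<dots> = (LINT y|lborel. \<phi> y *\<^sub>R \<kappa>\<^sup>2 *\<^sub>R ?u y)" by (simp add: algebra_simps)
      finally show "(LINT y|lborel. (deriv ^^ 2) \<phi> y *\<^sub>R ?u y) = (- 1) ^ 2 *\<^sub>R (LINT y|lborel. \<phi> y *\<^sub>R \<kappa>\<^sup>2 *\<^sub>R ?u y)"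
        by simp
    qed
  qed
  then show ?thesis by eventually_elim simp
qed

lemma has_weak_deriv_cong_AE:
  fixes g :: "real \<Rightarrow> 'a :: {banach, second_countable_topology}"
  assumes wd: "has_weak_deriv n f g" and h: "h \<in> Ltwo" and eq: "AE y in lborel. g y = h y"
  shows "has_weak_deriv n f h"
  unfolding has_weak_deriv_def
proof (intro conjI allI impI)
  show "locally_integrable f" "locally_integrable h"
    using wd Ltwo_locally_integrable[OF h] by (auto simp: has_weak_deriv_def)
  fix \<phi> assume t: "test_function \<phi>"
  obtain r where r: "r > 0" "\<And>y. \<bar>y\<bar> \<ge> r \<Longrightarrow> \<phi> y = 0"
    using test_function_bounded_support[OF t] by metis
  have "set_integrable lborel {-r..r} g"
    using wd unfolding has_weak_deriv_def locally_integrable_def by blast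
  then have [measurable]: "(\<lambda>y. indicator {-r..r} y *\<^sub>R g y) \<in> borel_measurable borel"
    unfolding set_integrable_def by (auto dest: borel_measurable_integrable)
  have [measurable]: "\<phi> \<in> borel_measurable borel" "h \<in> borel_measurable borel"
    using t h smooth_measurable test_function_smooth Ltwo_measurable by blast+
  \<comment> \<open>Local integrability makes \<open>g\<close> measurable only after multiplication
    by an indicator, which the bounded support of \<phi> allows to insert.\<close>
  have g: "\<phi> y *\<^sub>R g y = \<phi> y *\<^sub>R (indicator {-r..r} y *\<^sub>R g y)" for y
    using r(2)[of y] by (cases "\<bar>y\<bar> \<ge> r") (auto simp: indicator_def abs_le_iff)
  have "(LINT y|lborel. \<phi> y *\<^sub>R g y) = (LINT y|lborel. \<phi> y *\<^sub>R h y)"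
  proof (rule integral_cong_AE)
    show "(\<lambda>y. \<phi> y *\<^sub>R g y) \<in> borel_measurable lborel" unfolding g by measurable
    show "AE y in lborel. \<phi> y *\<^sub>R g y = \<phi> y *\<^sub>R h y" using eq by eventually_elim simp
  qed measurable
  then show "(LINT y|lborel. (deriv ^^ n) \<phi> y *\<^sub>R f y) = (- 1) ^ n *\<^sub>R (LINT y|lborel. \<phi> y *\<^sub>R h y)"
    using wd t by (simp add: has_weak_deriv_def)
qed

text \<open>\<open>green\<close> has the property from which the choice operator selects, so the
  selected function has it too, and uniqueness for the weak equation identifies the two almost
  everywhere.\<close>

lemma helmholtz_inv_green:
  assumes "k \<noteq> 0" and \<omega>: "\<omega> \<in> Ltwo"
  shows "helmholtz_inv k \<omega> \<in> Ltwo" "AE y in lborel. helmholtz_inv k \<omega> y = green (of_int \<bar>k\<bar>) \<omega> y"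
proof -
  define \<kappa> :: real where "\<kappa> = of_int \<bar>k\<bar>"
  have \<kappa>: "\<kappa> > 0" using assms by (simp add: \<kappa>_def)
  have "\<kappa>\<^sup>2 = (of_int k)\<^sup>2" by (simp add: \<kappa>_def)
  then have k2: "(of_int k)\<^sup>2 * z = \<kappa>\<^sup>2 *\<^sub>R z" for z :: complex
    by (simp add: scaleR_conv_of_real)
  let ?P = "\<lambda>\<psi>. \<psi> \<in> sobolev_H 2 \<and>
     (\<exists>\<psi>2. has_weak_deriv 2 \<psi> \<psi>2 \<and> (AE y in lborel. \<psi>2 y - (of_int k)\<^sup>2 * \<psi> y = \<omega> y))"
  have "?P (green \<kappa> \<omega>)"
    using green_sobolev[OF \<kappa> \<omega>] green_weak_deriv_2[OF \<kappa> \<omega>]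
    by (intro conjI exI[of _ "\<lambda>y. \<kappa>\<^sup>2 *\<^sub>R green \<kappa> \<omega> y + \<omega> y"]) (auto simp: k2)
  then have "?P (SOME \<psi>. ?P \<psi>)" by (rule someI[where P = ?P])
  then have "?P (helmholtz_inv k \<omega>)" by (simp only: helmholtz_inv_def)
  then obtain \<psi>2 where h: "helmholtz_inv k \<omega> \<in> Ltwo"
      and wd: "has_weak_deriv 2 (helmholtz_inv k \<omega>) \<psi>2"
      and eq: "AE y in lborel. \<psi>2 y - (of_int k)\<^sup>2 * helmholtz_inv k \<omega> y = \<omega> y"
    by (auto simp: sobolev_H_def)
  show "helmholtz_inv k \<omega> \<in> Ltwo" by (rule h)
  have "AE y in lborel. \<psi>2 y = \<kappa>\<^sup>2 *\<^sub>R helmholtz_inv k \<omega> y + \<omega> y"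
    using eq unfolding k2 by eventually_elim (auto simp: algebra_simps)
  then have "has_weak_deriv 2 (helmholtz_inv k \<omega>) (\<lambda>y. \<kappa>\<^sup>2 *\<^sub>R helmholtz_inv k \<omega> y + \<omega> y)"
    by (rule has_weak_deriv_cong_AE[OF wd Ltwo_add[OF Ltwo_scaleR[OF h] \<omega>]])
  then show "AE y in lborel. helmholtz_inv k \<omega> y = green (of_int \<bar>k\<bar>) \<omega> y"
    using weak_deriv_2_green[OF \<kappa> h \<omega>] by (simp add: \<kappa>_def)
qed

text \<open>The difference of two shifted kernels is measured by the kernel itself rather than by a
  constant. Hence the Lipschitz bound of the potential needs the same integral as the bound of its
  size and no further norm of \<omega>.\<close>

lemma expk_diff:
  assumes "\<kappa> > 0" "\<bar>y - y'\<bar> \<le> 1"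
  shows "\<bar>expk \<kappa> (y' - z) - expk \<kappa> (y - z)\<bar> \<le> \<kappa> * exp \<kappa> * \<bar>y - y'\<bar> * expk \<kappa> (y - z)"
proof -
  define a b d where "a = \<kappa> * \<bar>y - z\<bar>" and "b = \<kappa> * \<bar>y' - z\<bar>" and "d = \<kappa> * \<bar>y - y'\<bar>"
  have "\<bar>a - b\<bar> = \<kappa> * \<bar>\<bar>y - z\<bar> - \<bar>y' - z\<bar>\<bar>"
    using assms(1) unfolding a_def b_def by (simp add: abs_mult flip: right_diff_distrib)
  also have "\<dots> \<le> d" unfolding d_def using assms(1) by (intro mult_left_mono) auto
  finally have ab: "\<bar>a - b\<bar> \<le> d" .
  have d: "0 \<le> d" "d \<le> \<kappa>" using assms by (auto simp: d_def mult_left_le)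
  have "1 - d \<le> exp (- d)" using exp_ge_add_one_self[of "- d"] by simp
  then have "(1 - d) * exp d \<le> exp (- d) * exp d" by (intro mult_right_mono) auto
  also have "exp (- d) * exp d = 1" by (simp flip: exp_add)
  finally have "exp d - 1 \<le> d * exp d" by (simp add: algebra_simps)
  also have "\<dots> \<le> d * exp \<kappa>" using d by (intro mult_left_mono) auto
  finally have e: "exp d - 1 \<le> d * exp \<kappa>" .
  have "\<bar>exp (a - b) - 1\<bar> \<le> exp d - 1"
  proof (cases "a - b \<ge> 0")
    case True
    then show ?thesis using ab by simp
  next
    case False
    have "1 - exp (a - b) \<le> - (a - b)" using exp_ge_add_one_self[of "a - b"] by linarith
    also have "\<dots> \<le> d" using ab by simp
    also have "\<dots> \<le> exp d - 1" using exp_ge_add_one_self[of d] by linarith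
    finally show ?thesis using False by simp
  qed
  then have "\<bar>exp (a - b) - 1\<bar> * exp (- a) \<le> (d * exp \<kappa>) * exp (- a)"
    using e by (intro mult_right_mono) auto
  also have "\<bar>exp (a - b) - 1\<bar> * exp (- a) = \<bar>(exp (a - b) - 1) * exp (- a)\<bar>" by (simp add: abs_mult)
  also have "(exp (a - b) - 1) * exp (- a) = exp (- b) - exp (- a)"
    by (simp add: left_diff_distrib flip: exp_add)
  finally show ?thesis by (simp add: expk_def a_def b_def d_def algebra_simps)
qed

lemma green_bound:
  assumes \<kappa>: "\<kappa> > 0" and \<omega>: "\<omega> \<in> Ltwo" and A: "(LINT z|lborel. expk \<kappa> (y - z) * norm (\<omega> z)) \<le> A"
  shows "norm (green \<kappa> \<omega> y) \<le> A / (2 * \<kappa>)"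
  using conv_le_expk[OF exp_kernel_expk[OF \<kappa>] \<omega>, of y] A \<kappa> by (simp add: green_def field_simps)

lemma green_lipschitz:
  assumes \<kappa>: "\<kappa> > 0" and \<omega>: "\<omega> \<in> Ltwo" and A: "(LINT z|lborel. expk \<kappa> (y - z) * norm (\<omega> z)) \<le> A"
    and y': "\<bar>y - y'\<bar> \<le> 1"
  shows "norm (green \<kappa> \<omega> y' - green \<kappa> \<omega> y) \<le> exp \<kappa> * A * \<bar>y - y'\<bar>"
proof -
  note i = conv_integrable[OF exp_kernel_expk[OF \<kappa>] \<omega>]
  have iy: "integrable lborel (\<lambda>z. expk \<kappa> (y - z) * norm (\<omega> z))"
    using integrable_norm[OF i[of y]] by simp
  have "conv (expk \<kappa>) \<omega> y' - conv (expk \<kappa>) \<omega> y = (LINT z|lborel. (expk \<kappa> (y' - z) - expk \<kappa> (y - z)) *\<^sub>R \<omega> z)"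
    unfolding conv_def scaleR_left_diff_distrib by (rule Bochner_Integration.integral_diff[symmetric, OF i i])
  also have "norm \<dots> \<le> (LINT z|lborel. norm ((expk \<kappa> (y' - z) - expk \<kappa> (y - z)) *\<^sub>R \<omega> z))"
    by (rule integral_norm_bound)
  also have "\<dots> \<le> (LINT z|lborel. (\<kappa> * exp \<kappa> * \<bar>y - y'\<bar>) * (expk \<kappa> (y - z) * norm (\<omega> z)))"
  proof (rule integral_mono)
    show "integrable lborel (\<lambda>z. norm ((expk \<kappa> (y' - z) - expk \<kappa> (y - z)) *\<^sub>R \<omega> z))"
      unfolding scaleR_left_diff_distrib by (intro integrable_norm Bochner_Integration.integrable_diff i)
    show "integrable lborel (\<lambda>z. (\<kappa> * exp \<kappa> * \<bar>y - y'\<bar>) * (expk \<kappa> (y - z) * norm (\<omega> z)))"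
      by (intro integrable_mult_right iy)
    show "norm ((expk \<kappa> (y' - z) - expk \<kappa> (y - z)) *\<^sub>R \<omega> z) \<le> (\<kappa> * exp \<kappa> * \<bar>y - y'\<bar>) * (expk \<kappa> (y - z) * norm (\<omega> z))" for z
      using mult_right_mono[OF expk_diff[OF \<kappa> y', of z] norm_ge_zero[of "\<omega> z"]] by (simp add: mult.assoc)
  qed
  also have "\<dots> = (\<kappa> * exp \<kappa> * \<bar>y - y'\<bar>) * (LINT z|lborel. expk \<kappa> (y - z) * norm (\<omega> z))" by simp
  also have "\<dots> \<le> (\<kappa> * exp \<kappa> * \<bar>y - y'\<bar>) * A" using A \<kappa> by (intro mult_left_mono) auto
  finally have "norm (conv (expk \<kappa>) \<omega> y' - conv (expk \<kappa>) \<omega> y) \<le> \<kappa> * (exp \<kappa> * A * \<bar>y - y'\<bar>)"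
    by (simp add: algebra_simps)
  then have "(1 / (2 * \<kappa>)) * norm (conv (expk \<kappa>) \<omega> y' - conv (expk \<kappa>) \<omega> y)
      \<le> (1 / (2 * \<kappa>)) * (\<kappa> * (exp \<kappa> * A * \<bar>y - y'\<bar>))"
    using \<kappa> by (intro mult_left_mono) auto
  moreover have "green \<kappa> \<omega> y' - green \<kappa> \<omega> y = (- 1 / (2 * \<kappa>)) *\<^sub>R (conv (expk \<kappa>) \<omega> y' - conv (expk \<kappa>) \<omega> y)"
    by (simp only: green_def scaleR_right_diff_distrib)
  then have "norm (green \<kappa> \<omega> y' - green \<kappa> \<omega> y) = (1 / (2 * \<kappa>)) * norm (conv (expk \<kappa>) \<omega> y' - conv (expk \<kappa>) \<omega> y)"
    using \<kappa> by (simp only: norm_scaleR) simp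
  moreover have "0 \<le> A" using order_trans[OF _ A, of 0] by simp
  then have "0 \<le> exp \<kappa> * A * \<bar>y - y'\<bar>" by simp
  moreover have "(1 / (2 * \<kappa>)) * (\<kappa> * (exp \<kappa> * A * \<bar>y - y'\<bar>)) = (exp \<kappa> * A * \<bar>y - y'\<bar>) / 2"
    using \<kappa> by simp
  ultimately show ?thesis by linarith
qed

lemma green_isCont:
  assumes \<kappa>: "\<kappa> > 0" and \<omega>: "\<omega> \<in> Ltwo"
  shows "isCont (green \<kappa> \<omega>) y"
proof -
  define A where "A = (LINT z|lborel. expk \<kappa> (y - z) * norm (\<omega> z))"
  have "\<forall>\<^sub>F x in at y. \<bar>y - x\<bar> < 1"
    unfolding eventually_at by (intro exI[of _ 1]) (auto simp: dist_real_def abs_minus_commute)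
  then have "\<forall>\<^sub>F x in at y. norm (green \<kappa> \<omega> x - green \<kappa> \<omega> y) \<le> exp \<kappa> * A * \<bar>y - x\<bar>"
    by eventually_elim (rule green_lipschitz[OF \<kappa> \<omega>], auto simp: A_def)
  moreover have "((\<lambda>x. exp \<kappa> * A * \<bar>y - x\<bar>) \<longlongrightarrow> exp \<kappa> * A * \<bar>y - y\<bar>) (at y)" by (intro tendsto_intros)
  ultimately have "((\<lambda>x. green \<kappa> \<omega> x - green \<kappa> \<omega> y) \<longlongrightarrow> 0) (at y)"
    using Lim_null_comparison[of "\<lambda>x. green \<kappa> \<omega> x - green \<kappa> \<omega> y" "\<lambda>x. exp \<kappa> * A * \<bar>y - x\<bar>" "at y"] by simp
  then show ?thesis unfolding isCont_def by (rule LIM_zero_cancel)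
qed

text \<open>Integration ignores null sets, so \<open>f\<close> is also a primitive of
  \<open>h\<close>, and differentiating the integral of the continuous \<open>h\<close> recovers it
  at every point. This upgrades a regular representative of \<open>b''\<close> to the actual second
  derivative of the shear.\<close>

lemma derivative_eq_continuous_AE:
  fixes f g h :: "real \<Rightarrow> real"
  assumes d: "\<And>y. (f has_real_derivative g y) (at y)" and eq: "AE y in lborel. g y = h y"
    and c: "continuous_on UNIV h"
  shows "g = h"
proof
  fix y
  obtain N where N: "N \<in> null_sets lborel" "{y \<in> space lborel. \<not> g y = h y} \<subseteq> N"
    using eq by (auto simp: eventually_ae_filter)
  then have neg: "negligible N"
    using null_sets_completionI negligible_iff_null_sets by blast
  have *: "integral {y - 1..x} h = f x - f (y - 1)" if "x \<in> {y - 1..y + 1}" for x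
  proof -
    have "(g has_integral (f x - f (y - 1))) {y - 1..x}"
      by (rule fundamental_theorem_of_calculus)
        (use d that in \<open>auto simp: has_real_derivative_iff_has_vector_derivative intro: has_vector_derivative_at_within\<close>)
    then have "(h has_integral (f x - f (y - 1))) {y - 1..x}"
    proof (rule has_integral_spike[OF neg, rotated])
      show "h z = g z" if "z \<in> {y - 1..x} - N" for z
      proof (rule ccontr)
        assume "h z \<noteq> g z"
        then have "z \<in> N" using N(2) by auto
        then show False using that by simp
      qed
    qed
    then show ?thesis by (rule integral_unique)
  qed
  have "((\<lambda>x. integral {y - 1..x} h) has_real_derivative h y) (at y within {y - 1..y + 1})"
    by (rule integral_has_real_derivative) (use c continuous_on_subset in auto)
  then have "((\<lambda>x. integral {y - 1..x} h) has_real_derivative h y) (at y)"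
    by (simp add: at_within_Icc_at)
  then have "((\<lambda>x. f x - f (y - 1)) has_real_derivative h y) (at y)"
    by (rule has_field_derivative_transform_within_open[where S = "{y - 1<..<y + 1}"]) (use * in auto)
  moreover have "((\<lambda>x. f x - f (y - 1)) has_real_derivative g y - 0) (at y)"
    by (intro derivative_intros d)
  ultimately show "g y = h y" using DERIV_unique by fastforce
qed

text \<open>Potentials are continuous, and potentials of continuous functions are twice
  differentiable. The weak second derivative \<open>g2\<close> is the potential of
  \<open>g4 - g2\<close> and so has a continuous representative; \<beta> is the potential of
  \<open>g2 - \<beta>\<close>, hence of the continuous function \<open>q\<close>.\<close>

lemma sobolev_4_twice_differentiable:
  fixes \<beta> :: "real \<Rightarrow> real"
  assumes "\<beta> \<in> sobolev_H 4"
  obtains \<beta>0 \<beta>1 \<beta>2 where "AE y in lborel. \<beta> y = \<beta>0 y" "\<And>y. (\<beta>0 has_real_derivative \<beta>1 y) (at y)"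
    "\<And>y. (\<beta>1 has_real_derivative \<beta>2 y) (at y)" "continuous_on UNIV \<beta>2"
proof -
  have \<beta>: "\<beta> \<in> Ltwo" using assms by (simp add: sobolev_H_def)
  obtain g2 g4 where g: "g2 \<in> Ltwo" "has_weak_deriv 2 \<beta> g2" "g4 \<in> Ltwo" "has_weak_deriv 4 \<beta> g4"
  proof -
    have "\<forall>n\<le>4. \<exists>g\<in>Ltwo. has_weak_deriv n \<beta> g" using assms by (simp add: sobolev_H_def)
    from this[rule_format, of 2] this[rule_format, of 4] show thesis using that by auto
  qed
  have w: "has_weak_deriv 2 g2 g4"
    unfolding has_weak_deriv_def
  proof (intro conjI allI impI Ltwo_locally_integrable g)
    fix \<phi> assume t: "test_function \<phi>"
    have "(LINT y|lborel. (deriv ^^ 2) \<phi> y *\<^sub>R g2 y) = (LINT y|lborel. (deriv ^^ 2) ((deriv ^^ 2) \<phi>) y *\<^sub>R \<beta> y)"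
      using g(2) test_function_funpow_deriv[OF t, of 2] by (simp add: has_weak_deriv_def)
    also have "(deriv ^^ 2) ((deriv ^^ 2) \<phi>) = (deriv ^^ 4) \<phi>"
      by (simp add: numeral_eq_Suc)
    also have "(LINT y|lborel. (deriv ^^ 4) \<phi> y *\<^sub>R \<beta> y) = (LINT y|lborel. \<phi> y *\<^sub>R g4 y)"
      using g(4) t by (simp add: has_weak_deriv_def)
    finally show "(LINT y|lborel. (deriv ^^ 2) \<phi> y *\<^sub>R g2 y) = (- 1) ^ 2 *\<^sub>R (LINT y|lborel. \<phi> y *\<^sub>R g4 y)" by simp
  qed
  have one: "(0::real) < 1" by simp
  define f0 h0 where "f0 = green 1 (\<lambda>y. g4 y - g2 y)" and "h0 = green 1 (\<lambda>y. g2 y - \<beta> y)"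
  have L: "(\<lambda>y. g4 y - g2 y) \<in> Ltwo" "(\<lambda>y. g2 y - \<beta> y) \<in> Ltwo" by (intro Ltwo_diff g \<beta>)+
  have f0: "AE y in lborel. g2 y = f0 y"
    unfolding f0_def by (rule weak_deriv_2_green[OF one g(1) L(1)]) (use w in simp)
  have h0: "AE y in lborel. \<beta> y = h0 y"
    unfolding h0_def by (rule weak_deriv_2_green[OF one \<beta> L(2)]) (use g in simp)
  have c: "isCont f0 y" "isCont h0 y" for y
    unfolding f0_def h0_def by (intro green_isCont L one)+
  define q where "q y = f0 y - h0 y" for y
  have cq: "isCont q y" for y unfolding q_def by (intro continuous_intros c)
  have Lq: "q \<in> Ltwo"
    unfolding q_def[abs_def] f0_def h0_def by (intro Ltwo_diff green_Ltwo L one)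
  have "AE y in lborel. g2 y - \<beta> y = q y" using f0 h0 by eventually_elim (simp add: q_def)
  then have h0q: "h0 = green 1 q"
    unfolding h0_def by (intro green_cong_AE Ltwo_measurable L Lq)
  show ?thesis
  proof (rule that[OF h0])
    show "(h0 has_real_derivative green1 1 q y) (at y)" for y
      unfolding h0q using green_has_deriv(1)[OF one Lq cq] by (simp add: has_real_derivative_iff_has_vector_derivative)
    show "(green1 1 q has_real_derivative h0 y + q y) (at y)" for y
      unfolding h0q using green_has_deriv(2)[OF one Lq cq] by (simp add: has_real_derivative_iff_has_vector_derivative)
    show "continuous_on UNIV (\<lambda>y. h0 y + q y)"
      by (intro continuous_at_imp_continuous_on ballI continuous_intros c cq)
  qed
qed

text \<open>The lower bound near 0 and monotonicity make \<open>R\<close> non-negative. A positive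
  value would persist on a whole half line below the integrable \<open>g\<close>, which is
  impossible. So \<open>R\<close> is constantly 0, and its derivative and \<open>p\<close> vanish as
  well.\<close>

lemma nondecreasing_integrable_zero:
  fixes R R' g p :: "real \<Rightarrow> real"
  assumes d: "\<And>t. t > 0 \<Longrightarrow> (R has_real_derivative R' t) (at t)"
    and p: "\<And>t. t > 0 \<Longrightarrow> 0 \<le> p t \<and> p t \<le> R' t"
    and low: "\<And>t. 0 < t \<Longrightarrow> t \<le> 1 \<Longrightarrow> R t \<ge> - C * t"
    and up: "\<And>t. t > 0 \<Longrightarrow> R t \<le> g t" and g: "integrable lborel g" and "t > 0"
  shows "p t = 0"
proof -
  have mono: "R s \<le> R t" if "0 < s" "s \<le> t" for s t
    using that by (intro DERIV_nonneg_imp_nondecreasing[of s t R]) (auto intro!: exI d order_trans[OF _ conjunct2[OF p]] conjunct1[OF p])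
  have nonneg: "R t \<ge> 0" if "t > 0" for t
  proof (rule ccontr)
    assume "\<not> R t \<ge> 0"
    define s where "s = min (min t 1) (- R t / (2 * (\<bar>C\<bar> + 1)))"
    have s: "0 < s" "s \<le> t" "s \<le> 1" "s \<le> - R t / (2 * (\<bar>C\<bar> + 1))" using that \<open>\<not> R t \<ge> 0\<close> by (auto simp: s_def divide_neg_pos)
    have "C * s \<le> (\<bar>C\<bar> + 1) * (- R t / (2 * (\<bar>C\<bar> + 1)))" using s by (intro mult_mono) auto
    also have "\<dots> = - R t / 2" by (simp add: field_simps)
    finally have "R t < - C * s" using \<open>\<not> R t \<ge> 0\<close> by simp
    then show False using low[OF s(1,3)] mono[OF s(1,2)] by linarith
  qed
  have zero: "R t = 0" if "t > 0" for t
  proof (rule ccontr)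
    assume "R t \<noteq> 0"
    then have q: "R t > 0" using nonneg[OF that] by simp
    have "real n * R t \<le> (LINT y|lborel. norm (g y))" for n
    proof -
      have "real n * R t = (LINT y|lborel. R t * indicat_real {t..t + real n} y)"
        by simp
      also have "\<dots> \<le> (LINT y|lborel. norm (g y))"
      proof (rule integral_mono)
        show "integrable lborel (\<lambda>y. norm (g y))" using g by simp
        show "R t * indicat_real {t..t + real n} y \<le> norm (g y)" for y
          using mono[OF that, of y] up[of y] that by (auto simp: indicator_def)
      qed (simp add: emeasure_lborel_Icc_eq)
      finally show ?thesis .
    qed
    moreover obtain n where "real n * R t > (LINT y|lborel. norm (g y))"
      using reals_Archimedean3[OF q] by blast
    ultimately show False by (meson not_le)
  qed
  have "(R has_real_derivative 0) (at t)"
    by (rule has_field_derivative_transform_within_open[of "\<lambda>_. 0" _ _ "{0<..}"]) (use zero \<open>t > 0\<close> in auto)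
  then have "R' t = 0" using d[OF \<open>t > 0\<close>] DERIV_unique by blast
  then show ?thesis using p[OF \<open>t > 0\<close>] by simp
qed

section \<open>The critical point of an embedded eigenfunction\<close>

lemma mvt_abs:
  fixes f f' :: "real \<Rightarrow> real"
  assumes d: "\<And>z. (f has_real_derivative f' z) (at z)"
  obtains z where "\<bar>z - x\<bar> \<le> \<bar>y - x\<bar>" "f y - f x = (y - x) * f' z"
proof (cases x y rule: linorder_cases)
  case less
  then show thesis using MVT2[of x y f f'] d that by force
next
  case equal
  then show thesis using that[of x] by simp
next
  case greater
  then obtain z where "y < z" "z < x" "f x - f y = (x - y) * f' z" using MVT2[of y x f f'] d by blast
  then show thesis using that[of z] by (simp add: algebra_simps)
qed

lemma taylor_2_bound:
  fixes f g h :: "real \<Rightarrow> real"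
  assumes df: "\<And>z. (f has_real_derivative g z) (at z)" and dg: "\<And>z. (g has_real_derivative h z) (at z)"
    and K: "\<And>z. \<bar>z - x\<bar> \<le> 1 \<Longrightarrow> \<bar>h z\<bar> \<le> K" and y: "\<bar>y - x\<bar> \<le> 1"
  shows "\<bar>f y - f x - g x * (y - x)\<bar> \<le> K * (y - x)\<^sup>2"
proof -
  obtain z where z: "\<bar>z - x\<bar> \<le> \<bar>y - x\<bar>" "f y - f x = (y - x) * g z" using mvt_abs[OF df] by blast
  obtain v where v: "\<bar>v - x\<bar> \<le> \<bar>z - x\<bar>" "g z - g x = (z - x) * h v" using mvt_abs[OF dg] by blast
  have "f y - f x - g x * (y - x) = (y - x) * ((z - x) * h v)"
    unfolding z(2) v(2)[symmetric] by (simp add: algebra_simps)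
  then have "\<bar>f y - f x - g x * (y - x)\<bar> = \<bar>y - x\<bar> * (\<bar>z - x\<bar> * \<bar>h v\<bar>)" by (simp add: abs_mult)
  also have "\<dots> \<le> \<bar>y - x\<bar> * (\<bar>y - x\<bar> * K)"
    using z(1) v(1) y K[of v] by (intro mult_mono) auto
  finally show ?thesis by (simp add: power2_eq_square algebra_simps)
qed

lemma continuous_bounded_near:
  fixes h :: "real \<Rightarrow> real"
  assumes "\<And>y. isCont h y"
  obtains K where "K \<ge> 0" "\<And>z. \<bar>z - x\<bar> \<le> 1 \<Longrightarrow> \<bar>h z\<bar> \<le> K"
proof -
  have "compact (h ` {x - 1..x + 1})"
    by (intro compact_continuous_image continuous_at_imp_continuous_on) (use assms in auto)
  then obtain K where "\<forall>z\<in>{x - 1..x + 1}. norm (h z) \<le> K"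
    by (auto dest!: compact_imp_bounded simp: bounded_iff)
  then have K: "\<And>z. \<bar>z - x\<bar> \<le> 1 \<Longrightarrow> \<bar>h z\<bar> \<le> K" by (auto simp: abs_le_iff)
  moreover have "K \<ge> 0" using K[of x] by simp
  ultimately show thesis using that by blast
qed

text \<open>The eigenvalue equation is stated with \<open>green\<close>, so that the stream function
  has a value at the critical point \<open>y\<^sub>c\<close>. The pointwise derivatives
  \<open>\<beta>1\<close> and \<open>\<beta>2\<close> record what the Sobolev regularity of
  \<open>b''\<close> provides.\<close>

locale shear_eigenfunction =
  fixes \<kappa> m M :: real and b b1 \<beta> \<beta>1 \<beta>2 :: "real \<Rightarrow> real" and y\<^sub>c c :: real and \<omega>0 :: "real \<Rightarrow> complex"
  assumes \<kappa>: "0 < \<kappa>" and m: "0 < m"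
    and db: "\<And>y. (b has_real_derivative b1 y) (at y)" and db1: "\<And>y. (b1 has_real_derivative \<beta> y) (at y)"
    and d\<beta>: "\<And>y. (\<beta> has_real_derivative \<beta>1 y) (at y)" and d\<beta>1: "\<And>y. (\<beta>1 has_real_derivative \<beta>2 y) (at y)"
    and \<beta>2: "\<And>y. isCont \<beta>2 y"
    and b1: "\<And>y. m \<le> b1 y" "\<And>y. b1 y \<le> M" and c: "b y\<^sub>c = c"
    and \<omega>0: "\<omega>0 \<in> Ltwo" and eigen: "AE y in lborel. (b y - c) *\<^sub>R \<omega>0 y = \<beta> y *\<^sub>R green \<kappa> \<omega>0 y"
    and nonzero: "\<not> (AE y in lborel. \<omega>0 y = 0)" and \<beta>_Ltwo: "\<beta> \<in> Ltwo"
begin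

definition \<psi> :: "real \<Rightarrow> complex" where "\<psi> = green \<kappa> \<omega>0"
text \<open>The representative of the eigenfunction that is continuous away from
  \<open>y\<^sub>c\<close>. At \<open>y\<^sub>c\<close> division by 0 gives it the value 0, so
  estimates near the critical point leave that point out.\<close>

definition W :: "real \<Rightarrow> complex" where "W y = (\<beta> y / (b y - c)) *\<^sub>R \<psi> y"

text \<open>The mean value theorem makes \<open>b y - c\<close> comparable with
  \<open>y - y\<^sub>c\<close> on the whole line, which is what quantifies every singularity
  below.\<close>

lemma speed_factor:
  obtains r where "m \<le> r" "r \<le> M" "b y - c = (y - y\<^sub>c) * r"
proof -
  obtain z where "b y - b y\<^sub>c = (y - y\<^sub>c) * b1 z" using mvt_abs[OF db] by blast
  then show thesis using that[of "b1 z"] b1 c by simp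
qed

lemma speed_lower: "m * \<bar>y - y\<^sub>c\<bar> \<le> \<bar>b y - c\<bar>"
proof -
  obtain r where r: "m \<le> r" "b y - c = (y - y\<^sub>c) * r" using speed_factor[of y] by blast
  have "m * \<bar>y - y\<^sub>c\<bar> \<le> r * \<bar>y - y\<^sub>c\<bar>" using r by (intro mult_right_mono) auto
  also have "\<dots> = \<bar>b y - c\<bar>" using r m by (simp add: abs_mult)
  finally show ?thesis .
qed

lemma speed_upper: "\<bar>b y - c\<bar> \<le> M * \<bar>y - y\<^sub>c\<bar>"
proof -
  obtain r where r: "m \<le> r" "r \<le> M" "b y - c = (y - y\<^sub>c) * r" using speed_factor[of y] by blast
  have "\<bar>b y - c\<bar> = r * \<bar>y - y\<^sub>c\<bar>" using r m by (simp add: abs_mult)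
  also have "\<dots> \<le> M * \<bar>y - y\<^sub>c\<bar>" using r by (intro mult_right_mono) auto
  finally show ?thesis .
qed

lemma speed_nonzero: "y \<noteq> y\<^sub>c \<Longrightarrow> b y - c \<noteq> 0"
  using speed_lower[of y] m by (metis abs_zero mult_pos_pos not_le zero_less_abs_iff right_minus_eq)

lemma b_cont: "isCont b y" and \<beta>_cont: "isCont \<beta> y"
  using db d\<beta> DERIV_isCont by blast+

lemma \<psi>_cont: "isCont \<psi> y"
  unfolding \<psi>_def by (rule green_isCont[OF \<kappa> \<omega>0])

lemma measurables [measurable]:
  "b \<in> borel_measurable borel" "\<beta> \<in> borel_measurable borel" "\<psi> \<in> borel_measurable borel"
  "W \<in> borel_measurable borel" "\<omega>0 \<in> borel_measurable borel"
proof -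
  show [measurable]: "b \<in> borel_measurable borel" "\<beta> \<in> borel_measurable borel" "\<psi> \<in> borel_measurable borel"
    using b_cont \<beta>_cont \<psi>_cont by (auto intro!: borel_measurable_continuous_onI continuous_at_imp_continuous_on)
  show "W \<in> borel_measurable borel" unfolding W_def[abs_def] by measurable
  show "\<omega>0 \<in> borel_measurable borel" using \<omega>0 by (rule Ltwo_measurable)
qed

lemma \<omega>0_eq_W: "AE y in lborel. \<omega>0 y = W y"
  using eigen AE_lborel_singleton[of y\<^sub>c]
proof eventually_elim
  case (elim y)
  have "\<omega>0 y = (1 / (b y - c)) *\<^sub>R ((b y - c) *\<^sub>R \<omega>0 y)" using speed_nonzero[OF elim(2)] by simp
  also have "\<dots> = (1 / (b y - c)) *\<^sub>R (\<beta> y *\<^sub>R \<psi> y)" using elim(1) by (simp only: \<psi>_def)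
  finally show ?case by (simp add: W_def)
qed

lemma W_Ltwo: "W \<in> Ltwo"
  by (rule Ltwo_bound[OF _ \<omega>0]) (use \<omega>0_eq_W in \<open>auto elim!: eventually_mono\<close>)

lemma green_W: "green \<kappa> W = \<psi>"
  unfolding \<psi>_def using \<omega>0_eq_W by (intro green_cong_AE) (auto elim!: eventually_mono)

lemma W_cont: "y \<noteq> y\<^sub>c \<Longrightarrow> isCont W y"
  unfolding W_def using speed_nonzero[of y] by (intro continuous_intros b_cont \<beta>_cont \<psi>_cont) auto

lemma \<psi>_lipschitz:
  obtains L where "L \<ge> 0" "\<And>y. \<bar>y - y\<^sub>c\<bar> \<le> 1 \<Longrightarrow> norm (\<psi> y - \<psi> y\<^sub>c) \<le> L * \<bar>y - y\<^sub>c\<bar>"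
proof (rule that)
  show "0 \<le> exp \<kappa> * (Ltwo_norm (expk \<kappa>) * Ltwo_norm \<omega>0)" by simp
  show "norm (\<psi> y - \<psi> y\<^sub>c) \<le> exp \<kappa> * (Ltwo_norm (expk \<kappa>) * Ltwo_norm \<omega>0) * \<bar>y - y\<^sub>c\<bar>" if "\<bar>y - y\<^sub>c\<bar> \<le> 1" for y
    using green_lipschitz[OF \<kappa> \<omega>0 expk_integral_le_Ltwo[OF \<kappa> \<omega>0], of y\<^sub>c y] that
    by (simp add: \<psi>_def abs_minus_commute)
qed

section \<open>The energy flux\<close>

definition \<psi>1 :: "real \<Rightarrow> complex" where "\<psi>1 = green1 \<kappa> W"
text \<open>In terms of \<open>f = \<psi> / (b - c)\<close> the equation reads
  \<open>((b - c)\<^sup>2 f')' = \<kappa>\<^sup>2 (b - c)\<^sup>2 f\<close>, from which \<beta> has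
  disappeared. \<open>Q\<close> is the real inner product of \<open>f\<close> and
  \<open>(b - c)\<^sup>2 f'\<close>, so its derivative is a sum of squares.\<close>

definition Q :: "real \<Rightarrow> real" where "Q y = \<psi> y \<bullet> \<psi>1 y - b1 y * (\<psi> y \<bullet> \<psi> y) / (b y - c)"
definition Q' :: "real \<Rightarrow> real" where
  "Q' y = (norm (\<psi>1 y - (b1 y / (b y - c)) *\<^sub>R \<psi> y))\<^sup>2 + \<kappa>\<^sup>2 * (norm (\<psi> y))\<^sup>2"

lemma Q_deriv:
  assumes "y \<noteq> y\<^sub>c" shows "(Q has_real_derivative Q' y) (at y)"
proof -
  let ?B = "b y - c"
  have B: "?B \<noteq> 0" by (rule speed_nonzero[OF assms])
  have d: "(\<psi> has_vector_derivative \<psi>1 y) (at y)" "(\<psi>1 has_vector_derivative \<kappa>\<^sup>2 *\<^sub>R \<psi> y + W y) (at y)"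
    using green_has_deriv[OF \<kappa> W_Ltwo W_cont[OF assms]] by (simp_all add: green_W \<psi>1_def)
  note i = bounded_bilinear.has_vector_derivative[OF bounded_bilinear_inner, folded has_real_derivative_iff_has_vector_derivative]
  have "(Q has_real_derivative
      (\<psi> y \<bullet> (\<kappa>\<^sup>2 *\<^sub>R \<psi> y + W y) + \<psi>1 y \<bullet> \<psi>1 y) -
      ((\<beta> y * (\<psi> y \<bullet> \<psi> y) + (\<psi> y \<bullet> \<psi>1 y + \<psi>1 y \<bullet> \<psi> y) * b1 y) * ?B - (b1 y * (\<psi> y \<bullet> \<psi> y)) * (b1 y - 0)) / (?B * ?B)) (at y)"
    unfolding Q_def[abs_def]
    by (intro derivative_intros DERIV_divide DERIV_mult DERIV_diff i d db db1 B DERIV_const)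
  also have "(\<psi> y \<bullet> (\<kappa>\<^sup>2 *\<^sub>R \<psi> y + W y) + \<psi>1 y \<bullet> \<psi>1 y) -
      ((\<beta> y * (\<psi> y \<bullet> \<psi> y) + (\<psi> y \<bullet> \<psi>1 y + \<psi>1 y \<bullet> \<psi> y) * b1 y) * ?B - (b1 y * (\<psi> y \<bullet> \<psi> y)) * (b1 y - 0)) / (?B * ?B) = Q' y"
  proof -
    define B X Y Z where "B = ?B" and "X = \<psi> y \<bullet> \<psi> y" and "Y = \<psi> y \<bullet> \<psi>1 y" and "Z = \<psi>1 y \<bullet> \<psi>1 y"
    have sq: "(norm (v - q *\<^sub>R u))\<^sup>2 = v \<bullet> v - 2 * q * (u \<bullet> v) + q\<^sup>2 * (u \<bullet> u)" for q and u v :: complex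
      unfolding power2_norm_eq_inner
      by (simp add: inner_diff_left inner_diff_right inner_commute[of v u] power2_eq_square algebra_simps)
    have "Q' y = (Z - 2 * (b1 y / B) * Y + (b1 y / B)\<^sup>2 * X) + \<kappa>\<^sup>2 * X"
      unfolding Q'_def sq B_def X_def Y_def Z_def by (simp add: power2_norm_eq_inner)
    also have "\<dots> = (\<kappa>\<^sup>2 * X + \<beta> y / B * X + Z) - ((\<beta> y * X + 2 * Y * b1 y) * B - (b1 y * X) * b1 y) / (B * B)"
    proof -
      define i where "i = inverse B"
      have i: "B * i = 1" using B by (simp add: i_def B_def)
      have "((\<beta> y * X + 2 * Y * b1 y) * B - (b1 y * X) * b1 y) * (i * i) =
          (\<beta> y * X + 2 * Y * b1 y) * i * (B * i) - (b1 y * X) * b1 y * (i * i)" by (simp add: algebra_simps)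
      then show ?thesis unfolding i by (simp add: divide_inverse i_def[symmetric] power2_eq_square algebra_simps)
    qed
    finally show ?thesis
      by (simp add: W_def B_def X_def Y_def Z_def inner_add_right inner_commute[of "\<psi>1 y" "\<psi> y"])
  qed
  finally show ?thesis .
qed

text \<open>\<open>s\<close> selects the half line, on which \<open>s * Q\<close> increases away
  from \<open>y\<^sub>c\<close>. Near \<open>y\<^sub>c\<close> it is bounded below linearly, since
  \<psi> is Lipschitz and vanishes there. Above, it is bounded by an integrable product of norms,
  because the term with \<open>b1\<close> has a favourable sign on both sides.\<close>

lemma \<psi>_zero_side:
  assumes zero: "\<psi> y\<^sub>c = 0" and s: "s = 1 \<or> s = - 1" and "t > 0"
  shows "\<psi> (y\<^sub>c + s * t) = 0"
proof -
  obtain L where L: "L \<ge> 0" "\<And>y. \<bar>y - y\<^sub>c\<bar> \<le> 1 \<Longrightarrow> norm (\<psi> y - \<psi> y\<^sub>c) \<le> L * \<bar>y - y\<^sub>c\<bar>" using \<psi>_lipschitz by blast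
  define N where "N = (Ltwo_norm (expk \<kappa>) * Ltwo_norm W) / 2"
  have N: "norm (\<psi>1 y) \<le> N" for y
    using order_trans[OF conv_le_expk[OF exp_kernel_sgnk[OF \<kappa>] W_Ltwo] expk_integral_le_Ltwo[OF \<kappa> W_Ltwo], of y]
    by (simp add: \<psi>1_def green1_def N_def)
  have M: "M > 0" using m b1[of 0] by linarith
  define R where "R t = s * Q (y\<^sub>c + s * t)" for t
  define g where "g t = norm (\<psi> (y\<^sub>c + s * t)) * norm (\<psi>1 (y\<^sub>c + s * t))" for t
  have ss: "s * s = 1" "\<bar>s\<bar> = 1" "s \<noteq> 0" using s by auto
  have up: "R t \<le> g t" if "t > 0" for t
  proof -
    obtain r where r: "m \<le> r" "b (y\<^sub>c + s * t) - c = (s * t) * r" using speed_factor[of "y\<^sub>c + s * t"] by auto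
    have "s * (\<psi> (y\<^sub>c + s * t) \<bullet> \<psi>1 (y\<^sub>c + s * t)) \<le> g t"
      using Cauchy_Schwarz_ineq2[of "\<psi> (y\<^sub>c + s * t)" "\<psi>1 (y\<^sub>c + s * t)"] s unfolding g_def by auto
    moreover have "0 \<le> s * (b1 (y\<^sub>c + s * t) * (\<psi> (y\<^sub>c + s * t) \<bullet> \<psi> (y\<^sub>c + s * t)) / (b (y\<^sub>c + s * t) - c))"
    proof -
      have "s * (b1 (y\<^sub>c + s * t) * (\<psi> (y\<^sub>c + s * t) \<bullet> \<psi> (y\<^sub>c + s * t)) / (b (y\<^sub>c + s * t) - c))
          = b1 (y\<^sub>c + s * t) * (\<psi> (y\<^sub>c + s * t) \<bullet> \<psi> (y\<^sub>c + s * t)) / (t * r)"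
        unfolding r(2) using ss by simp
      also have "\<dots> \<ge> 0" using b1(1)[of "y\<^sub>c + s * t"] m r that by (intro divide_nonneg_nonneg mult_nonneg_nonneg) auto
      finally show ?thesis .
    qed
    ultimately show ?thesis unfolding R_def Q_def by (simp add: right_diff_distrib)
  qed
  have low: "R t \<ge> - (L * N + M * L\<^sup>2 / m) * t" if t: "0 < t" "t \<le> 1" for t
  proof -
    let ?y = "y\<^sub>c + s * t"
    have p: "norm (\<psi> ?y) \<le> L * t" using L(2)[of ?y] zero t ss by (simp add: abs_mult)
    have "norm (\<psi> ?y) * norm (\<psi>1 ?y) \<le> (L * t) * N" using p N t L by (intro mult_mono) auto
    then have 1: "\<bar>\<psi> ?y \<bullet> \<psi>1 ?y\<bar> \<le> (L * t) * N" using Cauchy_Schwarz_ineq2[of "\<psi> ?y" "\<psi>1 ?y"] by linarith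
    have "\<bar>b1 ?y * (\<psi> ?y \<bullet> \<psi> ?y) / (b ?y - c)\<bar> = b1 ?y * (norm (\<psi> ?y))\<^sup>2 / \<bar>b ?y - c\<bar>"
      using b1(1)[of ?y] m by (simp add: abs_mult power2_norm_eq_inner)
    also have "\<dots> \<le> M * (L * t)\<^sup>2 / (m * t)"
      using b1[of ?y] m speed_lower[of ?y] ss t p M by (intro frac_le mult_mono power_mono) (auto simp: abs_mult)
    also have "\<dots> = M * L\<^sup>2 / m * t" using t m by (simp add: power2_eq_square field_simps)
    finally have 2: "\<bar>b1 ?y * (\<psi> ?y \<bullet> \<psi> ?y) / (b ?y - c)\<bar> \<le> M * L\<^sup>2 / m * t" .
    have "\<bar>R t\<bar> = \<bar>Q ?y\<bar>" using ss by (simp add: R_def abs_mult)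
    also have "\<dots> \<le> (L * t) * N + M * L\<^sup>2 / m * t" using 1 2 unfolding Q_def by linarith
    finally show ?thesis by (simp add: algebra_simps)
  qed
  have "\<kappa>\<^sup>2 * (norm (\<psi> (y\<^sub>c + s * t)))\<^sup>2 = 0"
  proof (rule nondecreasing_integrable_zero[where R = R and R' = "\<lambda>t. Q' (y\<^sub>c + s * t)" and g = g
        and C = "L * N + M * L\<^sup>2 / m" and p = "\<lambda>t. \<kappa>\<^sup>2 * (norm (\<psi> (y\<^sub>c + s * t)))\<^sup>2"])
    show "(R has_real_derivative Q' (y\<^sub>c + s * t)) (at t)" if "t > 0" for t
    proof -
      have "((\<lambda>t. y\<^sub>c + s * t) has_real_derivative s) (at t)" by (auto intro!: derivative_eq_intros)
      moreover have "(Q has_real_derivative Q' (y\<^sub>c + s * t)) (at (y\<^sub>c + s * t))" using that ss by (intro Q_deriv) auto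
      ultimately have "((\<lambda>t. Q (y\<^sub>c + s * t)) has_real_derivative Q' (y\<^sub>c + s * t) * s) (at t)" by (rule DERIV_chain2[rotated])
      from DERIV_cmult[OF this, of s] show ?thesis
        using ss by (simp add: R_def[abs_def] mult.left_commute[of s])
    qed
    show "0 \<le> \<kappa>\<^sup>2 * (norm (\<psi> (y\<^sub>c + s * t)))\<^sup>2 \<and> \<kappa>\<^sup>2 * (norm (\<psi> (y\<^sub>c + s * t)))\<^sup>2 \<le> Q' (y\<^sub>c + s * t)" for t
      by (simp add: Q'_def)
    have "integrable lborel (\<lambda>y. norm (\<psi> y) * norm (\<psi>1 y))"
      unfolding \<psi>_def \<psi>1_def by (intro Ltwo_product green_Ltwo green1_Ltwo \<kappa> \<omega>0 W_Ltwo)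
    from lborel_integrable_real_affine[OF this ss(3)] show "integrable lborel g" by (simp add: g_def[abs_def])
  qed (use low up \<open>t > 0\<close> in auto)
  then show ?thesis using \<kappa> by simp
qed

text \<open>If \<open>\<psi>\<close> vanished at the critical point, then \<open>\<psi> / (b - c)\<close> would be an admissible multiplier:
  \<open>Q\<close> is the flux of the resulting energy identity, it is monotone and tends to zero at both ends of
  each half line.\<close>

lemma \<psi>_yc_nonzero: "\<psi> y\<^sub>c \<noteq> 0"
proof
  assume zero: "\<psi> y\<^sub>c = 0"
  have "\<psi> y = 0" for y
  proof (cases y y\<^sub>c rule: linorder_cases)
    case less
    then show ?thesis using \<psi>_zero_side[OF zero, of "-1" "y\<^sub>c - y"] by simp
  next
    case equal
    then show ?thesis using zero by simp
  next
    case greater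
    then show ?thesis using \<psi>_zero_side[OF zero, of 1 "y - y\<^sub>c"] by simp
  qed
  then have "W = (\<lambda>y. 0)" by (auto simp: W_def)
  then show False using \<omega>0_eq_W nonzero by simp
qed

text \<open>Otherwise the norm of \<open>W\<close> is at least
  \<open>d / (M * \<bar>y - y\<^sub>c\<bar>)\<close> near the critical point, and its square has
  integral at least \<open>d\<^sup>2 / (4 * M\<^sup>2 * s)\<close> between the distances
  \<open>s\<close> and \<open>2 * s\<close>. For small \<open>s\<close> this exceeds the squared
  norm \<open>N\<close>.\<close>

lemma \<beta>_yc_zero: "\<beta> y\<^sub>c = 0"
proof (rule ccontr)
  assume nz: "\<beta> y\<^sub>c \<noteq> 0"
  have M: "M > 0" using m b1[of 0] by linarith
  define F where "F y = \<bar>\<beta> y\<bar> * norm (\<psi> y)" for y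
  have Fc: "isCont F y\<^sub>c" unfolding F_def by (intro continuous_intros \<beta>_cont \<psi>_cont)
  define d where "d = F y\<^sub>c / 2"
  have F0: "F y\<^sub>c > 0" using nz \<psi>_yc_nonzero by (simp add: F_def)
  then have d: "d > 0" by (simp add: d_def)
  have "\<forall>\<^sub>F y in at y\<^sub>c. F y > d"
    using Fc F0 unfolding isCont_def d_def by (intro order_tendstoD(1)) auto
  then obtain e where e: "e > 0" "\<And>y. y \<noteq> y\<^sub>c \<Longrightarrow> \<bar>y - y\<^sub>c\<bar> < e \<Longrightarrow> F y > d"
    by (auto simp: eventually_at dist_real_def)
  define N where "N = (Ltwo_norm W)\<^sup>2"
  define s where "s = min (e / 3) (d\<^sup>2 / (M\<^sup>2 * 4 * (N + 1)))"
  have N: "N \<ge> 0" by (simp add: N_def)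
  have s: "s > 0" "2 * s < e" using e d M N by (auto simp: s_def)
  have sN: "s * (M\<^sup>2 * 4 * (N + 1)) \<le> d\<^sup>2"
  proof -
    have "s \<le> d\<^sup>2 / (M\<^sup>2 * 4 * (N + 1))" by (simp add: s_def)
    then show ?thesis using M N by (subst (asm) pos_le_divide_eq) auto
  qed
  let ?I = "{y\<^sub>c + s..y\<^sub>c + 2 * s}"
  have "(d / (M * (2 * s)))\<^sup>2 * s = (LINT y|lborel. (d / (M * (2 * s)))\<^sup>2 * indicat_real ?I y)"
    using s by simp
  also have "\<dots> \<le> (LINT y|lborel. (norm (W y))\<^sup>2)"
  proof (rule integral_mono)
    show "integrable lborel (\<lambda>y. (norm (W y))\<^sup>2)" by (rule Ltwo_integrable[OF W_Ltwo])
    show "(d / (M * (2 * s)))\<^sup>2 * indicat_real ?I y \<le> (norm (W y))\<^sup>2" for y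
    proof (cases "y \<in> ?I")
      case True
      have "d / (M * (2 * s)) \<le> F y / \<bar>b y - c\<bar>"
      proof (rule frac_le)
        show "d \<le> F y" using e(2)[of y] True s by auto
        have "\<bar>b y - c\<bar> \<le> M * \<bar>y - y\<^sub>c\<bar>" by (rule speed_upper)
        also have "\<dots> \<le> M * (2 * s)" using True s M by (intro mult_left_mono) auto
        finally show "\<bar>b y - c\<bar> \<le> M * (2 * s)" .
        show "0 < \<bar>b y - c\<bar>" using speed_nonzero[of y] True s by auto
      qed (simp add: F_def)
      also have "\<dots> = norm (W y)" by (simp add: F_def W_def)
      finally have "(d / (M * (2 * s)))\<^sup>2 \<le> (norm (W y))\<^sup>2" using d M s by (intro power_mono) auto
      then show ?thesis using True by simp
    qed simp
  qed (use s in \<open>simp add: emeasure_lborel_Icc_eq\<close>)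
  also have "\<dots> = N" by (simp add: N_def Ltwo_norm_sq)
  finally have "d\<^sup>2 \<le> N * (M\<^sup>2 * 4 * s)"
    using s M by (simp add: power_mult_distrib power_divide field_simps power2_eq_square)
  also have "\<dots> < s * (M\<^sup>2 * 4 * (N + 1))" using s M by (simp add: algebra_simps)
  finally show False using sN by simp
qed

lemma speed_taylor:
  obtains K where "K \<ge> 0" "\<And>y. \<bar>y - y\<^sub>c\<bar> \<le> 1 \<Longrightarrow> \<bar>b y - c - b1 y\<^sub>c * (y - y\<^sub>c)\<bar> \<le> K * (y - y\<^sub>c)\<^sup>2"
proof -
  obtain K where "K \<ge> 0" "\<And>z. \<bar>z - y\<^sub>c\<bar> \<le> 1 \<Longrightarrow> \<bar>\<beta> z\<bar> \<le> K"
    using continuous_bounded_near[OF \<beta>_cont] by blast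
  then show thesis using that[of K] taylor_2_bound[OF db db1, of y\<^sub>c K] c by simp
qed

text \<open>\<beta> and \<open>b - c\<close> both vanish at \<open>y\<^sub>c\<close>, the latter
  with non-zero slope. Second order Taylor bounds for each give their quotient the limit
  \<open>\<beta>1 y\<^sub>c / b1 y\<^sub>c\<close> with a linear error, and the Lipschitz factor
  \<psi> preserves this.\<close>

lemma W_near:
  obtains w C where "C \<ge> 0" "\<And>y. y \<noteq> y\<^sub>c \<Longrightarrow> \<bar>y - y\<^sub>c\<bar> \<le> 1 \<Longrightarrow> norm (W y - w) \<le> C * \<bar>y - y\<^sub>c\<bar>"
proof -
  obtain K1 where K1: "K1 \<ge> 0" "\<And>y. \<bar>y - y\<^sub>c\<bar> \<le> 1 \<Longrightarrow> \<bar>b y - c - b1 y\<^sub>c * (y - y\<^sub>c)\<bar> \<le> K1 * (y - y\<^sub>c)\<^sup>2"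
    using speed_taylor by blast
  obtain K2 where K2: "K2 \<ge> 0" "\<And>z. \<bar>z - y\<^sub>c\<bar> \<le> 1 \<Longrightarrow> \<bar>\<beta>2 z\<bar> \<le> K2"
    using continuous_bounded_near[OF \<beta>2] by blast
  have \<beta>: "\<bar>\<beta> y - \<beta>1 y\<^sub>c * (y - y\<^sub>c)\<bar> \<le> K2 * (y - y\<^sub>c)\<^sup>2" if "\<bar>y - y\<^sub>c\<bar> \<le> 1" for y
    using taylor_2_bound[OF d\<beta> d\<beta>1 K2(2) that] by (simp add: \<beta>_yc_zero)
  obtain L where L: "L \<ge> 0" "\<And>y. \<bar>y - y\<^sub>c\<bar> \<le> 1 \<Longrightarrow> norm (\<psi> y - \<psi> y\<^sub>c) \<le> L * \<bar>y - y\<^sub>c\<bar>" using \<psi>_lipschitz by blast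
  define a where "a = b1 y\<^sub>c"
  have a: "a > 0" using b1(1)[of y\<^sub>c] m by (simp add: a_def)
  define r where "r = \<beta>1 y\<^sub>c / a"
  define D where "D = (a * K2 + \<bar>\<beta>1 y\<^sub>c\<bar> * K1) / (m * a)"
  have D: "D \<ge> 0" using a K1 K2 m by (simp add: D_def)
  have q: "\<bar>\<beta> y / (b y - c) - r\<bar> \<le> D * \<bar>y - y\<^sub>c\<bar>" if y: "y \<noteq> y\<^sub>c" "\<bar>y - y\<^sub>c\<bar> \<le> 1" for y
  proof -
    let ?x = "y - y\<^sub>c" and ?B = "b y - c"
    have B: "?B \<noteq> 0" using speed_nonzero[OF y(1)] .
    have "\<beta> y / ?B - r = (a * (\<beta> y - \<beta>1 y\<^sub>c * ?x) - \<beta>1 y\<^sub>c * (?B - a * ?x)) / (?B * a)"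
      using B a by (simp add: r_def field_simps)
    then have "\<bar>\<beta> y / ?B - r\<bar> = \<bar>a * (\<beta> y - \<beta>1 y\<^sub>c * ?x) - \<beta>1 y\<^sub>c * (?B - a * ?x)\<bar> / (\<bar>?B\<bar> * a)"
      using a by (simp add: abs_mult)
    also have "\<dots> \<le> (a * (K2 * ?x\<^sup>2) + \<bar>\<beta>1 y\<^sub>c\<bar> * (K1 * ?x\<^sup>2)) / ((m * \<bar>?x\<bar>) * a)"
    proof (rule frac_le)
      have "\<bar>a * (\<beta> y - \<beta>1 y\<^sub>c * ?x) - \<beta>1 y\<^sub>c * (?B - a * ?x)\<bar>
          \<le> a * \<bar>\<beta> y - \<beta>1 y\<^sub>c * ?x\<bar> + \<bar>\<beta>1 y\<^sub>c\<bar> * \<bar>?B - a * ?x\<bar>"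
        using abs_triangle_ineq4[of "a * (\<beta> y - \<beta>1 y\<^sub>c * ?x)" "\<beta>1 y\<^sub>c * (?B - a * ?x)"] a by (simp add: abs_mult)
      also have "\<dots> \<le> a * (K2 * ?x\<^sup>2) + \<bar>\<beta>1 y\<^sub>c\<bar> * (K1 * ?x\<^sup>2)"
        using \<beta>[OF y(2)] K1(2)[OF y(2)] a by (intro add_mono mult_left_mono) (auto simp: a_def)
      finally show "\<bar>a * (\<beta> y - \<beta>1 y\<^sub>c * ?x) - \<beta>1 y\<^sub>c * (?B - a * ?x)\<bar> \<le> a * (K2 * ?x\<^sup>2) + \<bar>\<beta>1 y\<^sub>c\<bar> * (K1 * ?x\<^sup>2)" .
      show "0 < (m * \<bar>?x\<bar>) * a" using y m a by simp
      show "(m * \<bar>?x\<bar>) * a \<le> \<bar>?B\<bar> * a" using a speed_lower[of y] by (intro mult_right_mono) auto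
    qed (use a K1 K2 in simp)
    also have "\<dots> = D * \<bar>?x\<bar>"
    proof -
      define u where "u = \<bar>?x\<bar>"
      have u: "u > 0" "?x\<^sup>2 = u * u" using y by (auto simp: u_def power2_eq_square)
      have "(a * (K2 * (u * u)) + \<bar>\<beta>1 y\<^sub>c\<bar> * (K1 * (u * u))) / ((m * u) * a) = ((a * K2 + \<bar>\<beta>1 y\<^sub>c\<bar> * K1) * (u * u)) / ((m * a) * u)"
        by (simp add: algebra_simps)
      then show ?thesis unfolding u(2) u_def[symmetric] using u(1) by (simp add: D_def)
    qed
    finally show ?thesis .
  qed
  show thesis
  proof (rule that[of "D * (norm (\<psi> y\<^sub>c) + L) + \<bar>r\<bar> * L" "r *\<^sub>R \<psi> y\<^sub>c"])
    show "0 \<le> D * (norm (\<psi> y\<^sub>c) + L) + \<bar>r\<bar> * L" using D L by simp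
    fix y assume y: "y \<noteq> y\<^sub>c" "\<bar>y - y\<^sub>c\<bar> \<le> 1"
    have n: "norm (\<psi> y) \<le> norm (\<psi> y\<^sub>c) + L"
    proof -
      have "norm (\<psi> y) \<le> norm (\<psi> y\<^sub>c) + norm (\<psi> y - \<psi> y\<^sub>c)" using norm_triangle_sub by blast
      moreover have "L * \<bar>y - y\<^sub>c\<bar> \<le> L" using L y by (simp add: mult_left_le)
      ultimately show ?thesis using L(2)[OF y(2)] by linarith
    qed
    have "W y - r *\<^sub>R \<psi> y\<^sub>c = (\<beta> y / (b y - c) - r) *\<^sub>R \<psi> y + r *\<^sub>R (\<psi> y - \<psi> y\<^sub>c)"
      by (simp add: W_def algebra_simps)
    then have "norm (W y - r *\<^sub>R \<psi> y\<^sub>c) \<le> \<bar>\<beta> y / (b y - c) - r\<bar> * norm (\<psi> y) + \<bar>r\<bar> * norm (\<psi> y - \<psi> y\<^sub>c)"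
      by (metis norm_scaleR norm_triangle_ineq)
    also have "\<dots> \<le> (D * \<bar>y - y\<^sub>c\<bar>) * (norm (\<psi> y\<^sub>c) + L) + \<bar>r\<bar> * (L * \<bar>y - y\<^sub>c\<bar>)"
      using q[OF y] n L y D by (intro add_mono mult_mono) auto
    finally show "norm (W y - r *\<^sub>R \<psi> y\<^sub>c) \<le> (D * (norm (\<psi> y\<^sub>c) + L) + \<bar>r\<bar> * L) * \<bar>y - y\<^sub>c\<bar>"
      by (simp add: algebra_simps)
  qed
qed

end

section \<open>Singular integrals at the critical point\<close>

lemma set_integral_difference_bound:
  fixes f g :: "real \<Rightarrow> complex"
  assumes f: "set_integrable lborel {p..q} f" and g: "set_integrable lborel {p..q} g"
    and D: "\<And>y. y \<in> {p..q} \<Longrightarrow> y \<noteq> x \<Longrightarrow> norm (f y - g y) \<le> D" and "p \<le> q"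
  shows "norm ((LINT y:{p..q}|lborel. f y) - (LINT y:{p..q}|lborel. g y)) \<le> D * (q - p)"
proof -
  have i: "integrable lborel (\<lambda>y. indicator {p..q} y *\<^sub>R f y - indicator {p..q} y *\<^sub>R g y)"
    using f g unfolding set_integrable_def by (rule Bochner_Integration.integrable_diff)
  have "(LINT y:{p..q}|lborel. f y) - (LINT y:{p..q}|lborel. g y)
      = (LINT y|lborel. indicator {p..q} y *\<^sub>R f y - indicator {p..q} y *\<^sub>R g y)"
    using f g unfolding set_integrable_def set_lebesgue_integral_def by simp
  also have "norm \<dots> \<le> (LINT y|lborel. norm (indicator {p..q} y *\<^sub>R f y - indicator {p..q} y *\<^sub>R g y))"
    by (rule integral_norm_bound)
  also have "\<dots> \<le> (LINT y|lborel. D * indicat_real {p..q} y)"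
  proof (rule integral_mono_AE)
    show "integrable lborel (\<lambda>y. norm (indicator {p..q} y *\<^sub>R f y - indicator {p..q} y *\<^sub>R g y))"
      using i by (rule integrable_norm)
    show "integrable lborel (\<lambda>y. D * indicat_real {p..q} y)" by (simp add: emeasure_lborel_Icc_eq)
    show "AE y in lborel. norm (indicator {p..q} y *\<^sub>R f y - indicator {p..q} y *\<^sub>R g y) \<le> D * indicat_real {p..q} y"
      using AE_lborel_singleton[of x]
    proof eventually_elim
      case (elim y)
      then show ?case using D[of y] by (cases "y \<in> {p..q}") auto
    qed
  qed
  also have "\<dots> = D * (q - p)" using \<open>p \<le> q\<close> by simp
  finally show ?thesis .
qed

lemma Complex_inverse_bounds:
  assumes "\<epsilon> \<noteq> 0"
  shows "Complex u (- \<epsilon>) \<noteq> 0" "\<bar>u\<bar> \<le> norm (Complex u (- \<epsilon>))" "\<bar>\<epsilon>\<bar> \<le> norm (Complex u (- \<epsilon>))"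
  using assms abs_Re_le_cmod[of "Complex u (- \<epsilon>)"] abs_Im_le_cmod[of "Complex u (- \<epsilon>)"]
  by (auto simp: complex_eq_iff)

text \<open>The real part of the primitive is a logarithm, the imaginary part an arctangent. On an
  interval symmetric about \<open>x\<close> the logarithms cancel; on one that starts at
  \<open>x\<close> they diverge as \<epsilon> tends to 0. Both situations occur.\<close>

lemma set_integral_Complex_inverse:
  fixes x a \<epsilon> p q :: real
  assumes a: "a > 0" and \<epsilon>: "\<epsilon> \<noteq> 0" and "p \<le> q"
  defines "H \<equiv> \<lambda>y. Complex (ln (a\<^sup>2 * (y - x)\<^sup>2 + \<epsilon>\<^sup>2) / (2 * a)) (arctan (a * (y - x) / \<epsilon>) / a)"
  shows "set_integrable lborel {p..q} (\<lambda>y. 1 / Complex (a * (y - x)) (- \<epsilon>))"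
    and "(LINT y:{p..q}|lborel. 1 / Complex (a * (y - x)) (- \<epsilon>)) = H q - H p"
proof -
  have pos: "a\<^sup>2 * (y - x)\<^sup>2 + \<epsilon>\<^sup>2 > 0" for y using \<epsilon> by (intro add_nonneg_pos) auto
  have inv: "1 / Complex (a * (y - x)) (- \<epsilon>) =
      Complex (a * (y - x) / (a\<^sup>2 * (y - x)\<^sup>2 + \<epsilon>\<^sup>2)) (\<epsilon> / (a\<^sup>2 * (y - x)\<^sup>2 + \<epsilon>\<^sup>2))" for y
    by (simp add: complex_eq_iff Re_divide Im_divide power_mult_distrib)
  show i: "set_integrable lborel {p..q} (\<lambda>y. 1 / Complex (a * (y - x)) (- \<epsilon>))"
    unfolding inv Complex_eq
    by (intro borel_integrable_atLeastAtMost' continuous_intros) (use \<epsilon> a in auto)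
  have d: "(H has_vector_derivative 1 / Complex (a * (y - x)) (- \<epsilon>)) (at y within S)" for y S
  proof -
    have p1: "((\<lambda>y. ln (a\<^sup>2 * (y - x)\<^sup>2 + \<epsilon>\<^sup>2) / (2 * a)) has_real_derivative a * (y - x) / (a\<^sup>2 * (y - x)\<^sup>2 + \<epsilon>\<^sup>2)) (at y within S)"
    proof -
      define T where "T = a\<^sup>2 * (y - x)\<^sup>2 + \<epsilon>\<^sup>2"
      have "((\<lambda>y. ln (a\<^sup>2 * (y - x)\<^sup>2 + \<epsilon>\<^sup>2) / (2 * a)) has_real_derivative (1 / T * (a\<^sup>2 * (2 * (y - x)))) / (2 * a)) (at y within S)"
        unfolding T_def by (rule DERIV_cdivide) (use pos[of y] in \<open>auto intro!: derivative_eq_intros\<close>)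
      also have "(1 / T * (a\<^sup>2 * (2 * (y - x)))) / (2 * a) = a * (y - x) / T"
        using a by (simp add: power2_eq_square) (simp add: right_diff_distrib diff_divide_distrib)
      finally show ?thesis by (simp add: T_def)
    qed
    have "1 + (a * (y - x) / \<epsilon>)\<^sup>2 = (a\<^sup>2 * (y - x)\<^sup>2 + \<epsilon>\<^sup>2) / \<epsilon>\<^sup>2"
      using \<epsilon> by (simp add: field_simps power2_eq_square)
    moreover have "inverse (T / \<epsilon>\<^sup>2) * (a / \<epsilon>) / a = \<epsilon> / T" if "T > 0" for T
      using \<epsilon> a that by (simp add: field_simps power2_eq_square)
    ultimately have "inverse (1 + (a * (y - x) / \<epsilon>)\<^sup>2) * (a / \<epsilon>) / a = \<epsilon> / (a\<^sup>2 * (y - x)\<^sup>2 + \<epsilon>\<^sup>2)"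
      using pos[of y] by simp
    moreover have "((\<lambda>y. arctan (a * (y - x) / \<epsilon>) / a) has_real_derivative inverse (1 + (a * (y - x) / \<epsilon>)\<^sup>2) * (a / \<epsilon>) / a) (at y within S)"
      using \<epsilon> a by (auto intro!: derivative_eq_intros)
    ultimately have p2: "((\<lambda>y. arctan (a * (y - x) / \<epsilon>) / a) has_real_derivative \<epsilon> / (a\<^sup>2 * (y - x)\<^sup>2 + \<epsilon>\<^sup>2)) (at y within S)"
      by simp
    show ?thesis unfolding has_vector_derivative_complex_iff inv H_def complex.sel using p1 p2 by (rule conjI)
  qed
  have "((\<lambda>y. 1 / Complex (a * (y - x)) (- \<epsilon>)) has_integral H q - H p) {p..q}"
    using d \<open>p \<le> q\<close> by (intro fundamental_theorem_of_calculus) auto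
  then show "(LINT y:{p..q}|lborel. 1 / Complex (a * (y - x)) (- \<epsilon>)) = H q - H p"
    using set_borel_integral_eq_integral(2)[OF i] integral_unique by metis
qed

context shear_eigenfunction
begin

definition den :: "real \<Rightarrow> real \<Rightarrow> complex" where "den \<epsilon> y = Complex (b y - c) (- \<epsilon>)"

lemma den_measurable [measurable]: "den \<epsilon> \<in> borel_measurable borel"
  unfolding den_def[abs_def] Complex_eq by measurable

lemma den_bounds:
  assumes "\<epsilon> \<noteq> 0"
  shows "den \<epsilon> y \<noteq> 0" "\<bar>b y - c\<bar> \<le> norm (den \<epsilon> y)" "\<bar>\<epsilon>\<bar> \<le> norm (den \<epsilon> y)" "m * \<bar>y - y\<^sub>c\<bar> \<le> norm (den \<epsilon> y)"
  using Complex_inverse_bounds[OF assms, of "b y - c"] speed_lower[of y] by (auto simp: den_def)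

lemma set_integrable_den:
  assumes f[measurable]: "f \<in> borel_measurable borel" and "\<And>p q. set_integrable lborel {p..q} f" and \<epsilon>: "\<epsilon> \<noteq> 0"
  shows "set_integrable lborel {p..q} (\<lambda>y. f y / den \<epsilon> y)"
  unfolding set_integrable_def
proof (rule Bochner_Integration.integrable_bound)
  show "integrable lborel (\<lambda>y. (1 / \<bar>\<epsilon>\<bar>) *\<^sub>R norm (indicator {p..q} y *\<^sub>R f y))"
    using assms(2) unfolding set_integrable_def by (intro integrable_scaleR_right integrable_norm)
  have "norm (f y) / norm (den \<epsilon> y) \<le> norm (f y) / \<bar>\<epsilon>\<bar>" for y
    using den_bounds[OF \<epsilon>, of y] \<epsilon> by (intro divide_left_mono mult_pos_pos) auto
  then show "AE y in lborel. norm (indicator {p..q} y *\<^sub>R (f y / den \<epsilon> y)) \<le> norm ((1 / \<bar>\<epsilon>\<bar>) *\<^sub>R norm (indicator {p..q} y *\<^sub>R f y))"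
    by (auto simp: norm_divide indicator_def)
qed measurable

text \<open>Replacing \<open>f\<close> by \<open>w\<close> and \<open>b - c\<close> by its linear
  part changes the integrand by a bounded amount, uniformly in \<epsilon>: the errors are of first
  and second order, and the denominators they are divided by are at least of the same order. Every
  singular integral is thus reduced to the explicit one.\<close>

lemma singular_integral_comparison:
  assumes C: "C \<ge> 0" "\<And>y. y \<noteq> y\<^sub>c \<Longrightarrow> \<bar>y - y\<^sub>c\<bar> \<le> 1 \<Longrightarrow> norm (f y - w) \<le> C * \<bar>y - y\<^sub>c\<bar>"
    and f[measurable]: "f \<in> borel_measurable borel" and fi: "\<And>p q. set_integrable lborel {p..q} f"
  obtains D where "D \<ge> 0" "\<And>\<epsilon> p q. \<epsilon> \<noteq> 0 \<Longrightarrow> y\<^sub>c - 1 \<le> p \<Longrightarrow> p \<le> q \<Longrightarrow> q \<le> y\<^sub>c + 1 \<Longrightarrow>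
      norm ((LINT y:{p..q}|lborel. f y / den \<epsilon> y) - w * (LINT y:{p..q}|lborel. 1 / Complex (b1 y\<^sub>c * (y - y\<^sub>c)) (- \<epsilon>))) \<le> D"
proof -
  obtain K where K: "K \<ge> 0" "\<And>y. \<bar>y - y\<^sub>c\<bar> \<le> 1 \<Longrightarrow> \<bar>b y - c - b1 y\<^sub>c * (y - y\<^sub>c)\<bar> \<le> K * (y - y\<^sub>c)\<^sup>2"
    using speed_taylor by blast
  define a where "a = b1 y\<^sub>c"
  have a: "a > 0" using b1(1)[of y\<^sub>c] m by (simp add: a_def)
  define D where "D = C / m + norm w * (K / (m * a))"
  have D: "D \<ge> 0" using C K m a by (simp add: D_def)
  have bound: "norm (f y / den \<epsilon> y - w * (1 / Complex (a * (y - y\<^sub>c)) (- \<epsilon>))) \<le> D"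
    if y: "y \<noteq> y\<^sub>c" "\<bar>y - y\<^sub>c\<bar> \<le> 1" and \<epsilon>: "\<epsilon> \<noteq> 0" for y \<epsilon>
  proof -
    define u where "u = \<bar>y - y\<^sub>c\<bar>"
    let ?L = "Complex (a * (y - y\<^sub>c)) (- \<epsilon>)" and ?N = "den \<epsilon> y"
    have u: "u > 0" using y by (simp add: u_def)
    have L: "?L \<noteq> 0" "a * u \<le> norm ?L" using Complex_inverse_bounds[OF \<epsilon>, of "a * (y - y\<^sub>c)"] a by (auto simp: u_def abs_mult)
    have N: "?N \<noteq> 0" "m * u \<le> norm ?N" using den_bounds[OF \<epsilon>, of y] by (auto simp: u_def)
    have "?L - ?N = of_real (a * (y - y\<^sub>c) - (b y - c))" by (simp add: den_def complex_eq_iff)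
    then have LN: "norm (?L - ?N) \<le> K * (u * u)"
    proof -
      have "norm (?L - ?N) = \<bar>b y - c - a * (y - y\<^sub>c)\<bar>"
        unfolding \<open>?L - ?N = of_real (a * (y - y\<^sub>c) - (b y - c))\<close> norm_of_real by (rule abs_minus_commute)
      also have "\<dots> \<le> K * (y - y\<^sub>c)\<^sup>2" using K(2)[OF y(2)] by (simp add: a_def)
      also have "(y - y\<^sub>c)\<^sup>2 = u * u" by (simp add: u_def power2_eq_square)
      finally show ?thesis .
    qed
    have "f y / ?N - w * (1 / ?L) = (f y - w) / ?N + w * ((?L - ?N) / (?N * ?L))"
      using L(1) N(1) by (simp add: field_simps)
    then have "norm (f y / ?N - w * (1 / ?L)) \<le> norm (f y - w) / norm ?N + norm w * (norm (?L - ?N) / (norm ?N * norm ?L))"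
      by (metis norm_triangle_ineq norm_divide norm_mult)
    also have "\<dots> \<le> C * u / (m * u) + norm w * (K * (u * u) / ((m * u) * (a * u)))"
    proof (intro add_mono mult_left_mono frac_le)
      show "norm (f y - w) \<le> C * u" using C(2)[OF y] by (simp add: u_def)
      show "(m * u) * (a * u) \<le> norm ?N * norm ?L" using N L m a u by (intro mult_mono) auto
    qed (use C K m a u N LN in auto)
    also have "\<dots> = D" using u by (simp add: D_def field_simps)
    finally show ?thesis .
  qed
  show thesis
  proof (rule that[of "D * 2"])
    fix \<epsilon> p q :: real assume \<epsilon>: "\<epsilon> \<noteq> 0" and pq: "y\<^sub>c - 1 \<le> p" "p \<le> q" "q \<le> y\<^sub>c + 1"
    have i: "set_integrable lborel {p..q} (\<lambda>y. w * (1 / Complex (a * (y - y\<^sub>c)) (- \<epsilon>)))"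
      using set_integral_Complex_inverse(1)[OF a \<epsilon> pq(2)] by (rule set_integrable_mult_right[OF _])
    have "norm ((LINT y:{p..q}|lborel. f y / den \<epsilon> y) - (LINT y:{p..q}|lborel. w * (1 / Complex (a * (y - y\<^sub>c)) (- \<epsilon>)))) \<le> D * (q - p)"
      by (rule set_integral_difference_bound[OF set_integrable_den[OF f fi \<epsilon>] i bound pq(2)]) (use pq \<epsilon> in auto)
    also have "\<dots> \<le> D * 2" using D pq by (intro mult_left_mono) auto
    also have "(LINT y:{p..q}|lborel. w * (1 / Complex (a * (y - y\<^sub>c)) (- \<epsilon>))) = w * (LINT y:{p..q}|lborel. 1 / Complex (a * (y - y\<^sub>c)) (- \<epsilon>))"
      by (rule set_integral_mult_right)
    finally show "norm ((LINT y:{p..q}|lborel. f y / den \<epsilon> y) - w * (LINT y:{p..q}|lborel. 1 / Complex (b1 y\<^sub>c * (y - y\<^sub>c)) (- \<epsilon>))) \<le> D * 2"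
      by (simp add: a_def)
  qed (use D in simp)
qed

lemma \<psi>_Ltwo: "\<psi> \<in> Ltwo"
  unfolding \<psi>_def by (rule green_Ltwo[OF \<kappa> \<omega>0])

text \<open>The interval is symmetric about \<open>y\<^sub>c\<close>, so of the explicit integral
  only the arctangent remains, which is bounded by \<open>pi / a\<close>.\<close>

lemma W_singular_bounded:
  obtains J where "J \<ge> 0" "\<And>\<epsilon>. \<epsilon> \<noteq> 0 \<Longrightarrow> norm (LINT y:{y\<^sub>c - 1..y\<^sub>c + 1}|lborel. W y / den \<epsilon> y) \<le> J"
proof -
  obtain w C where C: "C \<ge> 0" "\<And>y. y \<noteq> y\<^sub>c \<Longrightarrow> \<bar>y - y\<^sub>c\<bar> \<le> 1 \<Longrightarrow> norm (W y - w) \<le> C * \<bar>y - y\<^sub>c\<bar>"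
    by (rule W_near) (rule that)
  obtain D where D: "D \<ge> 0" "\<And>\<epsilon> p q. \<epsilon> \<noteq> 0 \<Longrightarrow> y\<^sub>c - 1 \<le> p \<Longrightarrow> p \<le> q \<Longrightarrow> q \<le> y\<^sub>c + 1 \<Longrightarrow>
      norm ((LINT y:{p..q}|lborel. W y / den \<epsilon> y) - w * (LINT y:{p..q}|lborel. 1 / Complex (b1 y\<^sub>c * (y - y\<^sub>c)) (- \<epsilon>))) \<le> D"
    by (rule singular_integral_comparison[OF C measurables(4) Ltwo_set_integrable[OF W_Ltwo]]; (assumption | rule that))
  define a where "a = b1 y\<^sub>c"
  have a: "a > 0" using b1(1)[of y\<^sub>c] m by (simp add: a_def)
  show thesis
  proof (rule that[of "D + norm w * (pi / a)"])
    fix \<epsilon> :: real assume \<epsilon>: "\<epsilon> \<noteq> 0"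
    define X where "X = (LINT y:{y\<^sub>c - 1..y\<^sub>c + 1}|lborel. 1 / Complex (a * (y - y\<^sub>c)) (- \<epsilon>))"
    have "X = Complex 0 (2 * arctan (a / \<epsilon>) / a)"
      unfolding X_def by (subst set_integral_Complex_inverse(2)[OF a \<epsilon>]) (auto simp: complex_eq_iff arctan_minus)
    then have "norm X = 2 * \<bar>arctan (a / \<epsilon>)\<bar> / a" using a by (simp add: cmod_def abs_mult)
    also have "\<dots> \<le> pi / a" using a arctan_bounded[of "a / \<epsilon>"] by (intro divide_right_mono) (auto simp: abs_le_iff)
    finally have X: "norm X \<le> pi / a" .
    have "norm (LINT y:{y\<^sub>c - 1..y\<^sub>c + 1}|lborel. W y / den \<epsilon> y) \<le> norm (w * X) + D"
    proof -
      let ?Z = "LINT y:{y\<^sub>c - 1..y\<^sub>c + 1}|lborel. W y / den \<epsilon> y"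
      have "norm (?Z - w * X) \<le> D" using D(2)[OF \<epsilon>, of "y\<^sub>c - 1" "y\<^sub>c + 1"] by (simp add: X_def a_def)
      then show ?thesis using norm_triangle_sub[of ?Z "w * X"] by linarith
    qed
    also have "\<dots> \<le> norm w * (pi / a) + D" unfolding norm_mult using X by (intro add_right_mono mult_left_mono) auto
    finally show "norm (LINT y:{y\<^sub>c - 1..y\<^sub>c + 1}|lborel. W y / den \<epsilon> y) \<le> D + norm w * (pi / a)" by simp
  qed (use D a in simp)
qed

text \<open>Here the interval lies on one side of \<open>y\<^sub>c\<close>, the logarithm does not
  cancel, and its coefficient \<open>\<psi> y\<^sub>c\<close> is not 0.\<close>

lemma \<psi>_singular_unbounded:
  obtains e where "e > 0" "\<And>\<epsilon>. \<bar>\<epsilon>\<bar> = e \<Longrightarrow> norm (LINT y:{y\<^sub>c..y\<^sub>c + 1}|lborel. \<psi> y / den \<epsilon> y) > K"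
proof -
  obtain L where L: "L \<ge> 0" "\<And>y. \<bar>y - y\<^sub>c\<bar> \<le> 1 \<Longrightarrow> norm (\<psi> y - \<psi> y\<^sub>c) \<le> L * \<bar>y - y\<^sub>c\<bar>" using \<psi>_lipschitz by blast
  obtain D where D: "D \<ge> 0" "\<And>\<epsilon> p q. \<epsilon> \<noteq> 0 \<Longrightarrow> y\<^sub>c - 1 \<le> p \<Longrightarrow> p \<le> q \<Longrightarrow> q \<le> y\<^sub>c + 1 \<Longrightarrow>
      norm ((LINT y:{p..q}|lborel. \<psi> y / den \<epsilon> y) - \<psi> y\<^sub>c * (LINT y:{p..q}|lborel. 1 / Complex (b1 y\<^sub>c * (y - y\<^sub>c)) (- \<epsilon>))) \<le> D"
    by (rule singular_integral_comparison[OF L measurables(3) Ltwo_set_integrable[OF \<psi>_Ltwo]]; (assumption | rule that))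
  define a where "a = b1 y\<^sub>c"
  have a: "a > 0" using b1(1)[of y\<^sub>c] m by (simp add: a_def)
  define P where "P = norm (\<psi> y\<^sub>c)"
  have P: "P > 0" using \<psi>_yc_nonzero by (simp add: P_def)
  define R where "R = (\<bar>K\<bar> + D + 1) / P"
  \<comment> \<open>With this size of \<epsilon> the two logarithms differ by at least
    \<open>2 * a * R\<close>, so the real part of the explicit integral reaches \<open>R\<close>.
    The sign of \<epsilon> is left open, to be matched with that of \<open>k\<close> later.\<close>
  define e where "e = a * exp (- (a * R))"
  have e: "e > 0" using a by (simp add: e_def)
  show thesis
  proof (rule that[OF e])
    fix \<epsilon> :: real assume \<epsilon>: "\<bar>\<epsilon>\<bar> = e"
    then have \<epsilon>0: "\<epsilon> \<noteq> 0" using e by auto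
    define X where "X = (LINT y:{y\<^sub>c..y\<^sub>c + 1}|lborel. 1 / Complex (a * (y - y\<^sub>c)) (- \<epsilon>))"
    have ReX: "Re X = (ln (a\<^sup>2 + \<epsilon>\<^sup>2) - ln (\<epsilon>\<^sup>2)) / (2 * a)"
      unfolding X_def by (subst set_integral_Complex_inverse(2)[OF a \<epsilon>0]) (auto simp: diff_divide_distrib)
    have "\<epsilon>\<^sup>2 = e\<^sup>2" using \<epsilon> by (metis power2_abs)
    then have "ln (\<epsilon>\<^sup>2) = 2 * ln e" using e by (simp add: ln_realpow)
    also have "ln e = ln a - a * R" using a by (simp add: e_def ln_mult)
    finally have l1: "ln (\<epsilon>\<^sup>2) = 2 * ln a - 2 * a * R" by simp
    have "2 * ln a = ln (a\<^sup>2)" using a by (simp add: ln_realpow)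
    also have "\<dots> \<le> ln (a\<^sup>2 + \<epsilon>\<^sup>2)" using a by (subst ln_le_cancel_iff) (auto intro: add_pos_nonneg)
    finally have "2 * a * R \<le> ln (a\<^sup>2 + \<epsilon>\<^sup>2) - ln (\<epsilon>\<^sup>2)" using l1 by simp
    then have "R \<le> Re X" unfolding ReX using a by (simp add: field_simps)
    then have "R \<le> norm X" using complex_Re_le_cmod[of X] by linarith
    then have "P * R \<le> norm (\<psi> y\<^sub>c * X)" unfolding norm_mult P_def by (intro mult_left_mono) auto
    moreover have "P * R = \<bar>K\<bar> + D + 1" using P by (simp add: R_def)
    moreover have "norm ((LINT y:{y\<^sub>c..y\<^sub>c + 1}|lborel. \<psi> y / den \<epsilon> y) - \<psi> y\<^sub>c * X) \<le> D"
      using D(2)[OF \<epsilon>0, of y\<^sub>c "y\<^sub>c + 1"] by (simp add: X_def a_def)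
    ultimately show "norm (LINT y:{y\<^sub>c..y\<^sub>c + 1}|lborel. \<psi> y / den \<epsilon> y) > K"
      using norm_triangle_sub[of "\<psi> y\<^sub>c * X" "LINT y:{y\<^sub>c..y\<^sub>c + 1}|lborel. \<psi> y / den \<epsilon> y"]
      by (simp add: norm_minus_commute)
  qed
qed

lemma \<beta>\<psi>_integrable: "integrable lborel (\<lambda>y. \<bar>\<beta> y\<bar> * norm (\<psi> y))"
  using Ltwo_product(1)[OF \<beta>_Ltwo \<psi>_Ltwo] by simp

text \<open>The memory term is bounded uniformly in the regularisation, because \<open>\<beta>\<close> vanishes at the
  critical point: only \<open>green \<kappa> \<omega> y\<^sub>c\<close> meets the singularity, and it meets it through a symmetric integral.\<close>

lemma memory_bounded:
  obtains C where "C \<ge> 0" "\<And>\<epsilon> (\<omega> :: real \<Rightarrow> complex) A. \<epsilon> \<noteq> 0 \<Longrightarrow> \<omega> \<in> Ltwo \<Longrightarrow> (\<And>y. (LINT z|lborel. expk \<kappa> (y - z) * norm (\<omega> z)) \<le> A) \<Longrightarrow>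
      norm (LINT y|lborel. green \<kappa> \<omega> y * W y / den \<epsilon> y) \<le> C * A"
proof -
  obtain J where J: "J \<ge> 0" "\<And>\<epsilon>. \<epsilon> \<noteq> 0 \<Longrightarrow> norm (LINT y:{y\<^sub>c - 1..y\<^sub>c + 1}|lborel. W y / den \<epsilon> y) \<le> J"
    using W_singular_bounded by blast
  let ?I = "{y\<^sub>c - 1..y\<^sub>c + 1}"
  \<comment> \<open>Majorant for what is left after splitting off the value of the potential at
    \<open>y\<^sub>c\<close>. Within distance 1 the Lipschitz bound of the potential compensates the
    small denominator; beyond it, the lower bound \<open>m\<close> is used for both
    \<open>b - c\<close> and \<open>den\<close>.\<close>
  define E where "E y = (exp \<kappa> / m) * norm (indicat_real ?I y *\<^sub>R W y) + (1 / (2 * \<kappa> * m\<^sup>2)) * (\<bar>\<beta> y\<bar> * norm (\<psi> y))" for y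
  have Ei: "integrable lborel E"
    unfolding E_def[abs_def] using Ltwo_set_integrable[OF W_Ltwo, of "y\<^sub>c - 1" "y\<^sub>c + 1"]
    by (intro Bochner_Integration.integrable_add integrable_mult_right integrable_norm \<beta>\<psi>_integrable)
      (simp add: set_integrable_def)
  have E0: "E y \<ge> 0" for y using m \<kappa> by (simp add: E_def)
  show thesis
  proof (rule that[of "integral\<^sup>L lborel E + J / (2 * \<kappa>)"])
    show "0 \<le> integral\<^sup>L lborel E + J / (2 * \<kappa>)" using E0 J \<kappa> by simp
    fix \<epsilon> A :: real and \<omega> :: "real \<Rightarrow> complex" assume \<epsilon>: "\<epsilon> \<noteq> 0" and \<omega>: "\<omega> \<in> Ltwo" and A: "\<And>y. (LINT z|lborel. expk \<kappa> (y - z) * norm (\<omega> z)) \<le> A"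
    define \<phi> where "\<phi> = green \<kappa> \<omega>"
    have \<phi>b: "norm (\<phi> y) \<le> A / (2 * \<kappa>)" for y unfolding \<phi>_def by (rule green_bound[OF \<kappa> \<omega> A])
    have \<phi>l: "norm (\<phi> y - \<phi> y\<^sub>c) \<le> exp \<kappa> * A * \<bar>y - y\<^sub>c\<bar>" if "\<bar>y - y\<^sub>c\<bar> \<le> 1" for y
      using green_lipschitz[OF \<kappa> \<omega> A, of y\<^sub>c y] that by (simp add: \<phi>_def abs_minus_commute)
    have "0 \<le> A / (2 * \<kappa>)" using order_trans[OF norm_ge_zero \<phi>b] by blast
    then have A0: "A \<ge> 0" using \<kappa> by (simp add: zero_le_divide_iff)
    define r where "r y = \<phi> y * W y / den \<epsilon> y - \<phi> y\<^sub>c * (indicat_real ?I y *\<^sub>R (W y / den \<epsilon> y))" for y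
    have [measurable]: "\<phi> \<in> borel_measurable borel"
      unfolding \<phi>_def using \<omega> by (intro Ltwo_measurable green_Ltwo \<kappa>)
    have [measurable]: "r \<in> borel_measurable borel" unfolding r_def[abs_def] by measurable
    have r: "norm (r y) \<le> A * E y" for y
    proof (cases "y \<in> ?I")
      case True
      then have "r y = (\<phi> y - \<phi> y\<^sub>c) * W y / den \<epsilon> y" by (simp add: r_def diff_divide_distrib left_diff_distrib)
      then have "norm (r y) = norm (\<phi> y - \<phi> y\<^sub>c) / norm (den \<epsilon> y) * norm (W y)" by (simp add: norm_mult norm_divide)
      also have "\<dots> \<le> (exp \<kappa> * A / m) * norm (W y)"
      proof (rule mult_right_mono)
        show "norm (\<phi> y - \<phi> y\<^sub>c) / norm (den \<epsilon> y) \<le> exp \<kappa> * A / m"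
        proof (cases "y = y\<^sub>c")
          case True
          then show ?thesis using A0 m by simp
        next
          case False
          have "norm (\<phi> y - \<phi> y\<^sub>c) / norm (den \<epsilon> y) \<le> (exp \<kappa> * A * \<bar>y - y\<^sub>c\<bar>) / (m * \<bar>y - y\<^sub>c\<bar>)"
            using \<phi>l[of y] den_bounds(4)[OF \<epsilon>, of y] True False m A0 by (intro frac_le) (auto simp: abs_le_iff)
          also have "\<dots> = exp \<kappa> * A / m" using False by simp
          finally show ?thesis .
        qed
      qed simp
      also have "\<dots> = A * ((exp \<kappa> / m) * norm (indicat_real ?I y *\<^sub>R W y))" using True by simp
      also have "\<dots> \<le> A * E y" using A0 m \<kappa> by (intro mult_left_mono) (auto simp: E_def)
      finally show ?thesis .
    next
      case False
      then have x: "\<bar>y - y\<^sub>c\<bar> \<ge> 1" by auto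
      then have B: "m \<le> \<bar>b y - c\<bar>" using speed_lower[of y] m mult_left_mono[OF x, of m] by linarith
      have N: "m \<le> norm (den \<epsilon> y)" using B den_bounds(2)[OF \<epsilon>, of y] by linarith
      have "norm (r y) = norm (\<phi> y) * ((\<bar>\<beta> y\<bar> * norm (\<psi> y)) / (\<bar>b y - c\<bar> * norm (den \<epsilon> y)))"
        using False by (simp add: r_def W_def norm_mult norm_divide)
      also have "\<dots> \<le> (A / (2 * \<kappa>)) * ((\<bar>\<beta> y\<bar> * norm (\<psi> y)) / (m * m))"
        using \<phi>b[of y] B N m \<kappa> A0 by (intro mult_mono frac_le) auto
      also have "\<dots> = A * ((1 / (2 * \<kappa> * m\<^sup>2)) * (\<bar>\<beta> y\<bar> * norm (\<psi> y)))" by (simp add: power2_eq_square)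
      also have "\<dots> \<le> A * E y" using A0 m \<kappa> by (intro mult_left_mono) (auto simp: E_def)
      finally show ?thesis .
    qed
    have ri: "integrable lborel r"
      by (rule Bochner_Integration.integrable_bound[OF integrable_mult_right[OF Ei, of A]])
        (use r A0 E0 in \<open>auto simp: abs_mult\<close>)
    have wi: "integrable lborel (\<lambda>y. indicat_real ?I y *\<^sub>R (W y / den \<epsilon> y))"
      using set_integrable_den[OF measurables(4) Ltwo_set_integrable[OF W_Ltwo] \<epsilon>] by (simp add: set_integrable_def)
    have "(LINT y|lborel. \<phi> y * W y / den \<epsilon> y) = (LINT y|lborel. r y + \<phi> y\<^sub>c * (indicat_real ?I y *\<^sub>R (W y / den \<epsilon> y)))"
      by (simp add: r_def)
    also have "\<dots> = integral\<^sup>L lborel r + \<phi> y\<^sub>c * (LINT y:?I|lborel. W y / den \<epsilon> y)"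
      unfolding set_lebesgue_integral_def using ri wi
      by (simp only: Bochner_Integration.integral_add integrable_mult_right integral_mult_right_zero)
    finally have "norm (LINT y|lborel. \<phi> y * W y / den \<epsilon> y)
        = norm (integral\<^sup>L lborel r + \<phi> y\<^sub>c * (LINT y:?I|lborel. W y / den \<epsilon> y))" by (simp only:)
    also have "\<dots> \<le> norm (integral\<^sup>L lborel r) + norm (\<phi> y\<^sub>c) * norm (LINT y:?I|lborel. W y / den \<epsilon> y)"
      unfolding norm_mult[symmetric] by (rule norm_triangle_ineq)
    also have "\<dots> \<le> A * integral\<^sup>L lborel E + (A / (2 * \<kappa>)) * J"
    proof (intro add_mono mult_mono \<phi>b J \<epsilon>)
      have "norm (integral\<^sup>L lborel r) \<le> (LINT y|lborel. norm (r y))" by (rule integral_norm_bound)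
      also have "\<dots> \<le> (LINT y|lborel. A * E y)" using ri Ei r by (intro integral_mono integrable_norm) auto
      finally show "norm (integral\<^sup>L lborel r) \<le> A * integral\<^sup>L lborel E" by simp
    qed (use A0 \<kappa> in auto)
    finally show "norm (LINT y|lborel. green \<kappa> \<omega> y * W y / den \<epsilon> y) \<le> (integral\<^sup>L lborel E + J / (2 * \<kappa>)) * A"
      by (simp add: \<phi>_def algebra_simps)
  qed
qed

section \<open>Integrability over the whole line\<close>

lemma W_integrable: "integrable lborel W"
proof -
  let ?I = "{y\<^sub>c - 1..y\<^sub>c + 1}"
  have i: "integrable lborel (\<lambda>y. norm (indicat_real ?I y *\<^sub>R W y) + (1 / m) * (\<bar>\<beta> y\<bar> * norm (\<psi> y)))"
    using Ltwo_set_integrable[OF W_Ltwo, of "y\<^sub>c - 1" "y\<^sub>c + 1"]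
    by (intro Bochner_Integration.integrable_add integrable_mult_right integrable_norm \<beta>\<psi>_integrable)
      (simp add: set_integrable_def)
  have "norm (W y) \<le> norm (indicat_real ?I y *\<^sub>R W y) + (1 / m) * (\<bar>\<beta> y\<bar> * norm (\<psi> y))" for y
  proof (cases "y \<in> ?I")
    case False
    then have x: "\<bar>y - y\<^sub>c\<bar> \<ge> 1" by auto
    then have B: "m \<le> \<bar>b y - c\<bar>" using speed_lower[of y] m mult_left_mono[OF x, of m] by linarith
    have "norm (W y) = (\<bar>\<beta> y\<bar> * norm (\<psi> y)) / \<bar>b y - c\<bar>" by (simp add: W_def)
    also have "\<dots> \<le> (\<bar>\<beta> y\<bar> * norm (\<psi> y)) / m" using B m by (intro divide_left_mono mult_pos_pos) auto
    finally show ?thesis using False by simp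
  qed (use m in simp)
  then show ?thesis
    by (intro Bochner_Integration.integrable_bound[OF i]) (auto intro!: order_trans[OF _ abs_ge_self])
qed

text \<open>By Fubini an integrable function has an integrable potential. This allows the pairing
  with the regularised multiplier to be bounded through a supremum of the solution alone.\<close>

lemma \<psi>_integrable: "integrable lborel \<psi>"
proof -
  have "integrable lborel (\<lambda>y. LINT z|lborel. expk \<kappa> (y - z) * norm (W z))"
    using lborel_pair.integrable_fst'[OF integrable_expk_pair(2)[OF \<kappa> _ integrable_norm[OF W_integrable]]] by simp
  from integrable_mult_right[OF this, of "1 / (2 * \<kappa>)"] show ?thesis
  proof (rule Bochner_Integration.integrable_bound)
    show "AE y in lborel. norm (\<psi> y) \<le> norm (1 / (2 * \<kappa>) * (LINT z|lborel. expk \<kappa> (y - z) * norm (W z)))"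
      using green_bound[OF \<kappa> W_Ltwo order_refl] \<kappa> by (auto simp: green_W abs_mult)
  qed measurable
qed

end

section \<open>Weak solutions of the Rayleigh equation\<close>

lemma norm_iexp_diff: "norm (iexp u - iexp v) \<le> \<bar>u - v\<bar>"
proof -
  have "iexp u - iexp v = iexp v * (iexp (u - v) - 1)"
    by (simp add: algebra_simps flip: exp_add)
  then have "norm (iexp u - iexp v) = norm (iexp (u - v) - 1)" by (simp add: norm_mult)
  also have "\<dots> \<le> \<bar>u - v\<bar>" using iexp_approx1[of "u - v" 0] by simp
  finally show ?thesis .
qed

lemma Ltwo_bounded_mult:
  fixes f g :: "real \<Rightarrow> complex"
  assumes [measurable]: "f \<in> borel_measurable borel" and g[measurable]: "g \<in> Ltwo" and "\<And>y. norm (f y) \<le> C"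
  shows "(\<lambda>y. f y * g y) \<in> Ltwo"
proof (rule Ltwo_bound[OF _ Ltwo_scaleR[OF g, of C]])
  have [measurable]: "g \<in> borel_measurable borel" using g by (rule Ltwo_measurable)
  show "(\<lambda>y. f y * g y) \<in> borel_measurable borel" by measurable
  show "AE y in lborel. norm (f y * g y) \<le> norm (C *\<^sub>R g y)"
    using assms(3) by (auto simp: norm_mult intro!: mult_right_mono order_trans[OF assms(3) abs_ge_self])
qed

lemma of_real_Ltwo: "f \<in> Ltwo \<Longrightarrow> (\<lambda>y. of_real (f y) :: complex) \<in> Ltwo"
proof -
  assume f: "f \<in> Ltwo"
  then have [measurable]: "f \<in> borel_measurable borel" by (rule Ltwo_measurable)
  show ?thesis by (rule Ltwo_bound[OF _ f]) auto
qed

lemma Ltwo_curve_continuous: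
  fixes \<omega> :: "real \<Rightarrow> real \<Rightarrow> 'a :: {banach, second_countable_topology}"
  assumes L: "\<And>t. t \<ge> 0 \<Longrightarrow> \<omega> t \<in> Ltwo"
    and c: "\<And>t. t \<ge> 0 \<Longrightarrow> ((\<lambda>s. Ltwo_norm (\<lambda>y. \<omega> s y - \<omega> t y)) \<longlongrightarrow> 0) (at t within {0..})"
  shows "continuous_on {0..} (\<lambda>t. Ltwo_norm (\<omega> t))"
  unfolding continuous_on
proof
  fix t :: real assume t: "t \<in> {0..}"
  have "\<forall>\<^sub>F s in at t within {0..}. norm (Ltwo_norm (\<omega> s) - Ltwo_norm (\<omega> t)) \<le> Ltwo_norm (\<lambda>y. \<omega> s y - \<omega> t y)"
    using t by (auto simp: eventually_at_filter intro!: always_eventually Ltwo_norm_triangle_diff L)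
  then have "((\<lambda>s. Ltwo_norm (\<omega> s) - Ltwo_norm (\<omega> t)) \<longlongrightarrow> 0) (at t within {0..})"
    by (rule Lim_null_comparison) (use c t in auto)
  then show "((\<lambda>t. Ltwo_norm (\<omega> t)) \<longlongrightarrow> Ltwo_norm (\<omega> t)) (at t within {0..})" by (rule LIM_zero_cancel)
qed

lemma Ltwo_curve_bounded:
  fixes \<omega> :: "real \<Rightarrow> real \<Rightarrow> 'a :: {banach, second_countable_topology}"
  assumes "continuous_on {0..} (\<lambda>t. Ltwo_norm (\<omega> t))"
  obtains N where "N > 0" "\<And>t. 0 \<le> t \<Longrightarrow> t \<le> T \<Longrightarrow> Ltwo_norm (\<omega> t) \<le> N"
proof -
  have "compact ((\<lambda>t. Ltwo_norm (\<omega> t)) ` {0..T})"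
    by (intro compact_continuous_image continuous_on_subset[OF assms]) auto
  then obtain N where N: "N > 0" "\<forall>x\<in>(\<lambda>t. Ltwo_norm (\<omega> t)) ` {0..T}. norm x \<le> N"
    using compact_imp_bounded bounded_pos by metis
  then have "Ltwo_norm (\<omega> t) \<le> N" if "0 \<le> t" "t \<le> T" for t using that by force
  then show thesis using N(1) that by blast
qed

lemma Ltwo_curve_dominated:
  fixes \<Omega> :: "real \<Rightarrow> real \<Rightarrow> 'a :: {banach, second_countable_topology}"
  assumes L: "\<And>t. t \<ge> 0 \<Longrightarrow> \<Omega> t \<in> Ltwo" and D: "D \<in> Ltwo"
    and bound: "\<And>t z. t \<ge> 0 \<Longrightarrow> norm (\<Omega> t z) \<le> norm (D z :: real)"
    and cont: "\<And>z. continuous_on {0..} (\<lambda>t. \<Omega> t z)" and t: "t \<ge> 0"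
  shows "((\<lambda>s. Ltwo_norm (\<lambda>z. \<Omega> s z - \<Omega> t z)) \<longlongrightarrow> 0) (at t within {0..})"
  unfolding tendsto_at_iff_sequentially o_def
proof (intro allI impI)
  fix X :: "nat \<Rightarrow> real" assume X: "\<forall>n. X n \<in> {0..} - {t}" "X \<longlonglongrightarrow> t"
  then have X0: "X n \<ge> 0" for n by auto
  have [measurable]: "\<Omega> (X n) \<in> borel_measurable borel" "\<Omega> t \<in> borel_measurable borel" for n
    using Ltwo_measurable[OF L[OF X0]] Ltwo_measurable[OF L[OF t]] by auto
  have "(\<lambda>n. LINT z|lborel. (norm (\<Omega> (X n) z - \<Omega> t z))\<^sup>2) \<longlonglongrightarrow> (LINT z::real|lborel. 0)"
  proof (rule integral_dominated_convergence)
    show "integrable lborel (\<lambda>z. 4 * (norm (D z))\<^sup>2)" by (intro integrable_mult_right Ltwo_integrable D)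
    show "AE z in lborel. (\<lambda>n. (norm (\<Omega> (X n) z - \<Omega> t z))\<^sup>2) \<longlonglongrightarrow> 0"
    proof (rule AE_I2)
      fix z
      have "(\<lambda>n. \<Omega> (X n) z) \<longlonglongrightarrow> \<Omega> t z" by (rule continuous_on_tendsto_compose[OF cont X(2)]) (use X0 t in auto)
      then have "(\<lambda>n. (norm (\<Omega> (X n) z - \<Omega> t z))\<^sup>2) \<longlonglongrightarrow> (norm (\<Omega> t z - \<Omega> t z))\<^sup>2" by (intro tendsto_intros)
      then show "(\<lambda>n. (norm (\<Omega> (X n) z - \<Omega> t z))\<^sup>2) \<longlonglongrightarrow> 0" by simp
    qed
    show "AE z in lborel. norm ((norm (\<Omega> (X n) z - \<Omega> t z))\<^sup>2) \<le> 4 * (norm (D z))\<^sup>2" for n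
    proof (rule AE_I2)
      fix z
      have "norm (\<Omega> (X n) z - \<Omega> t z) \<le> 2 * norm (D z)"
        using norm_triangle_ineq4[of "\<Omega> (X n) z" "\<Omega> t z"] bound[OF X0, of n z] bound[OF t, of z] by linarith
      then have "(norm (\<Omega> (X n) z - \<Omega> t z))\<^sup>2 \<le> (2 * norm (D z))\<^sup>2" by (intro power_mono) auto
      then show "norm ((norm (\<Omega> (X n) z - \<Omega> t z))\<^sup>2) \<le> 4 * (norm (D z))\<^sup>2" by (simp add: power_mult_distrib)
    qed
  qed measurable
  then have "(\<lambda>n. sqrt (LINT z|lborel. (norm (\<Omega> (X n) z - \<Omega> t z))\<^sup>2)) \<longlonglongrightarrow> sqrt (LINT z::real|lborel. 0)"
    by (rule tendsto_real_sqrt)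
  then show "(\<lambda>n. Ltwo_norm (\<lambda>z. \<Omega> (X n) z - \<Omega> t z)) \<longlonglongrightarrow> 0" by (simp add: Ltwo_norm_def)
qed

text \<open>\<open>rayleigh_solution\<close> tests with real functions only, so complex ones are
  assembled from two of them. No conjugation is involved in any pairing; they are all
  bilinear.\<close>

definition ctest :: "(real \<Rightarrow> real) \<Rightarrow> (real \<Rightarrow> real) \<Rightarrow> real \<Rightarrow> complex" where
  "ctest \<phi>1 \<phi>2 y = of_real (\<phi>1 y) + \<i> * of_real (\<phi>2 y)"

lemma ctest_Ltwo:
  assumes "test_function \<phi>1" "test_function \<phi>2" shows "ctest \<phi>1 \<phi>2 \<in> Ltwo"
  unfolding ctest_def[abs_def]
  by (intro Ltwo_add Ltwo_bounded_mult[where C = 1] of_real_Ltwo test_function_Ltwo assms) auto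

locale rayleigh_data =
  fixes k :: int and b \<beta> :: "real \<Rightarrow> real" and \<kappa> :: real
  assumes k: "k \<noteq> 0" and \<kappa>_def: "\<kappa> = of_int \<bar>k\<bar>" and b_cont: "\<And>y. isCont b y"
    and \<beta>: "deriv (deriv b) = \<beta>" and \<beta>_Ltwo: "\<beta> \<in> Ltwo"
begin

lemma \<kappa>: "\<kappa> > 0" using k by (simp add: \<kappa>_def)

lemma abs_k: "\<bar>of_int k :: real\<bar> = \<kappa>" by (simp add: \<kappa>_def)

lemma measurables [measurable]: "b \<in> borel_measurable borel" "\<beta> \<in> borel_measurable borel"
  using b_cont Ltwo_measurable[OF \<beta>_Ltwo] by (auto intro!: borel_measurable_continuous_onI continuous_at_imp_continuous_on)

definition "C\<^sub>\<beta> = Ltwo_norm (expk \<kappa>) / (2 * \<kappa>) * Ltwo_norm \<beta>"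

text \<open>The nonlocal part of the Rayleigh operator. It is bounded on square integrable
  functions, with constant \<open>C\<^sub>\<beta>\<close>: the potential is bounded pointwise by the
  norm of \<omega>, and \<beta> supplies the square integrability.\<close>

definition memory :: "(real \<Rightarrow> complex) \<Rightarrow> real \<Rightarrow> complex" where
  "memory \<omega> y = \<beta> y *\<^sub>R green \<kappa> \<omega> y"

lemma green_le:
  assumes "\<omega> \<in> Ltwo" shows "norm (green \<kappa> \<omega> y) \<le> Ltwo_norm (expk \<kappa>) / (2 * \<kappa>) * Ltwo_norm \<omega>"
  using green_bound[OF \<kappa> assms expk_integral_le_Ltwo[OF \<kappa> assms], of y] by (simp add: field_simps)

lemma memory_Ltwo:
  assumes "\<omega> \<in> Ltwo" shows "memory \<omega> \<in> Ltwo" "Ltwo_norm (memory \<omega>) \<le> C\<^sub>\<beta> * Ltwo_norm \<omega>"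
proof -
  let ?c = "Ltwo_norm (expk \<kappa>) / (2 * \<kappa>) * Ltwo_norm \<omega>"
  have [measurable]: "\<omega> \<in> borel_measurable borel" using assms by (rule Ltwo_measurable)
  have m: "memory \<omega> \<in> borel_measurable borel" unfolding memory_def[abs_def] by measurable
  have c0: "0 \<le> ?c" using \<kappa> by simp
  have "norm (memory \<omega> y) \<le> norm (?c *\<^sub>R \<beta> y)" for y
    using mult_right_mono[OF green_le[OF assms, of y], of "\<bar>\<beta> y\<bar>"] c0 \<kappa>
    by (simp add: memory_def abs_mult mult.commute)
  then have le: "AE y in lborel. norm (memory \<omega> y) \<le> norm (?c *\<^sub>R \<beta> y)" by simp
  show "memory \<omega> \<in> Ltwo" by (rule Ltwo_bound[OF m Ltwo_scaleR[OF \<beta>_Ltwo] le])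
  have "Ltwo_norm (memory \<omega>) \<le> Ltwo_norm (\<lambda>y. ?c *\<^sub>R \<beta> y)"
    by (rule Ltwo_norm_mono[OF m Ltwo_scaleR[OF \<beta>_Ltwo] le])
  also have "\<dots> = C\<^sub>\<beta> * Ltwo_norm \<omega>" unfolding Ltwo_norm_scaleR abs_of_nonneg[OF c0] by (simp add: C\<^sub>\<beta>_def)
  finally show "Ltwo_norm (memory \<omega>) \<le> C\<^sub>\<beta> * Ltwo_norm \<omega>" .
qed

lemma C\<^sub>\<beta>_nonneg: "C\<^sub>\<beta> \<ge> 0" using \<kappa> by (simp add: C\<^sub>\<beta>_def)

lemma rayleigh_AE:
  assumes "\<omega> \<in> Ltwo"
  shows "AE y in lborel. rayleigh b k \<omega> y = of_real (b y) * \<omega> y - memory \<omega> y"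
  using helmholtz_inv_green(2)[OF k assms, folded \<kappa>_def]
  by eventually_elim (simp add: rayleigh_def memory_def \<beta> scaleR_conv_of_real)

section \<open>The weak form of the equation\<close>

definition weighted :: "(real \<Rightarrow> complex) \<Rightarrow> bool" where
  "weighted \<eta> \<longleftrightarrow> \<eta> \<in> Ltwo \<and> (\<lambda>y. of_real (b y) * \<eta> y) \<in> Ltwo"

definition pair :: "(real \<Rightarrow> complex) \<Rightarrow> (real \<Rightarrow> complex) \<Rightarrow> complex" where
  "pair u v = (LINT y|lborel. u y * v y)"

text \<open>The weak form of the Rayleigh operator times \<open>- \<i> * k\<close>. Multiplication
  by \<open>b\<close> is transferred to \<eta>, so the expression makes sense for all square
  integrable \<omega>; this is the purpose of \<open>weighted\<close>.\<close>

definition generator :: "(real \<Rightarrow> complex) \<Rightarrow> (real \<Rightarrow> complex) \<Rightarrow> complex" where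
  "generator \<omega> \<eta> = - (\<i> * of_int k * (pair \<omega> (\<lambda>y. of_real (b y) * \<eta> y) - pair (memory \<omega>) \<eta>))"

lemma pair_le: "u \<in> Ltwo \<Longrightarrow> v \<in> Ltwo \<Longrightarrow> norm (pair u v) \<le> Ltwo_norm u * Ltwo_norm v"
  unfolding pair_def by (rule Ltwo_mult(2))

lemma pair_diff:
  assumes "u \<in> Ltwo" "v \<in> Ltwo" "w \<in> Ltwo"
  shows "pair u (\<lambda>y. v y - w y) = pair u v - pair u w" "pair (\<lambda>y. v y - w y) u = pair v u - pair w u"
  using Ltwo_mult(1)[OF assms(1,2)] Ltwo_mult(1)[OF assms(1,3)] Ltwo_mult(1)[OF assms(2,1)] Ltwo_mult(1)[OF assms(3,1)]
  by (simp_all add: pair_def right_diff_distrib left_diff_distrib)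

lemma memory_diff:
  assumes "u \<in> Ltwo" "v \<in> Ltwo" shows "memory (\<lambda>y. u y - v y) = (\<lambda>y. memory u y - memory v y)"
proof -
  have "conv (expk \<kappa>) (\<lambda>y. u y - v y) y = conv (expk \<kappa>) u y - conv (expk \<kappa>) v y" for y
    using conv_integrable[OF exp_kernel_expk[OF \<kappa>] assms(1), of y] conv_integrable[OF exp_kernel_expk[OF \<kappa>] assms(2), of y]
    unfolding conv_def scaleR_right_diff_distrib by (rule Bochner_Integration.integral_diff)
  then show ?thesis by (auto simp: memory_def green_def scaleR_right_diff_distrib)
qed

lemma generator_diff:
  assumes "u \<in> Ltwo" "v \<in> Ltwo" "weighted \<eta>"
  shows "generator (\<lambda>y. u y - v y) \<eta> = generator u \<eta> - generator v \<eta>"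
  using assms memory_Ltwo(1)[OF assms(1)] memory_Ltwo(1)[OF assms(2)]
  unfolding generator_def weighted_def memory_diff[OF assms(1,2)]
  by (simp add: pair_diff(2) algebra_simps)

lemma generator_le:
  assumes "\<omega> \<in> Ltwo" "weighted \<eta>"
  shows "norm (generator \<omega> \<eta>) \<le> \<kappa> * (Ltwo_norm \<omega> * Ltwo_norm (\<lambda>y. of_real (b y) * \<eta> y) + C\<^sub>\<beta> * Ltwo_norm \<omega> * Ltwo_norm \<eta>)"
proof -
  have w: "\<eta> \<in> Ltwo" "(\<lambda>y. of_real (b y) * \<eta> y) \<in> Ltwo" using assms(2) by (auto simp: weighted_def)
  have "norm (generator \<omega> \<eta>) = \<kappa> * norm (pair \<omega> (\<lambda>y. of_real (b y) * \<eta> y) - pair (memory \<omega>) \<eta>)"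
    by (simp add: generator_def norm_mult abs_k)
  also have "\<dots> \<le> \<kappa> * (Ltwo_norm \<omega> * Ltwo_norm (\<lambda>y. of_real (b y) * \<eta> y) + C\<^sub>\<beta> * Ltwo_norm \<omega> * Ltwo_norm \<eta>)"
  proof (intro mult_left_mono order_trans[OF norm_triangle_ineq4] add_mono pair_le assms w)
    have "norm (pair (memory \<omega>) \<eta>) \<le> Ltwo_norm (memory \<omega>) * Ltwo_norm \<eta>"
      by (intro pair_le memory_Ltwo assms w)
    also have "\<dots> \<le> (C\<^sub>\<beta> * Ltwo_norm \<omega>) * Ltwo_norm \<eta>"
      by (intro mult_right_mono memory_Ltwo assms) auto
    finally show "norm (pair (memory \<omega>) \<eta>) \<le> C\<^sub>\<beta> * Ltwo_norm \<omega> * Ltwo_norm \<eta>" .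
  qed (use \<kappa> in auto)
  finally show ?thesis .
qed

lemma weighted_diff: "weighted f \<Longrightarrow> weighted g \<Longrightarrow> weighted (\<lambda>y. f y - g y)"
  unfolding weighted_def by (auto intro!: Ltwo_diff simp: right_diff_distrib)

lemma generator_diff_right:
  assumes "\<omega> \<in> Ltwo" "weighted f" "weighted g"
  shows "generator \<omega> (\<lambda>y. f y - g y) = generator \<omega> f - generator \<omega> g"
  using assms memory_Ltwo(1)[OF assms(1)] unfolding generator_def weighted_def
  by (simp add: right_diff_distrib[of "of_real _"] pair_diff(1)) (simp add: algebra_simps)

lemma weighted_bounded_support:
  assumes [measurable]: "f \<in> Ltwo" and r: "\<And>y. \<bar>y\<bar> > r \<Longrightarrow> f y = 0"
  shows "weighted f"
  unfolding weighted_def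
proof
  have [measurable]: "f \<in> borel_measurable borel" using assms(1) by (rule Ltwo_measurable)
  have "compact (b ` {-\<bar>r\<bar>..\<bar>r\<bar>})"
    by (intro compact_continuous_image continuous_at_imp_continuous_on) (use b_cont in auto)
  then obtain K where K: "\<forall>y\<in>{-\<bar>r\<bar>..\<bar>r\<bar>}. norm (b y) \<le> K"
    by (auto dest!: compact_imp_bounded simp: bounded_iff)
  have "norm (of_real (b y) * f y) \<le> norm (K *\<^sub>R f y)" for y
  proof (cases "y \<in> {-\<bar>r\<bar>..\<bar>r\<bar>}")
    case True
    then show ?thesis using K by (auto simp: norm_mult intro!: mult_right_mono order_trans[OF _ abs_ge_self])
  next
    case False
    then show ?thesis using r[of y] by auto
  qed
  then show "(\<lambda>y. of_real (b y) * f y) \<in> Ltwo" by (intro Ltwo_bound[OF _ Ltwo_scaleR[OF assms(1), of K]]) auto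
qed fact

lemma weighted_ctest:
  assumes "test_function \<phi>1" "test_function \<phi>2" shows "weighted (ctest \<phi>1 \<phi>2)"
proof -
  obtain r1 r2 where "\<And>y. \<bar>y\<bar> > r1 \<Longrightarrow> \<phi>1 y = 0" "\<And>y. \<bar>y\<bar> > r2 \<Longrightarrow> \<phi>2 y = 0"
    using assms by (auto simp: test_function_def)
  then show ?thesis
    by (intro weighted_bounded_support[where r = "max r1 r2"] ctest_Ltwo assms) (auto simp: ctest_def)
qed

text \<open>Density in the graph norm of multiplication by \<open>b\<close>: the real and imaginary
  parts are approximated separately with the weight \<open>1 + (b y)\<^sup>2\<close>, each up to
  \<open>e\<^sup>2 / 2\<close>.\<close>

lemma ctest_dense:
  assumes "weighted \<eta>" "e > 0"
  shows "\<exists>\<phi>1 \<phi>2. test_function \<phi>1 \<and> test_function \<phi>2 \<and> Ltwo_norm (\<lambda>y. ctest \<phi>1 \<phi>2 y - \<eta> y) \<le> e \<and>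
    Ltwo_norm (\<lambda>y. of_real (b y) * (ctest \<phi>1 \<phi>2 y - \<eta> y)) \<le> e"
proof -
  define w where "w y = 1 + (b y)\<^sup>2" for y
  have \<eta>: "\<eta> \<in> Ltwo" "(\<lambda>y. of_real (b y) * \<eta> y) \<in> Ltwo" using assms by (auto simp: weighted_def)
  have [measurable]: "\<eta> \<in> borel_measurable borel" using \<eta>(1) by (rule Ltwo_measurable)
  have w: "continuous_on UNIV w" "\<And>y. w y \<ge> 0" unfolding w_def
    using b_cont by (auto intro!: continuous_intros continuous_at_imp_continuous_on)
  have [measurable]: "w \<in> borel_measurable borel" unfolding w_def[abs_def] by measurable
  have wi: "integrable lborel (\<lambda>y. (norm (\<eta> y))\<^sup>2 + (norm (of_real (b y) * \<eta> y))\<^sup>2)"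
    by (intro Bochner_Integration.integrable_add Ltwo_integrable \<eta>)
  have wn: "w y * (norm z)\<^sup>2 = (norm z)\<^sup>2 + (norm (of_real (b y) * z))\<^sup>2" for y and z :: complex
    by (simp add: w_def norm_mult power_mult_distrib distrib_right)
  have "integrable lborel (\<lambda>y. w y * (Re (\<eta> y))\<^sup>2)" "integrable lborel (\<lambda>y. w y * (Im (\<eta> y))\<^sup>2)"
    by (rule Bochner_Integration.integrable_bound[OF wi[folded wn]];
      (use w(2) in \<open>auto simp: abs_mult cmod_power2 intro!: mult_left_mono AE_I2\<close>))+
  then obtain \<phi>1 \<phi>2 where t: "test_function \<phi>1" "test_function \<phi>2"
      and n: "wnear w (e\<^sup>2 / 2) \<phi>1 (\<lambda>y. Re (\<eta> y))" "wnear w (e\<^sup>2 / 2) \<phi>2 (\<lambda>y. Im (\<eta> y))"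
    using wnear_test_dense[OF w, of "\<lambda>y. Re (\<eta> y)" "e\<^sup>2 / 2"] wnear_test_dense[OF w, of "\<lambda>y. Im (\<eta> y)" "e\<^sup>2 / 2"] assms(2) by auto
  define d where "d y = ctest \<phi>1 \<phi>2 y - \<eta> y" for y
  have d2: "w y * (norm (d y))\<^sup>2 = w y * (\<phi>1 y - Re (\<eta> y))\<^sup>2 + w y * (\<phi>2 y - Im (\<eta> y))\<^sup>2" for y
    by (simp add: d_def ctest_def cmod_power2 distrib_left)
  have "(LINT y|lborel. w y * (norm (d y))\<^sup>2) < e\<^sup>2" and di: "integrable lborel (\<lambda>y. w y * (norm (d y))\<^sup>2)"
    unfolding d2 using n by (auto simp: wnear_def)
  then have le: "(LINT y|lborel. w y * (norm (d y))\<^sup>2) \<le> e\<^sup>2" by simp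
  have dw: "weighted d" unfolding d_def using weighted_diff[OF weighted_ctest[OF t] assms(1)] .
  then have dL: "d \<in> Ltwo" "(\<lambda>y. of_real (b y) * d y) \<in> Ltwo" by (auto simp: weighted_def)
  have "(Ltwo_norm d)\<^sup>2 \<le> (LINT y|lborel. w y * (norm (d y))\<^sup>2)" unfolding Ltwo_norm_sq
    by (rule integral_mono[OF Ltwo_integrable[OF dL(1)] di]) (simp add: wn)
  from order_trans[OF this le] have n1: "Ltwo_norm d \<le> e" by (rule power2_le_imp_le) (use assms(2) in simp)
  have "(Ltwo_norm (\<lambda>y. of_real (b y) * d y))\<^sup>2 \<le> (LINT y|lborel. w y * (norm (d y))\<^sup>2)" unfolding Ltwo_norm_sq
    by (rule integral_mono[OF Ltwo_integrable[OF dL(2)] di]) (simp add: wn)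
  from order_trans[OF this le] have n2: "Ltwo_norm (\<lambda>y. of_real (b y) * d y) \<le> e"
    by (rule power2_le_imp_le) (use assms(2) in simp)
  show ?thesis using t n1 n2 unfolding d_def by blast
qed

definition weak_curve :: "(real \<Rightarrow> real \<Rightarrow> complex) \<Rightarrow> bool" where
  "weak_curve \<omega> \<longleftrightarrow> (\<forall>t\<ge>0. \<omega> t \<in> Ltwo) \<and>
     (\<forall>t\<ge>0. ((\<lambda>s. Ltwo_norm (\<lambda>y. \<omega> s y - \<omega> t y)) \<longlongrightarrow> 0) (at t within {0..})) \<and>
     (\<forall>\<eta> t. weighted \<eta> \<longrightarrow> t \<ge> 0 \<longrightarrow> ((\<lambda>s. pair (\<omega> s) \<eta>) has_vector_derivative generator (\<omega> t) \<eta>) (at t within {0..}))"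

lemma pair_ctest:
  assumes L: "\<omega> \<in> Ltwo" and t: "test_function \<phi>1" "test_function \<phi>2"
  shows "pair \<omega> (ctest \<phi>1 \<phi>2) = (LINT y|lborel. \<phi>1 y *\<^sub>R \<omega> y) + \<i> * (LINT y|lborel. \<phi>2 y *\<^sub>R \<omega> y)"
    and "generator \<omega> (ctest \<phi>1 \<phi>2) = - (\<i> * of_int k * (LINT y|lborel. \<phi>1 y *\<^sub>R rayleigh b k \<omega> y)) +
      \<i> * - (\<i> * of_int k * (LINT y|lborel. \<phi>2 y *\<^sub>R rayleigh b k \<omega> y))"
proof -
  note i1 = Ltwo_bilinear[OF bounded_bilinear_scaleR test_function_Ltwo L]
  have p: "pair u (ctest \<phi>1 \<phi>2) = (LINT y|lborel. \<phi>1 y *\<^sub>R u y) + \<i> * (LINT y|lborel. \<phi>2 y *\<^sub>R u y)"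
    if "integrable lborel (\<lambda>y. \<phi>1 y *\<^sub>R u y)" "integrable lborel (\<lambda>y. \<phi>2 y *\<^sub>R u y)" for u :: "real \<Rightarrow> complex"
  proof -
    have "pair u (ctest \<phi>1 \<phi>2) = (LINT y|lborel. \<phi>1 y *\<^sub>R u y + \<i> * (\<phi>2 y *\<^sub>R u y))"
      unfolding pair_def by (intro Bochner_Integration.integral_cong) (auto simp: ctest_def scaleR_conv_of_real algebra_simps)
    also have "\<dots> = (LINT y|lborel. \<phi>1 y *\<^sub>R u y) + \<i> * (LINT y|lborel. \<phi>2 y *\<^sub>R u y)"
      using that by (simp only: Bochner_Integration.integral_add integrable_mult_right integral_mult_right_zero)
    finally show ?thesis .
  qed
  show "pair \<omega> (ctest \<phi>1 \<phi>2) = (LINT y|lborel. \<phi>1 y *\<^sub>R \<omega> y) + \<i> * (LINT y|lborel. \<phi>2 y *\<^sub>R \<omega> y)"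
    by (intro p i1 t)
  have r: "(LINT y|lborel. \<phi> y *\<^sub>R rayleigh b k \<omega> y) = (LINT y|lborel. \<phi> y *\<^sub>R (of_real (b y) * \<omega> y)) - (LINT y|lborel. \<phi> y *\<^sub>R memory \<omega> y)"
      and ib: "integrable lborel (\<lambda>y. \<phi> y *\<^sub>R (of_real (b y) * \<omega> y))" and im: "integrable lborel (\<lambda>y. \<phi> y *\<^sub>R memory \<omega> y)"
    if \<phi>: "test_function \<phi>" for \<phi>
  proof -
    have [measurable]: "\<phi> \<in> borel_measurable borel" "\<omega> \<in> borel_measurable borel" "memory \<omega> \<in> borel_measurable borel"
        "helmholtz_inv k \<omega> \<in> borel_measurable borel"
      using \<phi> L memory_Ltwo[OF L] helmholtz_inv_green(1)[OF k L] Ltwo_measurable test_function_smooth smooth_measurable by blast+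
    show im: "integrable lborel (\<lambda>y. \<phi> y *\<^sub>R memory \<omega> y)"
      by (intro Ltwo_bilinear[OF bounded_bilinear_scaleR] test_function_Ltwo memory_Ltwo L \<phi>)
    have t0: "test_function (\<lambda>y. 0 * \<phi> y)" by (intro test_function_mult smooth_const \<phi>)
    have "(\<lambda>y. of_real (b y) * ctest \<phi> (\<lambda>y. 0 * \<phi> y) y) \<in> Ltwo"
      using weighted_ctest[OF \<phi> t0] by (simp add: weighted_def)
    from Ltwo_mult(1)[OF this L] show ib: "integrable lborel (\<lambda>y. \<phi> y *\<^sub>R (of_real (b y) * \<omega> y))"
      by (simp add: ctest_def scaleR_conv_of_real mult.commute mult.left_commute)
    have "(LINT y|lborel. \<phi> y *\<^sub>R rayleigh b k \<omega> y) = (LINT y|lborel. \<phi> y *\<^sub>R (of_real (b y) * \<omega> y) - \<phi> y *\<^sub>R memory \<omega> y)"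
    proof (rule integral_cong_AE)
      show "(\<lambda>y. \<phi> y *\<^sub>R rayleigh b k \<omega> y) \<in> borel_measurable lborel"
        unfolding rayleigh_def \<beta> by measurable
      show "AE y in lborel. \<phi> y *\<^sub>R rayleigh b k \<omega> y = \<phi> y *\<^sub>R (of_real (b y) * \<omega> y) - \<phi> y *\<^sub>R memory \<omega> y"
        using rayleigh_AE[OF L] by eventually_elim (simp add: scaleR_right_diff_distrib)
    qed measurable
    then show "(LINT y|lborel. \<phi> y *\<^sub>R rayleigh b k \<omega> y) = (LINT y|lborel. \<phi> y *\<^sub>R (of_real (b y) * \<omega> y)) - (LINT y|lborel. \<phi> y *\<^sub>R memory \<omega> y)"
      using im ib by simp
  qed
  have "pair \<omega> (\<lambda>y. of_real (b y) * ctest \<phi>1 \<phi>2 y) = pair (\<lambda>y. of_real (b y) * \<omega> y) (ctest \<phi>1 \<phi>2)"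
    by (simp add: pair_def mult.assoc mult.left_commute)
  also have "\<dots> = (LINT y|lborel. \<phi>1 y *\<^sub>R (of_real (b y) * \<omega> y)) + \<i> * (LINT y|lborel. \<phi>2 y *\<^sub>R (of_real (b y) * \<omega> y))"
    by (intro p ib t)
  finally have "pair \<omega> (\<lambda>y. of_real (b y) * ctest \<phi>1 \<phi>2 y) = \<dots>" .
  moreover have "pair (memory \<omega>) (ctest \<phi>1 \<phi>2) = (LINT y|lborel. \<phi>1 y *\<^sub>R memory \<omega> y) + \<i> * (LINT y|lborel. \<phi>2 y *\<^sub>R memory \<omega> y)"
    by (intro p im t)
  ultimately show "generator \<omega> (ctest \<phi>1 \<phi>2) = - (\<i> * of_int k * (LINT y|lborel. \<phi>1 y *\<^sub>R rayleigh b k \<omega> y)) +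
      \<i> * - (\<i> * of_int k * (LINT y|lborel. \<phi>2 y *\<^sub>R rayleigh b k \<omega> y))"
    unfolding generator_def r[OF t(1)] r[OF t(2)] by (simp add: algebra_simps)
qed

text \<open>A weighted \<eta> is approximated by test functions in the graph norm. The norm of the
  curve is bounded on \<open>{0..t + 1}\<close>, so the derivatives of the pairings converge
  uniformly there and the limit may be differentiated. The interval reaches beyond \<open>t\<close>
  so that the derivative at \<open>t\<close> agrees with the one within the half line.\<close>

lemma rayleigh_solution_weak_curve:
  assumes "rayleigh_solution b k \<omega>in \<omega>"
  shows "weak_curve \<omega>"
proof -
  have L: "\<And>t. t \<ge> 0 \<Longrightarrow> \<omega> t \<in> Ltwo"
    and c: "\<And>t. t \<ge> 0 \<Longrightarrow> ((\<lambda>s. Ltwo_norm (\<lambda>y. \<omega> s y - \<omega> t y)) \<longlongrightarrow> 0) (at t within {0..})"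
    and e: "\<And>\<phi> t. test_function \<phi> \<Longrightarrow> t \<ge> 0 \<Longrightarrow> ((\<lambda>s. LINT y|lborel. \<phi> y *\<^sub>R \<omega> s y) has_vector_derivative
          - (\<i> * of_int k * (LINT y|lborel. \<phi> y *\<^sub>R rayleigh b k (\<omega> t) y))) (at t within {0..})"
    using assms by (auto simp: rayleigh_solution_def)
  have "((\<lambda>s. pair (\<omega> s) \<eta>) has_vector_derivative generator (\<omega> t) \<eta>) (at t within {0..})"
    if \<eta>: "weighted \<eta>" and t: "t \<ge> 0" for \<eta> t
  proof -
    obtain N where N: "N > 0" "\<And>s. 0 \<le> s \<Longrightarrow> s \<le> t + 1 \<Longrightarrow> Ltwo_norm (\<omega> s) \<le> N"
      using Ltwo_curve_bounded[OF Ltwo_curve_continuous[OF L c]] by blast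
    define near where "near n \<phi>1 \<phi>2 \<longleftrightarrow> test_function \<phi>1 \<and> test_function \<phi>2 \<and>
        Ltwo_norm (\<lambda>y. ctest \<phi>1 \<phi>2 y - \<eta> y) \<le> 1 / real (Suc n) \<and>
        Ltwo_norm (\<lambda>y. of_real (b y) * (ctest \<phi>1 \<phi>2 y - \<eta> y)) \<le> 1 / real (Suc n)" for n \<phi>1 \<phi>2
    have "\<forall>n. \<exists>\<phi>1 \<phi>2. near n \<phi>1 \<phi>2" unfolding near_def by (intro allI ctest_dense[OF \<eta>]) simp
    then obtain \<phi>1 \<phi>2 where "\<And>n. near n (\<phi>1 n) (\<phi>2 n)" by metis
    then have \<phi>: "\<And>n. test_function (\<phi>1 n)" "\<And>n. test_function (\<phi>2 n)"
      "\<And>n. Ltwo_norm (\<lambda>y. ctest (\<phi>1 n) (\<phi>2 n) y - \<eta> y) \<le> 1 / real (Suc n)"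
      "\<And>n. Ltwo_norm (\<lambda>y. of_real (b y) * (ctest (\<phi>1 n) (\<phi>2 n) y - \<eta> y)) \<le> 1 / real (Suc n)"
      by (auto simp: near_def)
    have l0: "(\<lambda>n. 1 / real (Suc n)) \<longlonglongrightarrow> 0" by (rule LIMSEQ_Suc[OF lim_1_over_n])
    define \<theta> where "\<theta> n = ctest (\<phi>1 n) (\<phi>2 n)" for n
    have w\<theta>: "weighted (\<theta> n)" for n unfolding \<theta>_def by (intro weighted_ctest \<phi>)
    let ?S = "{0..t + 1}"
    have d: "((\<lambda>s. pair (\<omega> s) (\<theta> n)) has_vector_derivative generator (\<omega> x) (\<theta> n)) (at x within ?S)" if "x \<in> ?S" for n x
    proof -
      have x: "x \<ge> 0" using that by simp
      have "((\<lambda>s. (LINT y|lborel. \<phi>1 n y *\<^sub>R \<omega> s y) + \<i> * (LINT y|lborel. \<phi>2 n y *\<^sub>R \<omega> s y)) has_vector_derivative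
          generator (\<omega> x) (\<theta> n)) (at x within {0..})"
        unfolding \<theta>_def pair_ctest(2)[OF L[OF x] \<phi>(1,2)]
        by (intro derivative_intros has_vector_derivative_mult_right e \<phi> x)
      then have "((\<lambda>s. (LINT y|lborel. \<phi>1 n y *\<^sub>R \<omega> s y) + \<i> * (LINT y|lborel. \<phi>2 n y *\<^sub>R \<omega> s y)) has_vector_derivative
          generator (\<omega> x) (\<theta> n)) (at x within ?S)"
        by (rule has_vector_derivative_within_subset) auto
      then show ?thesis
        by (rule has_vector_derivative_transform[rotated 2]) (use that pair_ctest(1)[OF L \<phi>(1,2)] in \<open>auto simp: \<theta>_def\<close>)
    qed
    define E where "E = \<kappa> * (N + C\<^sub>\<beta> * N)"
    have E: "E \<ge> 0" using N \<kappa> C\<^sub>\<beta>_nonneg by (simp add: E_def)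
    have g: "norm (generator (\<omega> x) (\<theta> n) - generator (\<omega> x) \<eta>) \<le> E / real (Suc n)" if "x \<in> ?S" for n x
    proof -
      have x: "\<omega> x \<in> Ltwo" "Ltwo_norm (\<omega> x) \<le> N" using that L N by auto
      have "generator (\<omega> x) (\<theta> n) - generator (\<omega> x) \<eta> = generator (\<omega> x) (\<lambda>y. \<theta> n y - \<eta> y)"
        by (rule generator_diff_right[symmetric, OF x(1) w\<theta> \<eta>])
      also have "norm \<dots> \<le> \<kappa> * (Ltwo_norm (\<omega> x) * Ltwo_norm (\<lambda>y. of_real (b y) * (\<theta> n y - \<eta> y)) + C\<^sub>\<beta> * Ltwo_norm (\<omega> x) * Ltwo_norm (\<lambda>y. \<theta> n y - \<eta> y))"
        by (rule generator_le[OF x(1) weighted_diff[OF w\<theta> \<eta>]])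
      also have "\<dots> \<le> \<kappa> * (N * (1 / real (Suc n)) + C\<^sub>\<beta> * N * (1 / real (Suc n)))"
        using \<kappa> C\<^sub>\<beta>_nonneg N x \<phi>(3,4)[of n] unfolding \<theta>_def by (intro mult_left_mono add_mono mult_mono) auto
      also have "\<dots> = E / real (Suc n)" by (simp add: E_def algebra_simps add_divide_distrib)
      finally show ?thesis .
    qed
    have lim: "(\<lambda>n. pair (\<omega> x) (\<theta> n)) \<longlonglongrightarrow> pair (\<omega> x) \<eta>" if "x \<in> ?S" for x
    proof -
      have x: "\<omega> x \<in> Ltwo" "Ltwo_norm (\<omega> x) \<le> N" using that L N by auto
      have "norm (pair (\<omega> x) (\<theta> n) - pair (\<omega> x) \<eta>) \<le> N * (1 / real (Suc n))" for n
      proof -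
        have tw: "\<theta> n \<in> Ltwo" "\<eta> \<in> Ltwo" using w\<theta> \<eta> by (auto simp: weighted_def)
        have "pair (\<omega> x) (\<theta> n) - pair (\<omega> x) \<eta> = pair (\<omega> x) (\<lambda>y. \<theta> n y - \<eta> y)" by (rule pair_diff(1)[symmetric, OF x(1) tw])
        also have "norm \<dots> \<le> Ltwo_norm (\<omega> x) * Ltwo_norm (\<lambda>y. \<theta> n y - \<eta> y)" by (intro pair_le x Ltwo_diff tw)
        also have "\<dots> \<le> N * (1 / real (Suc n))" using x N \<phi>(3)[of n] unfolding \<theta>_def by (intro mult_mono) auto
        finally show ?thesis .
      qed
      then have ev: "\<forall>\<^sub>F n in sequentially. norm (pair (\<omega> x) (\<theta> n) - pair (\<omega> x) \<eta>) \<le> N * (1 / real (Suc n))"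
        by (intro always_eventually allI)
      have "(\<lambda>n. N * (1 / real (Suc n))) \<longlonglongrightarrow> 0"
        using tendsto_mult_left[OF l0, of N] by (simp only: mult_zero_right)
      from Lim_null_comparison[OF ev this]
      show ?thesis by (rule LIM_zero_cancel)
    qed
    have "\<exists>g. \<forall>x\<in>?S. (\<lambda>n. pair (\<omega> x) (\<theta> n)) \<longlonglongrightarrow> g x \<and> (g has_derivative (\<lambda>h. h *\<^sub>R generator (\<omega> x) \<eta>)) (at x within ?S)"
    proof (rule has_derivative_sequence)
      show "((\<lambda>s. pair (\<omega> s) (\<theta> n)) has_derivative (\<lambda>h. h *\<^sub>R generator (\<omega> x) (\<theta> n))) (at x within ?S)" if "x \<in> ?S" for n x
        using d[OF that] by (simp add: has_vector_derivative_def)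
      show "\<forall>\<^sub>F n in sequentially. \<forall>x\<in>?S. \<forall>h. norm (h *\<^sub>R generator (\<omega> x) (\<theta> n) - h *\<^sub>R generator (\<omega> x) \<eta>) \<le> e * norm h"
        if "e > 0" for e
      proof -
        have "(\<lambda>n. E * (1 / real (Suc n))) \<longlonglongrightarrow> E * 0"
          by (rule tendsto_mult_left[OF l0])
        then have "\<forall>\<^sub>F n in sequentially. E / real (Suc n) < e" using that by (intro order_tendstoD(2)) auto
        then show ?thesis
        proof eventually_elim
          case (elim n)
          show ?case
          proof (intro ballI allI)
            fix x h assume "x \<in> ?S"
            have "norm (h *\<^sub>R generator (\<omega> x) (\<theta> n) - h *\<^sub>R generator (\<omega> x) \<eta>) = \<bar>h\<bar> * norm (generator (\<omega> x) (\<theta> n) - generator (\<omega> x) \<eta>)"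
              by (simp flip: scaleR_right_diff_distrib)
            also have "\<dots> \<le> \<bar>h\<bar> * e" using g[OF \<open>x \<in> ?S\<close>, of n] elim by (intro mult_left_mono) auto
            finally show "norm (h *\<^sub>R generator (\<omega> x) (\<theta> n) - h *\<^sub>R generator (\<omega> x) \<eta>) \<le> e * norm h" by (simp add: mult.commute)
          qed
        qed
      qed
      show "(\<lambda>n. pair (\<omega> 0) (\<theta> n)) \<longlonglongrightarrow> pair (\<omega> 0) \<eta>" using t by (intro lim) auto
    qed (use t in auto)
    then obtain g where g0: "\<forall>x\<in>?S. (\<lambda>n. pair (\<omega> x) (\<theta> n)) \<longlonglongrightarrow> g x \<and>
        (g has_derivative (\<lambda>h. h *\<^sub>R generator (\<omega> x) \<eta>)) (at x within ?S)" by blast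
    have g: "\<And>x. x \<in> ?S \<Longrightarrow> (\<lambda>n. pair (\<omega> x) (\<theta> n)) \<longlonglongrightarrow> g x"
      "\<And>x. x \<in> ?S \<Longrightarrow> (g has_vector_derivative generator (\<omega> x) \<eta>) (at x within ?S)"
      unfolding has_vector_derivative_def using g0 by blast+
    have geq: "g x = pair (\<omega> x) \<eta>" if "x \<in> ?S" for x using LIMSEQ_unique[OF g(1)[OF that] lim[OF that]] .
    have "((\<lambda>s. pair (\<omega> s) \<eta>) has_vector_derivative generator (\<omega> t) \<eta>) (at t within ?S)"
      by (rule has_vector_derivative_transform[OF _ _ g(2)]) (use t geq in auto)
    moreover have "at t within ?S = at t within {0..}"
      by (rule at_within_nhd[of _ "{..<t + 1}"]) (use t in auto)
    ultimately show ?thesis by simp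
  qed
  then show ?thesis using L c by (simp add: weak_curve_def)
qed

end

section \<open>Uniqueness, by transport along the shear\<close>

lemma has_vector_derivative_iff_tendsto:
  fixes r :: "real \<Rightarrow> 'a :: real_normed_vector"
  shows "(r has_vector_derivative D) (at t within S) \<longleftrightarrow>
    ((\<lambda>s. (1 / (s - t)) *\<^sub>R (r s - r t)) \<longlongrightarrow> D) (at t within S)"
proof -
  have "norm ((1 / (s - t)) *\<^sub>R (r s - r t) - D) = norm (r s - r t - (s - t) *\<^sub>R D) / norm (s - t)" if "s \<noteq> t" for s
  proof -
    have "(1 / (s - t)) *\<^sub>R (r s - r t) - D = (1 / (s - t)) *\<^sub>R (r s - r t - (s - t) *\<^sub>R D)"
      using that by (simp add: scaleR_right_diff_distrib)
    then show ?thesis by simp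
  qed
  then have "\<forall>\<^sub>F s in at t within S. norm ((1 / (s - t)) *\<^sub>R (r s - r t) - D) = norm (r s - r t - (s - t) *\<^sub>R D) / norm (s - t)"
    unfolding eventually_at_filter by (intro always_eventually allI impI)
  from tendsto_cong[OF this]
  have "((\<lambda>s. norm ((1 / (s - t)) *\<^sub>R (r s - r t) - D)) \<longlongrightarrow> 0) (at t within S) \<longleftrightarrow> (r has_vector_derivative D) (at t within S)"
    unfolding has_vector_derivative_def has_derivative_iff_norm by (simp only: bounded_linear_scaleR_left simp_thms)
  then show ?thesis by (simp only: tendsto_norm_zero_iff LIM_zero_iff)
qed

lemma at_within_half_line: "0 < (s::real) \<Longrightarrow> at s within {0..} = at s"
  by (rule at_within_open_subset[of _ "{0<..}"]) auto

lemma continuous_on_half_line_deriv: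
  assumes "\<And>s. s \<ge> 0 \<Longrightarrow> (f has_vector_derivative f' s) (at s within {0..})" "0 \<le> (x::real)"
  shows "continuous_on {x..y} f"
proof -
  have "continuous_on {0..} f"
    unfolding continuous_on_eq_continuous_within using has_vector_derivative_continuous[OF assms(1)] by auto
  then show ?thesis by (rule continuous_on_subset) (use assms(2) in auto)
qed

context rayleigh_data
begin

lemma weak_curve_diff:
  assumes "weak_curve u" "weak_curve v" shows "weak_curve (\<lambda>t y. u t y - v t y)"
  unfolding weak_curve_def
proof (intro conjI allI impI)
  note u = assms(1)[unfolded weak_curve_def] and v = assms(2)[unfolded weak_curve_def]
  have L: "u t \<in> Ltwo" "v t \<in> Ltwo" if "t \<ge> 0" for t using u v that by auto
  fix t :: real assume t: "t \<ge> 0"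
  show "(\<lambda>y. u t y - v t y) \<in> Ltwo" by (intro Ltwo_diff L t)
  show "((\<lambda>s. Ltwo_norm (\<lambda>y. u s y - v s y - (u t y - v t y))) \<longlongrightarrow> 0) (at t within {0..})"
  proof (rule Lim_null_comparison)
    show "((\<lambda>s. Ltwo_norm (\<lambda>y. u s y - u t y) + Ltwo_norm (\<lambda>y. v s y - v t y)) \<longlongrightarrow> 0) (at t within {0..})"
      using u v t by (auto intro!: tendsto_add_zero)
    have "norm (Ltwo_norm (\<lambda>y. u s y - v s y - (u t y - v t y))) \<le> Ltwo_norm (\<lambda>y. u s y - u t y) + Ltwo_norm (\<lambda>y. v s y - v t y)"
      if s: "s \<ge> 0" for s
    proof -
      have eq: "(\<lambda>y. u s y - v s y - (u t y - v t y)) = (\<lambda>y. (u s y - u t y) + (-1) *\<^sub>R (v s y - v t y))" by (auto simp: algebra_simps)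
      have "Ltwo_norm (\<lambda>y. (u s y - u t y) + (-1) *\<^sub>R (v s y - v t y)) \<le> Ltwo_norm (\<lambda>y. u s y - u t y) + Ltwo_norm (\<lambda>y. (-1) *\<^sub>R (v s y - v t y))"
        by (intro Ltwo_norm_triangle Ltwo_diff Ltwo_scaleR L s t)
      then show ?thesis unfolding eq Ltwo_norm_scaleR by simp
    qed
    then show "\<forall>\<^sub>F s in at t within {0..}. norm (Ltwo_norm (\<lambda>y. u s y - v s y - (u t y - v t y))) \<le>
        Ltwo_norm (\<lambda>y. u s y - u t y) + Ltwo_norm (\<lambda>y. v s y - v t y)"
      by (simp add: eventually_at_filter)
  qed
  fix \<eta> assume \<eta>: "weighted \<eta>"
  then have \<eta>L: "\<eta> \<in> Ltwo" by (simp add: weighted_def)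
  have "((\<lambda>s. pair (u s) \<eta> - pair (v s) \<eta>) has_vector_derivative generator (\<lambda>y. u t y - v t y) \<eta>) (at t within {0..})"
    unfolding generator_diff[OF L[OF t] \<eta>] using u v \<eta> t by (intro derivative_intros) auto
  then show "((\<lambda>s. pair (\<lambda>y. u s y - v s y) \<eta>) has_vector_derivative generator (\<lambda>y. u t y - v t y) \<eta>) (at t within {0..})"
    by (rule has_vector_derivative_transform[rotated 2]) (use t pair_diff(2)[OF \<eta>L L] in auto)
qed

text \<open>Transport of the multiplier by the part of the equation without memory (the interaction
  picture). In the pairing with a weak curve the unbounded term with \<open>b\<close> then cancels
  and only the bounded \<open>memory\<close> remains.\<close>

definition rotated :: "real \<Rightarrow> (real \<Rightarrow> complex) \<Rightarrow> real \<Rightarrow> complex" where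
  "rotated t \<eta> y = iexp (of_int k * b y * t) * \<eta> y"

lemma norm_rotated [simp]: "norm (rotated t \<eta> y) = norm (\<eta> y)"
  by (simp add: rotated_def norm_mult)

lemma rotated_measurable [measurable]: "\<eta> \<in> borel_measurable borel \<Longrightarrow> rotated t \<eta> \<in> borel_measurable borel"
  unfolding rotated_def[abs_def] by measurable

lemma rotated_Ltwo: "\<eta> \<in> Ltwo \<Longrightarrow> rotated t \<eta> \<in> Ltwo"
  by (rule Ltwo_bound[of _ \<eta>]) (auto dest: Ltwo_measurable)

lemma Ltwo_norm_rotated [simp]: "Ltwo_norm (rotated t \<eta>) = Ltwo_norm \<eta>"
  by (simp add: Ltwo_norm_def)

lemma rotated_b: "rotated t (\<lambda>y. of_real (b y) * \<eta> y) = (\<lambda>y. of_real (b y) * rotated t \<eta> y)"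
  by (auto simp: rotated_def)

lemma weighted_rotated: "weighted \<eta> \<Longrightarrow> weighted (rotated t \<eta>)"
  unfolding weighted_def rotated_b[symmetric] by (auto intro: rotated_Ltwo)

text \<open>A product rule. The curve is differentiable only when tested against a fixed function,
  whereas the rotated multiplier has difference quotients dominated by the square integrable
  \<open>g\<close>. The increment of the multiplier is therefore treated by dominated convergence,
  and the curve is tested with the multiplier frozen at time \<open>t\<close>.\<close>

lemma pair_rotated_deriv:
  assumes d: "weak_curve d" and \<eta>: "weighted \<eta>" and t: "t \<ge> 0"
  shows "((\<lambda>s. pair (d s) (rotated s \<eta>)) has_vector_derivative
    \<i> * of_int k * pair (memory (d t)) (rotated t \<eta>)) (at t within {0..})"
proof -
  have L: "d s \<in> Ltwo" if "s \<ge> 0" for s using d that by (simp add: weak_curve_def)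
  have \<eta>L: "\<eta> \<in> Ltwo" "(\<lambda>y. of_real (b y) * \<eta> y) \<in> Ltwo" using \<eta> by (auto simp: weighted_def)
  note rL = rotated_Ltwo[OF \<eta>L(1)] and rbL = rotated_Ltwo[OF \<eta>L(2)]
  have [measurable]: "\<eta> \<in> borel_measurable borel" using \<eta>L(1) by (rule Ltwo_measurable)
  define g where "g y = of_int k * (of_real (b y) * \<eta> y)" for y
  have gL: "g \<in> Ltwo"
    unfolding g_def[abs_def] using Ltwo_scaleR[OF \<eta>L(2), of "of_int k"] by (simp add: scaleR_conv_of_real)
  let ?D = "\<i> * of_int k * pair (d t) (rotated t (\<lambda>y. of_real (b y) * \<eta> y))"
  have "((\<lambda>s. pair (d s) (\<lambda>y. rotated s \<eta> y - rotated t \<eta> y)) has_vector_derivative ?D) (at t within {0..})"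
    unfolding has_vector_derivative_iff_tendsto tendsto_at_iff_sequentially o_def
  proof (intro allI impI)
    fix X :: "nat \<Rightarrow> real" assume X: "\<forall>n. X n \<in> {0..} - {t}" "X \<longlonglongrightarrow> t"
    have X0: "X n \<ge> 0" "X n \<noteq> t" for n using X(1) by auto
    define q where "q n y = (1 / (X n - t)) *\<^sub>R (rotated (X n) \<eta> y - rotated t \<eta> y)" for n y
    have qL: "q n \<in> Ltwo" for n unfolding q_def by (intro Ltwo_scaleR Ltwo_diff rL)
    have [measurable]: "q n \<in> borel_measurable borel" for n using qL by (rule Ltwo_measurable)
    have qg: "norm (q n y) \<le> norm (g y)" for n y
    proof -
      have "norm (rotated (X n) \<eta> y - rotated t \<eta> y) = norm (iexp (of_int k * b y * X n) - iexp (of_int k * b y * t)) * norm (\<eta> y)"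
        by (simp add: rotated_def norm_mult flip: left_diff_distrib)
      also have "\<dots> \<le> \<bar>of_int k * b y * X n - of_int k * b y * t\<bar> * norm (\<eta> y)"
        by (intro mult_right_mono norm_iexp_diff) auto
      also have "\<bar>of_int k * b y * X n - of_int k * b y * t\<bar> = \<bar>X n - t\<bar> * \<bar>of_int k * b y\<bar>"
        by (simp add: abs_mult[symmetric] algebra_simps)
      also have "\<bar>X n - t\<bar> * \<bar>of_int k * b y\<bar> * norm (\<eta> y) = \<bar>X n - t\<bar> * norm (g y)"
        by (simp add: g_def norm_mult abs_mult)
      finally have "norm (rotated (X n) \<eta> y - rotated t \<eta> y) \<le> \<bar>X n - t\<bar> * norm (g y)" .
      then show ?thesis using X0(2)[of n] by (simp add: q_def divide_le_eq mult.commute)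
    qed
    have ql: "(\<lambda>n. q n y) \<longlonglongrightarrow> \<i> * (of_int k * rotated t (\<lambda>y. of_real (b y) * \<eta> y) y)" for y
    proof -
      let ?c = "of_int k * b y"
      have "((\<lambda>s. iexp (?c * s)) has_vector_derivative ?c *\<^sub>R (\<i> * iexp (?c * t))) (at t)"
        using vector_diff_chain_at[of "\<lambda>s. ?c * s" ?c t iexp "\<i> * iexp (?c * t)"] has_vector_derivative_iexp[of "?c * t" UNIV]
          has_vector_derivative_mult_right[OF has_vector_derivative_id, of ?c] by (simp add: o_def)
      then have "((\<lambda>s. iexp (?c * s) * \<eta> y) has_vector_derivative ?c *\<^sub>R (\<i> * iexp (?c * t)) * \<eta> y) (at t)"
        by (rule has_vector_derivative_mult_left)
      then have "((\<lambda>s. rotated s \<eta> y) has_vector_derivative \<i> * (of_int k * rotated t (\<lambda>y. of_real (b y) * \<eta> y) y)) (at t)"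
        by (simp add: rotated_def scaleR_conv_of_real mult_ac)
      then show ?thesis
        unfolding has_vector_derivative_iff_tendsto tendsto_at_iff_sequentially q_def using X X0 by (auto simp: o_def)
    qed
    have lim1: "(\<lambda>n. pair (d t) (q n)) \<longlonglongrightarrow> (LINT y|lborel. d t y * (\<i> * (of_int k * rotated t (\<lambda>y. of_real (b y) * \<eta> y) y)))"
      unfolding pair_def
    proof (rule integral_dominated_convergence)
      have [measurable]: "d t \<in> borel_measurable borel" using L[OF t] by (rule Ltwo_measurable)
      show "(\<lambda>y. d t y * (\<i> * (of_int k * rotated t (\<lambda>y. of_real (b y) * \<eta> y) y))) \<in> borel_measurable lborel" by measurable
      show "(\<lambda>y. d t y * q n y) \<in> borel_measurable lborel" for n by measurable
      show "integrable lborel (\<lambda>y. norm (d t y) * norm (g y))" by (rule Ltwo_product(1)[OF L[OF t] gL])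
      show "AE y in lborel. (\<lambda>n. d t y * q n y) \<longlonglongrightarrow> d t y * (\<i> * (of_int k * rotated t (\<lambda>y. of_real (b y) * \<eta> y) y))"
        using ql by (auto intro!: tendsto_intros)
      show "AE y in lborel. norm (d t y * q n y) \<le> norm (d t y) * norm (g y)" for n
        using qg by (auto simp: norm_mult intro!: mult_left_mono)
    qed
    have "(LINT y|lborel. d t y * (\<i> * (of_int k * rotated t (\<lambda>y. of_real (b y) * \<eta> y) y))) = ?D"
    proof -
      have "(LINT y|lborel. d t y * (\<i> * (of_int k * rotated t (\<lambda>y. of_real (b y) * \<eta> y) y))) =
          (LINT y|lborel. (\<i> * of_int k) * (d t y * rotated t (\<lambda>y. of_real (b y) * \<eta> y) y))"
        by (intro Bochner_Integration.integral_cong) (auto simp: mult_ac)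
      then show ?thesis by (simp add: pair_def)
    qed
    with lim1 have lim1: "(\<lambda>n. pair (d t) (q n)) \<longlonglongrightarrow> ?D" by simp
    \<comment> \<open>Continuity of the curve in norm is what is needed here, since the difference
      quotients stay bounded in norm.\<close>
    have lim2: "(\<lambda>n. pair (\<lambda>y. d (X n) y - d t y) (q n)) \<longlonglongrightarrow> 0"
    proof (rule Lim_null_comparison)
      have "norm (pair (\<lambda>y. d (X n) y - d t y) (q n)) \<le> Ltwo_norm (\<lambda>y. d (X n) y - d t y) * Ltwo_norm g" for n
      proof -
        have "norm (pair (\<lambda>y. d (X n) y - d t y) (q n)) \<le> Ltwo_norm (\<lambda>y. d (X n) y - d t y) * Ltwo_norm (q n)"
          by (intro pair_le Ltwo_diff L X0 t qL)
        also have "\<dots> \<le> Ltwo_norm (\<lambda>y. d (X n) y - d t y) * Ltwo_norm g"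
          by (intro mult_left_mono Ltwo_norm_mono gL) (use qg in auto)
        finally show ?thesis .
      qed
      then show "\<forall>\<^sub>F n in sequentially. norm (pair (\<lambda>y. d (X n) y - d t y) (q n)) \<le> Ltwo_norm (\<lambda>y. d (X n) y - d t y) * Ltwo_norm g"
        by (intro always_eventually allI)
      have "((\<lambda>s. Ltwo_norm (\<lambda>y. d s y - d t y)) \<longlongrightarrow> 0) (at t within {0..})" using d t by (simp add: weak_curve_def)
      then have "(\<lambda>n. Ltwo_norm (\<lambda>y. d (X n) y - d t y)) \<longlonglongrightarrow> 0"
        unfolding tendsto_at_iff_sequentially using X by (auto simp: o_def)
      from tendsto_mult_right[OF this, of "Ltwo_norm g"]
      show "(\<lambda>n. Ltwo_norm (\<lambda>y. d (X n) y - d t y) * Ltwo_norm g) \<longlonglongrightarrow> 0" by (simp only: mult_zero_left)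
    qed
    have eq: "(1 / (X n - t)) *\<^sub>R (pair (d (X n)) (\<lambda>y. rotated (X n) \<eta> y - rotated t \<eta> y) - pair (d t) (\<lambda>y. rotated t \<eta> y - rotated t \<eta> y))
        = pair (\<lambda>y. d (X n) y - d t y) (q n) + pair (d t) (q n)" for n
    proof -
      have "pair (d t) (\<lambda>y. rotated t \<eta> y - rotated t \<eta> y) = 0" by (simp add: pair_def)
      moreover have "(1 / (X n - t)) *\<^sub>R pair (d (X n)) (\<lambda>y. rotated (X n) \<eta> y - rotated t \<eta> y) = pair (d (X n)) (q n)"
        unfolding pair_def q_def by (simp only: mult_scaleR_right integral_scaleR_right)
      moreover have "pair (\<lambda>y. d (X n) y - d t y) (q n) = pair (d (X n)) (q n) - pair (d t) (q n)"
        by (rule pair_diff(2)[OF qL L[OF X0(1)] L[OF t]])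
      ultimately show ?thesis by (simp only: diff_zero diff_add_cancel)
    qed
    show "(\<lambda>n. (1 / (X n - t)) *\<^sub>R (pair (d (X n)) (\<lambda>y. rotated (X n) \<eta> y - rotated t \<eta> y) - pair (d t) (\<lambda>y. rotated t \<eta> y - rotated t \<eta> y))) \<longlonglongrightarrow> ?D"
      unfolding eq using tendsto_add[OF lim2 lim1] by simp
  qed
  moreover have "((\<lambda>s. pair (d s) (rotated t \<eta>)) has_vector_derivative generator (d t) (rotated t \<eta>)) (at t within {0..})"
    using d weighted_rotated[OF \<eta>] t by (simp add: weak_curve_def)
  ultimately have "((\<lambda>s. pair (d s) (\<lambda>y. rotated s \<eta> y - rotated t \<eta> y) + pair (d s) (rotated t \<eta>)) has_vector_derivative
      ?D + generator (d t) (rotated t \<eta>)) (at t within {0..})" by (rule has_vector_derivative_add)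
  moreover have "?D + generator (d t) (rotated t \<eta>) = \<i> * of_int k * pair (memory (d t)) (rotated t \<eta>)"
    unfolding generator_def rotated_b by (simp add: algebra_simps)
  ultimately have "((\<lambda>s. pair (d s) (\<lambda>y. rotated s \<eta> y - rotated t \<eta> y) + pair (d s) (rotated t \<eta>)) has_vector_derivative
      \<i> * of_int k * pair (memory (d t)) (rotated t \<eta>)) (at t within {0..})" by simp
  then show ?thesis
    by (rule has_vector_derivative_transform[rotated 2]) (use t L rL in \<open>auto simp: pair_diff(1)\<close>)
qed

text \<open>A weighted Gronwall argument: \<open>S\<close> is the maximum of \<open>exp (- \<mu> s) \<parallel>d s\<parallel>\<close>.\<close>

lemma weak_curve_zero:
  assumes d: "weak_curve d" and d0: "AE y in lborel. d 0 y = 0" and T: "T \<ge> 0"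
  shows "AE y in lborel. d T y = 0"
proof -
  have L: "d s \<in> Ltwo" if "s \<ge> 0" for s using d that by (simp add: weak_curve_def)
  have c: "continuous_on {0..} (\<lambda>t. Ltwo_norm (d t))"
    using d by (intro Ltwo_curve_continuous) (auto simp: weak_curve_def)
  \<comment> \<open>The factor 2 makes \<open>\<kappa> * C\<^sub>\<beta> / \<mu>\<close> at most 1 /
    2, which gives \<open>S \<le> S / 2\<close> in the end; the summand 1 keeps \<mu> positive if
    \<open>C\<^sub>\<beta>\<close> is 0.\<close>
  define \<mu> where "\<mu> = 2 * \<kappa> * C\<^sub>\<beta> + 1"
  have \<mu>: "\<mu> > 0" "\<kappa> * C\<^sub>\<beta> / \<mu> \<le> 1 / 2" using \<kappa> C\<^sub>\<beta>_nonneg by (auto simp: \<mu>_def field_simps add_pos_nonneg add_nonneg_pos)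
  define h where "h s = exp (- \<mu> * s) * Ltwo_norm (d s)" for s
  have "continuous_on {0..T} h" unfolding h_def
    by (intro continuous_intros continuous_on_subset[OF c]) auto
  then obtain t where t: "t \<in> {0..T}" "\<And>s. s \<in> {0..T} \<Longrightarrow> h s \<le> h t"
    using continuous_attains_sup[of "{0..T}" h] T by auto
  define S where "S = h t"
  have S: "S \<ge> 0" by (simp add: S_def h_def)
  have dS: "Ltwo_norm (d s) \<le> S * exp (\<mu> * s)" if "s \<in> {0..T}" for s
  proof -
    have "Ltwo_norm (d s) = h s * exp (\<mu> * s)" by (simp add: h_def mult.assoc mult.commute[of "Ltwo_norm _"] flip: exp_add)
    also have "\<dots> \<le> S * exp (\<mu> * s)" unfolding S_def using t(2)[OF that] by (intro mult_right_mono) auto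
    finally show ?thesis .
  qed
  have t0: "t \<ge> 0" using t by simp
  have [measurable]: "d t \<in> borel_measurable borel" using L[OF t0] by (rule Ltwo_measurable)
  define R where "R = S * exp (\<mu> * t) / 2"
  have R: "R \<ge> 0" using S by (simp add: R_def)
  \<comment> \<open>\<open>d t\<close> may fail to be \<open>weighted\<close>. A truncation of it
    has bounded support and is admissible, and the bound \<open>R\<close> does not depend on
    \<open>n\<close>.\<close>
  define cut where "cut n y = (if \<bar>y\<bar> \<le> real n then d t y else 0)" for n y
  have [measurable]: "cut n \<in> borel_measurable borel" for n unfolding cut_def by measurable
  have cutL: "cut n \<in> Ltwo" for n by (rule Ltwo_bound[OF _ L[OF t0]]) (auto simp: cut_def)
  have bound: "Ltwo_norm (cut n) \<le> R" for n
  proof (cases "Ltwo_norm (cut n) = 0")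
    case False
    then have P: "Ltwo_norm (cut n) > 0" by (simp add: order_less_le)
    \<comment> \<open>Rotated to time \<open>t\<close> this is the conjugate of
      \<open>cut n\<close>, so the pairing at time \<open>t\<close> is the squared norm of
      \<open>cut n\<close>, while at time 0 it is 0.\<close>
    define \<eta> where "\<eta> y = iexp (- (of_int k * b y * t)) * cnj (cut n y)" for y
    have [measurable]: "cnj \<in> borel_measurable borel"
      by (intro borel_measurable_continuous_onI continuous_on_cnj continuous_on_id)
    have [measurable]: "\<eta> \<in> borel_measurable borel" unfolding \<eta>_def[abs_def] by measurable
    have \<eta>n: "norm (\<eta> y) = norm (cut n y)" for y by (simp add: \<eta>_def norm_mult)
    have \<eta>L: "\<eta> \<in> Ltwo" by (rule Ltwo_bound[OF _ cutL[of n]]) (simp_all add: \<eta>n)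
    have w: "weighted \<eta>" by (rule weighted_bounded_support[OF \<eta>L, of "real n"]) (simp add: \<eta>_def cut_def)
    have N\<eta>: "Ltwo_norm \<eta> = Ltwo_norm (cut n)" by (simp add: Ltwo_norm_def \<eta>n)
    define p where "p s = pair (d s) (rotated s \<eta>)" for s
    have pd: "(p has_vector_derivative \<i> * of_int k * pair (memory (d s)) (rotated s \<eta>)) (at s within {0..})" if "s \<ge> 0" for s
      unfolding p_def by (rule pair_rotated_deriv[OF d w that])
    have p0: "p 0 = 0"
    proof -
      have "p 0 = (LINT y::real|lborel. 0)" unfolding p_def pair_def
        using d0 L[of 0] rotated_Ltwo[OF \<eta>L, of 0] Ltwo_measurable by (intro integral_cong_AE) (auto dest!: Ltwo_measurable)
      then show ?thesis by simp
    qed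
    have pt: "p t = of_real ((Ltwo_norm (cut n))\<^sup>2)"
    proof -
      have "p t = (LINT y|lborel. of_real ((norm (cut n y))\<^sup>2))" unfolding p_def pair_def
        by (intro Bochner_Integration.integral_cong)
          (auto simp: rotated_def \<eta>_def cut_def complex_norm_square mult.assoc[symmetric] simp flip: exp_add simp del: of_real_power)
      then show ?thesis by (simp only: integral_complex_of_real Ltwo_norm_sq)
    qed
    have "norm (p t - p 0) \<le> \<kappa> * C\<^sub>\<beta> * Ltwo_norm (cut n) * S / \<mu> * exp (\<mu> * t) - \<kappa> * C\<^sub>\<beta> * Ltwo_norm (cut n) * S / \<mu> * exp (\<mu> * 0)"
    proof (cases "t = 0")
      case False
      define A where "A = \<kappa> * C\<^sub>\<beta> * Ltwo_norm (cut n) * S"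
      have "norm (p t - p 0) \<le> A / \<mu> * exp (\<mu> * t) - A / \<mu> * exp (\<mu> * 0)"
      proof (rule differentiable_bound_general[where f' = "\<lambda>s. \<i> * of_int k * pair (memory (d s)) (rotated s \<eta>)" and \<phi>' = "\<lambda>s. A * exp (\<mu> * s)"])
        show "0 < t" using False t0 by simp
        show "continuous_on {0..t} p"
          by (rule continuous_on_half_line_deriv[OF pd]) auto
        show "(p has_vector_derivative \<i> * of_int k * pair (memory (d s)) (rotated s \<eta>)) (at s)" if "0 < s" "s < t" for s
        proof -
          have "at s within {0..} = at s" using that by (intro at_within_half_line) auto
          then show ?thesis using pd[of s] that by simp
        qed
        show "((\<lambda>s. A / \<mu> * exp (\<mu> * s)) has_vector_derivative A * exp (\<mu> * s)) (at s)" for s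
          unfolding has_real_derivative_iff_has_vector_derivative[symmetric]
          using \<mu>(1) by (auto intro!: derivative_eq_intros)
        show "norm (\<i> * of_int k * pair (memory (d s)) (rotated s \<eta>)) \<le> A * exp (\<mu> * s)" if "0 < s" "s < t" for s
        proof -
          have s: "s \<ge> 0" "s \<in> {0..T}" using that t by auto
          have "norm (pair (memory (d s)) (rotated s \<eta>)) \<le> Ltwo_norm (memory (d s)) * Ltwo_norm (rotated s \<eta>)"
            by (intro pair_le memory_Ltwo L s rotated_Ltwo \<eta>L)
          also have "\<dots> \<le> (C\<^sub>\<beta> * (S * exp (\<mu> * s))) * Ltwo_norm (cut n)"
            unfolding Ltwo_norm_rotated N\<eta> using C\<^sub>\<beta>_nonneg
            by (intro mult_right_mono order_trans[OF memory_Ltwo(2)[OF L[OF s(1)]]] mult_left_mono dS s) auto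
          finally have "\<kappa> * norm (pair (memory (d s)) (rotated s \<eta>)) \<le> \<kappa> * ((C\<^sub>\<beta> * (S * exp (\<mu> * s))) * Ltwo_norm (cut n))"
            using \<kappa> by (intro mult_left_mono) auto
          then show ?thesis by (simp add: norm_mult abs_k A_def mult_ac)
        qed
      qed (use \<mu>(1) in \<open>auto intro!: continuous_intros\<close>)
      then show ?thesis by (simp add: A_def)
    qed simp
    also have "\<dots> \<le> (\<kappa> * C\<^sub>\<beta> / \<mu>) * (Ltwo_norm (cut n) * S * exp (\<mu> * t))"
    proof -
      have "0 \<le> \<kappa> * C\<^sub>\<beta> * Ltwo_norm (cut n) * S / \<mu>" using \<mu> \<kappa> C\<^sub>\<beta>_nonneg S by simp
      then show ?thesis by (simp add: mult_ac)
    qed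
    also have "\<dots> \<le> (1 / 2) * (Ltwo_norm (cut n) * S * exp (\<mu> * t))"
      using \<mu> S by (intro mult_right_mono) auto
    finally have "(Ltwo_norm (cut n))\<^sup>2 \<le> Ltwo_norm (cut n) * R"
      unfolding p0 pt by (simp add: R_def norm_power algebra_simps)
    then show ?thesis using P by (simp add: power2_eq_square)
  qed (use R in simp)
  have "Ltwo_norm (d t) \<le> R"
  proof (rule power2_le_imp_le[OF _ R])
    have "(\<lambda>n. LINT y|lborel. (norm (cut n y))\<^sup>2) \<longlonglongrightarrow> (LINT y|lborel. (norm (d t y))\<^sup>2)"
    proof (rule integral_dominated_convergence)
      show "integrable lborel (\<lambda>y. (norm (d t y))\<^sup>2)" by (rule Ltwo_integrable[OF L[OF t0]])
      show "AE y in lborel. (\<lambda>n. (norm (cut n y))\<^sup>2) \<longlonglongrightarrow> (norm (d t y))\<^sup>2"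
      proof (rule AE_I2)
        fix y
        obtain N where "\<bar>y\<bar> \<le> real N" using real_arch_simple by blast
        then show "(\<lambda>n. (norm (cut n y))\<^sup>2) \<longlonglongrightarrow> (norm (d t y))\<^sup>2"
          by (intro tendsto_eventually eventually_sequentiallyI[of N]) (auto simp: cut_def)
      qed
    qed (auto simp: cut_def)
    moreover have "(LINT y|lborel. (norm (cut n y))\<^sup>2) \<le> R\<^sup>2" for n
      unfolding Ltwo_norm_sq[symmetric] using bound[of n] by (intro power_mono) auto
    ultimately show "(Ltwo_norm (d t))\<^sup>2 \<le> R\<^sup>2" unfolding Ltwo_norm_sq by (intro LIMSEQ_le_const2) auto
  qed
  then have "exp (- \<mu> * t) * Ltwo_norm (d t) \<le> exp (- \<mu> * t) * R" by (intro mult_left_mono) auto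
  then have "S \<le> S / 2" by (simp add: S_def h_def R_def mult.left_commute flip: exp_add)
  then have "S = 0" using S by simp
  then have "Ltwo_norm (d T) = 0" using dS[of T] T by (simp add: order_antisym)
  then show ?thesis by (rule Ltwo_norm_eq_0[OF L[OF T]])
qed

lemma rayleigh_solution_unique:
  assumes "rayleigh_solution b k \<omega>in u" "rayleigh_solution b k \<omega>in v" "T \<ge> 0"
  shows "AE y in lborel. u T y = v T y"
proof -
  have "AE y in lborel. u 0 y = \<omega>in y" "AE y in lborel. v 0 y = \<omega>in y"
    using assms(1,2) by (auto simp: rayleigh_solution_def)
  then have "AE y in lborel. u 0 y - v 0 y = 0" by eventually_elim simp
  from weak_curve_zero[OF weak_curve_diff[OF assms(1,2)[THEN rayleigh_solution_weak_curve]] this assms(3)]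
  show ?thesis by eventually_elim simp
qed

end

section \<open>Existence of solutions\<close>

lemma vector_derivative_lipschitz:
  fixes f :: "real \<Rightarrow> complex"
  assumes d: "\<And>x. x \<ge> 0 \<Longrightarrow> (f has_vector_derivative f' x) (at x within {0..})"
    and E: "\<And>x. 0 \<le> x \<Longrightarrow> x \<le> T \<Longrightarrow> norm (f' x) \<le> E" and xy: "x \<in> {0..T}" "y \<in> {0..T}"
  shows "norm (f x - f y) \<le> E * \<bar>x - y\<bar>"
proof -
  have le: "norm (f y - f x) \<le> E * (y - x)" if "x < y" "x \<in> {0..T}" "y \<in> {0..T}" for x y
  proof -
    have "norm (f y - f x) \<le> E * y - E * x"
    proof (rule differentiable_bound_general[OF \<open>x < y\<close>, where f' = f' and \<phi>' = "\<lambda>_. E"])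
      show "continuous_on {x..y} f"
        by (rule continuous_on_half_line_deriv[OF d]) (use that in auto)
      show "(f has_vector_derivative f' s) (at s)" if "x < s" "s < y" for s
      proof -
        have "at s within {0..} = at s"
          using that \<open>x \<in> {0..T}\<close> by (intro at_within_half_line) auto
        then show ?thesis using d[of s] that \<open>x \<in> {0..T}\<close> by simp
      qed
      show "((\<lambda>s. E * s) has_vector_derivative E) (at s)" for s
        unfolding has_real_derivative_iff_has_vector_derivative[symmetric] by (auto intro!: derivative_eq_intros)
    qed (use that E in \<open>auto intro!: continuous_intros\<close>)
    then show ?thesis by (simp add: algebra_simps)
  qed
  show ?thesis
    using le[of x y] le[of y x] xy by (cases x y rule: linorder_cases) (auto simp: norm_minus_commute)
qed

context rayleigh_data
begin

text \<open>The potential is Lipschitz in space with a constant independent of time and, by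
  dominated convergence, continuous in time at each fixed point; together these give joint
  continuity. Times are clamped at 0 because the type of bounded continuous functions asks for a
  function on the whole plane.\<close>

lemma green_curve_bcontfun:
  fixes \<Omega> :: "real \<Rightarrow> real \<Rightarrow> complex"
  assumes [measurable]: "\<And>t. \<Omega> t \<in> borel_measurable borel" and D: "D \<in> Ltwo"
    and bound: "\<And>t z. t \<ge> 0 \<Longrightarrow> norm (\<Omega> t z) \<le> norm (D z :: real)"
    and cont: "\<And>z. continuous_on {0..} (\<lambda>t. \<Omega> t z)"
  shows "(\<lambda>p. green \<kappa> (\<Omega> (max 0 (fst p))) (snd p) :: complex) \<in> bcontfun"
proof -
  have L: "\<Omega> t \<in> Ltwo" if "t \<ge> 0" for t by (rule Ltwo_bound[OF _ D]) (use bound that in auto)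
  have LN: "Ltwo_norm (\<Omega> t) \<le> Ltwo_norm D" if "t \<ge> 0" for t by (rule Ltwo_norm_mono[OF _ D]) (use bound that in auto)
  define A where "A = Ltwo_norm (expk \<kappa>) * Ltwo_norm D"
  have A: "(LINT z|lborel. expk \<kappa> (y - z) * norm (\<Omega> t z)) \<le> A" if "t \<ge> 0" for t y
    unfolding A_def by (rule order_trans[OF expk_integral_le_Ltwo[OF \<kappa> L[OF that]]]) (intro mult_left_mono LN that; simp)
  have tc: "isCont (\<lambda>t. green \<kappa> (\<Omega> (max 0 t)) y) t0" for y t0
    unfolding continuous_at_sequentially o_def
  proof (intro allI impI)
    fix X :: "nat \<Rightarrow> real" assume X: "X \<longlonglongrightarrow> t0"
    have "(\<lambda>n. LINT z|lborel. expk \<kappa> (y - z) *\<^sub>R \<Omega> (max 0 (X n)) z) \<longlonglongrightarrow> (LINT z|lborel. expk \<kappa> (y - z) *\<^sub>R \<Omega> (max 0 t0) z)"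
    proof (rule integral_dominated_convergence)
      show "integrable lborel (\<lambda>z. norm (expk \<kappa> (y - z) *\<^sub>R D z))"
        by (intro integrable_norm conv_integrable[OF exp_kernel_expk[OF \<kappa>] D])
      show "AE z in lborel. (\<lambda>n. expk \<kappa> (y - z) *\<^sub>R \<Omega> (max 0 (X n)) z) \<longlonglongrightarrow> expk \<kappa> (y - z) *\<^sub>R \<Omega> (max 0 t0) z"
        by (intro AE_I2 tendsto_scaleR tendsto_const continuous_on_tendsto_compose[OF cont] tendsto_max X) auto
      show "AE z in lborel. norm (expk \<kappa> (y - z) *\<^sub>R \<Omega> (max 0 (X n)) z) \<le> norm (expk \<kappa> (y - z) *\<^sub>R D z)" for n
        using bound[of "max 0 (X n)"] by (auto simp: abs_mult intro!: mult_left_mono)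
    qed measurable
    then show "(\<lambda>n. green \<kappa> (\<Omega> (max 0 (X n))) y) \<longlonglongrightarrow> green \<kappa> (\<Omega> (max 0 t0)) y"
      unfolding green_def conv_def by (intro tendsto_intros)
  qed
  have "isCont (\<lambda>p. green \<kappa> (\<Omega> (max 0 (fst p))) (snd p)) q" for q :: "real \<times> real"
  proof -
    let ?F = "\<lambda>p. green \<kappa> (\<Omega> (max 0 (fst p))) (snd p)"
    let ?B = "\<lambda>p. exp \<kappa> * A * \<bar>snd q - snd p\<bar> + norm (green \<kappa> (\<Omega> (max 0 (fst p))) (snd q) - ?F q)"
    have "((\<lambda>p. snd q - snd p) \<longlongrightarrow> snd q - snd q) (at q)" by (intro tendsto_intros)
    then have "\<forall>\<^sub>F p in at q. dist (snd q - snd p) (snd q - snd q) < 1" by (rule tendstoD) simp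
    then have "\<forall>\<^sub>F p in at q. \<bar>snd q - snd p\<bar> \<le> 1" by eventually_elim (simp add: dist_real_def)
    then have "\<forall>\<^sub>F p in at q. norm (?F p - ?F q) \<le> ?B p"
    proof eventually_elim
      case (elim p)
      have "norm (?F p - green \<kappa> (\<Omega> (max 0 (fst p))) (snd q)) \<le> exp \<kappa> * A * \<bar>snd q - snd p\<bar>"
        using elim by (intro green_lipschitz \<kappa> L A) auto
      then show ?case
        using norm_triangle_ineq[of "?F p - green \<kappa> (\<Omega> (max 0 (fst p))) (snd q)" "green \<kappa> (\<Omega> (max 0 (fst p))) (snd q) - ?F q"] by simp
    qed
    moreover have "(?B \<longlongrightarrow> exp \<kappa> * A * \<bar>snd q - snd q\<bar> + norm (?F q - ?F q)) (at q)"
    proof (intro tendsto_intros)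
      show "((\<lambda>p. green \<kappa> (\<Omega> (max 0 (fst p))) (snd q)) \<longlongrightarrow> ?F q) (at q)"
        by (rule isCont_tendsto_compose[OF tc, where f = fst]) (intro tendsto_intros)
    qed
    then have "(?B \<longlongrightarrow> 0) (at q)" by simp
    ultimately have "((\<lambda>p. ?F p - ?F q) \<longlongrightarrow> 0) (at q)" by (rule Lim_null_comparison)
    then show ?thesis unfolding isCont_def by (rule LIM_zero_cancel)
  qed
  then have "continuous_on UNIV (\<lambda>p. green \<kappa> (\<Omega> (max 0 (fst p))) (snd p))"
    by (intro continuous_at_imp_continuous_on ballI)
  moreover have "bounded (range (\<lambda>p. green \<kappa> (\<Omega> (max 0 (fst p))) (snd p)))"
    unfolding bounded_iff using green_bound[OF \<kappa> L A] by (intro exI[of _ "A / (2 * \<kappa>)"]) auto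
  ultimately show ?thesis by (simp add: bcontfun_def)
qed

end

locale rayleigh_initial = rayleigh_data +
  fixes \<omega>in :: "real \<Rightarrow> complex"
  assumes \<omega>in: "\<omega>in \<in> Ltwo"
begin

section \<open>The fixed point for the stream function\<close>

definition \<mu> :: real where "\<mu> = 2 * \<kappa> * C\<^sub>\<beta> + 1"

lemma \<mu>: "\<mu> > 0" "\<kappa> * C\<^sub>\<beta> / \<mu> \<le> 1 / 2"
  using \<kappa> C\<^sub>\<beta>_nonneg by (auto simp: \<mu>_def field_simps add_pos_nonneg add_nonneg_pos)

text \<open>The unknown is the stream function multiplied by \<open>exp (- \<mu> * t)\<close>. With
  this weight one contraction covers all times at once, and bounded continuous functions form the
  complete space in which it acts.\<close>

type_synonym field = "(real \<times> real) \<Rightarrow>\<^sub>C complex"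

definition source :: "field \<Rightarrow> real \<Rightarrow> real \<Rightarrow> complex" where
  "source \<theta> z s = iexp (of_int k * b z * s) * (exp (\<mu> * s) *\<^sub>R apply_bcontfun \<theta> (s, z))"

definition duhamel :: "field \<Rightarrow> real \<Rightarrow> real \<Rightarrow> complex" where
  "duhamel \<theta> t z = (LINT s:{0..t}|lborel. source \<theta> z s)"

text \<open>For the prescribed stream function \<open>exp (\<mu> * t) * \<theta>\<close> the
  equation is a scalar linear differential equation in time for each \<open>z\<close> separately;
  this is its solution by Duhamel's formula.\<close>

definition flow :: "field \<Rightarrow> real \<Rightarrow> real \<Rightarrow> complex" where
  "flow \<theta> t z = iexp (- (of_int k * b z * t)) * (\<omega>in z + \<i> * of_int k * of_real (\<beta> z) * duhamel \<theta> t z)"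

lemma \<omega>in_measurable [measurable]: "\<omega>in \<in> borel_measurable borel"
  using \<omega>in by (rule Ltwo_measurable)

lemma bcontfun_measurable [measurable]: "(\<lambda>p. apply_bcontfun (\<theta> :: field) p) \<in> borel_measurable (borel \<Otimes>\<^sub>M borel)"
  unfolding borel_prod by (intro borel_measurable_continuous_onI continuous_on_apply_bcontfun)

lemma slice_continuous: "continuous_on A (\<lambda>s. apply_bcontfun (\<theta> :: field) (s, z))"
  by (rule continuous_on_compose2[OF continuous_on_apply_bcontfun[of UNIV \<theta>]]) (auto intro!: continuous_intros)

lemma source_continuous: "continuous_on A (source \<theta> z)"
  unfolding source_def[abs_def] by (intro continuous_intros slice_continuous)

lemma source_integrable: "set_integrable lborel {0..t} (source \<theta> z)"
  by (intro borel_integrable_atLeastAtMost' source_continuous)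

lemma duhamel_measurable [measurable]: "duhamel \<theta> t \<in> borel_measurable borel"
proof -
  have "(\<lambda>z. LINT s|lborel. indicator {0..t} s *\<^sub>R (iexp (of_int k * b z * s) * (exp (\<mu> * s) *\<^sub>R apply_bcontfun \<theta> (s, z)))) \<in> borel_measurable borel"
    by measurable
  then show ?thesis by (simp add: duhamel_def[abs_def] source_def set_lebesgue_integral_def)
qed

lemma flow_measurable [measurable]: "flow \<theta> t \<in> borel_measurable borel"
  unfolding flow_def[abs_def] by measurable

lemma duhamel_0: "duhamel \<theta> 0 z = 0"
  using set_borel_integral_eq_integral(2)[OF source_integrable[of 0 \<theta> z]] by (simp add: duhamel_def)

lemma duhamel_deriv:
  assumes "t \<ge> 0" shows "((\<lambda>t. duhamel \<theta> t z) has_vector_derivative source \<theta> z t) (at t within {0..})"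
proof -
  have "((\<lambda>u. integral {0..u} (source \<theta> z)) has_vector_derivative source \<theta> z t) (at t within {0..t + 1})"
    by (rule integral_has_vector_derivative[OF source_continuous]) (use assms in auto)
  moreover have "at t within {0..t + 1} = at t within {0..}"
    by (rule at_within_nhd[of _ "{..<t + 1}"]) (use assms in auto)
  moreover have "duhamel \<theta> t z = integral {0..t} (source \<theta> z)" for t
    unfolding duhamel_def by (rule set_borel_integral_eq_integral(2)[OF source_integrable])
  ultimately show ?thesis by simp
qed

text \<open>Integrating the growth \<open>exp (\<mu> * s)\<close> in time gains the factor
  \<open>1 / \<mu>\<close>, the source of the contraction.\<close>

lemma duhamel_diff_le:
  assumes "t \<ge> 0" and B: "\<And>p. norm (apply_bcontfun \<theta>1 p - apply_bcontfun \<theta>2 p) \<le> B"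
  shows "norm (duhamel \<theta>1 t z - duhamel \<theta>2 t z) \<le> exp (\<mu> * t) * (B / \<mu>)"
proof -
  have B0: "B \<ge> 0" using order_trans[OF norm_ge_zero B] .
  have "norm ((duhamel \<theta>1 t z - duhamel \<theta>2 t z) - (duhamel \<theta>1 0 z - duhamel \<theta>2 0 z)) \<le> B / \<mu> * exp (\<mu> * t) - B / \<mu> * exp (\<mu> * 0)"
  proof (cases "t = 0")
    case False
    have d: "((\<lambda>t. duhamel \<theta>1 t z - duhamel \<theta>2 t z) has_vector_derivative source \<theta>1 z s - source \<theta>2 z s) (at s within {0..})" if "s \<ge> 0" for s
      using that by (intro derivative_intros duhamel_deriv)
    show ?thesis
    proof (rule differentiable_bound_general[where f' = "\<lambda>s. source \<theta>1 z s - source \<theta>2 z s" and \<phi>' = "\<lambda>s. B * exp (\<mu> * s)"])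
      show "0 < t" using False assms by simp
      show "continuous_on {0..t} (\<lambda>t. duhamel \<theta>1 t z - duhamel \<theta>2 t z)"
        by (rule continuous_on_half_line_deriv[OF d]) auto
      show "((\<lambda>t. duhamel \<theta>1 t z - duhamel \<theta>2 t z) has_vector_derivative source \<theta>1 z s - source \<theta>2 z s) (at s)" if "0 < s" "s < t" for s
      proof -
        have "at s within {0..} = at s" using that by (intro at_within_half_line) auto
        then show ?thesis using d[of s] that by simp
      qed
      show "((\<lambda>s. B / \<mu> * exp (\<mu> * s)) has_vector_derivative B * exp (\<mu> * s)) (at s)" for s
        unfolding has_real_derivative_iff_has_vector_derivative[symmetric]
        using \<mu>(1) by (auto intro!: derivative_eq_intros)
      show "norm (source \<theta>1 z s - source \<theta>2 z s) \<le> B * exp (\<mu> * s)" for s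
      proof -
        have "source \<theta>1 z s - source \<theta>2 z s = iexp (of_int k * b z * s) * (exp (\<mu> * s) *\<^sub>R (apply_bcontfun \<theta>1 (s, z) - apply_bcontfun \<theta>2 (s, z)))"
          by (simp add: source_def scaleR_right_diff_distrib right_diff_distrib)
        then have "norm (source \<theta>1 z s - source \<theta>2 z s) = exp (\<mu> * s) * norm (apply_bcontfun \<theta>1 (s, z) - apply_bcontfun \<theta>2 (s, z))"
          by (simp add: norm_mult)
        also have "\<dots> \<le> exp (\<mu> * s) * B" using B by (intro mult_left_mono) auto
        finally show ?thesis by (simp add: mult.commute)
      qed
    qed (use \<mu>(1) in \<open>auto intro!: continuous_intros\<close>)
  qed (simp add: duhamel_0)
  also have "\<dots> \<le> exp (\<mu> * t) * (B / \<mu>)"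
  proof -
    have "0 \<le> B / \<mu>" using B0 \<mu> by simp
    then show ?thesis by (simp add: mult.commute)
  qed
  finally show ?thesis by (simp add: duhamel_0)
qed

lemma duhamel_le: "t \<ge> 0 \<Longrightarrow> norm (duhamel \<theta> t z) \<le> exp (\<mu> * t) * (norm \<theta> / \<mu>)"
  using duhamel_diff_le[of t \<theta> 0 "norm \<theta>" z] norm_bounded[of \<theta>]
  by (simp add: duhamel_def[of 0] source_def)

definition scaled_flow :: "field \<Rightarrow> real \<Rightarrow> real \<Rightarrow> complex" where
  "scaled_flow \<theta> t z = exp (- \<mu> * t) *\<^sub>R flow \<theta> t z"

text \<open>A square integrable majorant of \<open>scaled_flow\<close> independent of time, which
  makes dominated convergence available in all limits in time.\<close>

definition envelope :: "field \<Rightarrow> real \<Rightarrow> real" where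
  "envelope \<theta> z = norm (\<omega>in z) + (\<kappa> * (norm \<theta> / \<mu>)) *\<^sub>R \<bar>\<beta> z\<bar>"

lemma envelope_Ltwo: "envelope \<theta> \<in> Ltwo"
proof -
  have "(\<lambda>z. norm (\<omega>in z)) \<in> Ltwo" by (rule Ltwo_bound[OF _ \<omega>in]) auto
  moreover have "(\<lambda>z. \<bar>\<beta> z\<bar>) \<in> Ltwo" by (rule Ltwo_bound[OF _ \<beta>_Ltwo]) auto
  ultimately show ?thesis unfolding envelope_def[abs_def] by (intro Ltwo_add Ltwo_scaleR)
qed

lemma envelope_nonneg: "envelope \<theta> z \<ge> 0" using \<kappa> \<mu> by (simp add: envelope_def)

lemma flow_le:
  assumes "t \<ge> 0" shows "norm (flow \<theta> t z) \<le> exp (\<mu> * t) * envelope \<theta> z"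
proof -
  have "norm (flow \<theta> t z) = norm (\<omega>in z + \<i> * of_int k * of_real (\<beta> z) * duhamel \<theta> t z)" by (simp add: flow_def norm_mult)
  also have "\<dots> \<le> norm (\<omega>in z) + norm (\<i> * of_int k * of_real (\<beta> z) * duhamel \<theta> t z)" by (rule norm_triangle_ineq)
  also have "norm (\<i> * of_int k * of_real (\<beta> z) * duhamel \<theta> t z) = \<kappa> * \<bar>\<beta> z\<bar> * norm (duhamel \<theta> t z)"
    by (simp add: norm_mult abs_k)
  also have "norm (\<omega>in z) + \<kappa> * \<bar>\<beta> z\<bar> * norm (duhamel \<theta> t z) \<le> exp (\<mu> * t) * norm (\<omega>in z) + \<kappa> * \<bar>\<beta> z\<bar> * (exp (\<mu> * t) * (norm \<theta> / \<mu>))"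
    using \<mu> \<kappa> assms by (intro add_mono mult_left_mono duhamel_le) (auto simp: mult_le_cancel_right1)
  also have "\<dots> = exp (\<mu> * t) * envelope \<theta> z" by (simp add: envelope_def algebra_simps)
  finally show ?thesis .
qed

lemma scaled_flow_le: "t \<ge> 0 \<Longrightarrow> norm (scaled_flow \<theta> t z) \<le> envelope \<theta> z"
  using mult_left_mono[OF flow_le[of t \<theta> z], of "exp (- \<mu> * t)"]
  by (simp add: scaled_flow_def mult.assoc[symmetric] flip: exp_add)

lemma flow_deriv:
  assumes "t \<ge> 0"
  shows "((\<lambda>t. flow \<theta> t z) has_vector_derivative
    - (\<i> * of_int k * (of_real (b z) * flow \<theta> t z)) + \<i> * of_int k * of_real (\<beta> z) * (exp (\<mu> * t) *\<^sub>R apply_bcontfun \<theta> (t, z)))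
    (at t within {0..})"
proof -
  let ?c = "- (of_int k * b z)"
  have 1: "((\<lambda>t. iexp (?c * t)) has_vector_derivative ?c *\<^sub>R (\<i> * iexp (?c * t))) (at t)"
    using vector_diff_chain_at[of "\<lambda>s. ?c * s" ?c t iexp "\<i> * iexp (?c * t)"] has_vector_derivative_iexp[of "?c * t" UNIV]
      has_vector_derivative_mult_right[OF has_vector_derivative_id, of ?c] by (simp add: o_def)
  have 2: "((\<lambda>t. \<omega>in z + (\<i> * of_int k * of_real (\<beta> z)) * duhamel \<theta> t z) has_vector_derivative 0 + (\<i> * of_int k * of_real (\<beta> z)) * source \<theta> z t) (at t within {0..})"
    by (intro derivative_intros has_vector_derivative_mult_right duhamel_deriv assms)
  have e: "iexp (?c * t) * iexp (of_int k * b z * t) = 1" by (simp flip: exp_add)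
  have "((\<lambda>t. iexp (?c * t) * (\<omega>in z + (\<i> * of_int k * of_real (\<beta> z)) * duhamel \<theta> t z)) has_vector_derivative
      iexp (?c * t) * (0 + (\<i> * of_int k * of_real (\<beta> z)) * source \<theta> z t) + (?c *\<^sub>R (\<i> * iexp (?c * t))) * (\<omega>in z + (\<i> * of_int k * of_real (\<beta> z)) * duhamel \<theta> t z))
      (at t within {0..})"
    by (rule has_vector_derivative_mult[OF has_vector_derivative_at_within[OF 1] 2])
  also have "(\<lambda>t. iexp (?c * t) * (\<omega>in z + (\<i> * of_int k * of_real (\<beta> z)) * duhamel \<theta> t z)) = (\<lambda>t. flow \<theta> t z)"
    by (simp add: flow_def)
  also have "(?c *\<^sub>R (\<i> * iexp (?c * t))) * (\<omega>in z + (\<i> * of_int k * of_real (\<beta> z)) * duhamel \<theta> t z) = - (\<i> * of_int k * (of_real (b z) * flow \<theta> t z))"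
    by (simp add: flow_def scaleR_conv_of_real mult_ac)
  also have "iexp (?c * t) * (0 + (\<i> * of_int k * of_real (\<beta> z)) * source \<theta> z t) =
      (\<i> * of_int k * of_real (\<beta> z)) * (iexp (?c * t) * iexp (of_int k * b z * t)) * (exp (\<mu> * t) *\<^sub>R apply_bcontfun \<theta> (t, z))"
    by (simp add: source_def mult_ac)
  finally show ?thesis unfolding e by (simp add: add.commute)
qed

lemma flow_continuous: "continuous_on {0..} (\<lambda>t. flow \<theta> t z)"
  using has_vector_derivative_continuous[OF flow_deriv] by (auto simp: continuous_on_eq_continuous_within)

lemma scaled_flow_continuous: "continuous_on {0..} (\<lambda>t. scaled_flow \<theta> t z)"
  unfolding scaled_flow_def by (intro continuous_intros flow_continuous)

lemma scaled_flow_bound: "t \<ge> 0 \<Longrightarrow> norm (scaled_flow \<theta> t z) \<le> norm (envelope \<theta> z)"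
  using scaled_flow_le[of t \<theta> z] envelope_nonneg[of \<theta> z] by simp

lemma scaled_flow_measurable [measurable]: "scaled_flow \<theta> t \<in> borel_measurable borel"
  unfolding scaled_flow_def[abs_def] by measurable

lemma scaled_flow_Ltwo: "t \<ge> 0 \<Longrightarrow> scaled_flow \<theta> t \<in> Ltwo"
  by (rule Ltwo_bound[OF _ envelope_Ltwo[of \<theta>]]) (use scaled_flow_bound in auto)

text \<open>The equation is solved with the stream function frozen, and the stream function is
  recomputed from the result. A fixed point is a vorticity driven by its own potential.\<close>

definition picard :: "field \<Rightarrow> field" where
  "picard \<theta> = Bcontfun (\<lambda>p. green \<kappa> (scaled_flow \<theta> (max 0 (fst p))) (snd p))"

lemma picard_apply: "apply_bcontfun (picard \<theta>) p = green \<kappa> (scaled_flow \<theta> (max 0 (fst p))) (snd p)"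
proof -
  have "(\<lambda>p. green \<kappa> (scaled_flow \<theta> (max 0 (fst p))) (snd p)) \<in> bcontfun"
    by (rule green_curve_bcontfun[where \<Omega> = "scaled_flow \<theta>" and D = "envelope \<theta>"])
      (auto intro: envelope_Ltwo scaled_flow_continuous simp: scaled_flow_bound[unfolded real_norm_def])
  then show ?thesis unfolding picard_def by (simp add: Bcontfun_inverse)
qed

text \<open>The initial datum cancels in the difference of two flows. The Duhamel terms that remain
  are at most a multiple of \<beta>, so the ratio is
  \<open>\<kappa> * C\<^sub>\<beta> / \<mu>\<close>, at most 1 / 2 by the choice of \<mu>.\<close>

lemma picard_contraction: "dist (picard \<theta>1) (picard \<theta>2) \<le> 1 / 2 * dist \<theta>1 \<theta>2"
proof (rule dist_bound)
  fix p :: "real \<times> real"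
  define t y where "t = max 0 (fst p)" and "y = snd p"
  have t: "t \<ge> 0" by (simp add: t_def)
  let ?d = "\<lambda>z. scaled_flow \<theta>1 t z - scaled_flow \<theta>2 t z"
  note L = scaled_flow_Ltwo[OF t]
  have dL: "?d \<in> Ltwo" by (intro Ltwo_diff L)
  define B where "B = dist \<theta>1 \<theta>2"
  have Bp: "norm (apply_bcontfun \<theta>1 p - apply_bcontfun \<theta>2 p) \<le> B" for p
    using dist_bounded[of \<theta>1 p \<theta>2] by (simp add: B_def dist_norm)
  have B0: "B \<ge> 0" by (simp add: B_def)
  have c0: "\<kappa> * (B / \<mu>) \<ge> 0" using \<kappa> \<mu> B0 by simp
  have le: "norm (?d z) \<le> norm ((\<kappa> * (B / \<mu>)) *\<^sub>R \<beta> z)" for z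
  proof -
    have "?d z = exp (- \<mu> * t) *\<^sub>R (iexp (- (of_int k * b z * t)) * (\<i> * of_int k * of_real (\<beta> z) * (duhamel \<theta>1 t z - duhamel \<theta>2 t z)))"
      by (simp add: scaled_flow_def flow_def algebra_simps)
    then have "norm (?d z) = exp (- \<mu> * t) * (\<kappa> * \<bar>\<beta> z\<bar> * norm (duhamel \<theta>1 t z - duhamel \<theta>2 t z))"
      by (simp add: norm_mult abs_k)
    also have "\<dots> \<le> exp (- \<mu> * t) * (\<kappa> * \<bar>\<beta> z\<bar> * (exp (\<mu> * t) * (B / \<mu>)))"
      using \<kappa> by (intro mult_left_mono duhamel_diff_le t Bp) auto
    also have "\<dots> = (exp (- \<mu> * t) * exp (\<mu> * t)) * ((\<kappa> * (B / \<mu>)) * \<bar>\<beta> z\<bar>)" by (simp only: mult_ac)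
    also have "exp (- \<mu> * t) * exp (\<mu> * t) = 1" by (simp flip: exp_add)
    finally show ?thesis unfolding norm_scaleR[of "\<kappa> * (B / \<mu>)"] abs_of_nonneg[OF c0] by simp
  qed
  have "green \<kappa> (scaled_flow \<theta>1 t) y - green \<kappa> (scaled_flow \<theta>2 t) y = green \<kappa> ?d y"
    using conv_integrable[OF exp_kernel_expk[OF \<kappa>] L, of y \<theta>1] conv_integrable[OF exp_kernel_expk[OF \<kappa>] L, of y \<theta>2]
    unfolding green_def conv_def scaleR_right_diff_distrib
    by (simp only: Bochner_Integration.integral_diff scaleR_right_diff_distrib)
  then have "dist (apply_bcontfun (picard \<theta>1) p) (apply_bcontfun (picard \<theta>2) p) = norm (green \<kappa> ?d y)"
    by (simp add: picard_apply dist_norm t_def y_def)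
  also have "\<dots> \<le> Ltwo_norm (expk \<kappa>) / (2 * \<kappa>) * Ltwo_norm ?d" by (rule green_le[OF dL])
  also have "\<dots> \<le> Ltwo_norm (expk \<kappa>) / (2 * \<kappa>) * Ltwo_norm (\<lambda>z. (\<kappa> * (B / \<mu>)) *\<^sub>R \<beta> z)"
    using \<kappa> le by (intro mult_left_mono Ltwo_norm_mono Ltwo_scaleR \<beta>_Ltwo) auto
  also have "\<dots> = (\<kappa> * C\<^sub>\<beta> / \<mu>) * B"
    unfolding Ltwo_norm_scaleR abs_of_nonneg[OF c0] by (simp add: C\<^sub>\<beta>_def)
  also have "\<dots> \<le> 1 / 2 * B" using \<mu> B0 by (intro mult_right_mono) auto
  finally show "dist (apply_bcontfun (picard \<theta>1) p) (apply_bcontfun (picard \<theta>2) p) \<le> 1 / 2 * dist \<theta>1 \<theta>2"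
    by (simp add: B_def)
qed

lemma picard_fixpoint: obtains \<theta> where "picard \<theta> = \<theta>"
proof -
  have "\<exists>!\<theta>. picard \<theta> = \<theta>"
    by (rule banach_fix_type[of "1 / 2"]) (use picard_contraction in auto)
  then show thesis using that by blast
qed

lemma flow_Ltwo: "t \<ge> 0 \<Longrightarrow> flow \<theta> t \<in> Ltwo"
  by (rule Ltwo_bound[OF _ Ltwo_scaleR[OF envelope_Ltwo[of \<theta>], of "exp (\<mu> * t)"]])
    (use flow_le envelope_nonneg in \<open>auto intro!: order_trans[OF flow_le] AE_I2 simp: abs_mult\<close>)

lemma flow_Ltwo_continuous:
  assumes t: "t \<ge> 0"
  shows "((\<lambda>s. Ltwo_norm (\<lambda>z. flow \<theta> s z - flow \<theta> t z)) \<longlongrightarrow> 0) (at t within {0..})"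
proof (rule Lim_null_comparison)
  let ?B = "\<lambda>s. exp (\<mu> * s) * Ltwo_norm (\<lambda>z. scaled_flow \<theta> s z - scaled_flow \<theta> t z) + \<bar>exp (\<mu> * s) - exp (\<mu> * t)\<bar> * Ltwo_norm (scaled_flow \<theta> t)"
  have "((\<lambda>s. Ltwo_norm (\<lambda>z. scaled_flow \<theta> s z - scaled_flow \<theta> t z)) \<longlongrightarrow> 0) (at t within {0..})"
    by (rule Ltwo_curve_dominated[OF scaled_flow_Ltwo envelope_Ltwo scaled_flow_bound scaled_flow_continuous t])
  then have "(?B \<longlongrightarrow> exp (\<mu> * t) * 0 + \<bar>exp (\<mu> * t) - exp (\<mu> * t)\<bar> * Ltwo_norm (scaled_flow \<theta> t)) (at t within {0..})"
    by (intro tendsto_intros)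
  then show "(?B \<longlongrightarrow> 0) (at t within {0..})" by simp
  have fs: "flow \<theta> s z = exp (\<mu> * s) *\<^sub>R scaled_flow \<theta> s z" for s z
    by (simp add: scaled_flow_def flip: exp_add)
  have "norm (Ltwo_norm (\<lambda>z. flow \<theta> s z - flow \<theta> t z)) \<le> ?B s" if s: "s \<ge> 0" for s
  proof -
    have eq: "(\<lambda>z. flow \<theta> s z - flow \<theta> t z) =
        (\<lambda>z. exp (\<mu> * s) *\<^sub>R (scaled_flow \<theta> s z - scaled_flow \<theta> t z) + (exp (\<mu> * s) - exp (\<mu> * t)) *\<^sub>R scaled_flow \<theta> t z)"
      unfolding fs by (auto simp: algebra_simps)
    have "Ltwo_norm (\<lambda>z. exp (\<mu> * s) *\<^sub>R (scaled_flow \<theta> s z - scaled_flow \<theta> t z) + (exp (\<mu> * s) - exp (\<mu> * t)) *\<^sub>R scaled_flow \<theta> t z)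
      \<le> Ltwo_norm (\<lambda>z. exp (\<mu> * s) *\<^sub>R (scaled_flow \<theta> s z - scaled_flow \<theta> t z)) + Ltwo_norm (\<lambda>z. (exp (\<mu> * s) - exp (\<mu> * t)) *\<^sub>R scaled_flow \<theta> t z)"
      by (intro Ltwo_norm_triangle Ltwo_scaleR Ltwo_diff scaled_flow_Ltwo s t)
    then show ?thesis unfolding eq Ltwo_norm_scaleR by simp
  qed
  then show "\<forall>\<^sub>F s in at t within {0..}. norm (Ltwo_norm (\<lambda>z. flow \<theta> s z - flow \<theta> t z)) \<le> ?B s"
    by (simp add: eventually_at_filter)
qed

text \<open>The flow satisfies its equation pointwise in \<open>z\<close>, and differentiation is
  exchanged with the integral by dominated convergence. The dominating function contains
  \<open>b z\<close> as a factor, which a weighted \<eta> absorbs.\<close>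

lemma flow_weak_deriv:
  assumes fp: "picard \<theta> = \<theta>" and \<eta>: "weighted \<eta>" and t: "t \<ge> 0"
  shows "((\<lambda>s. pair (flow \<theta> s) \<eta>) has_vector_derivative generator (flow \<theta> t) \<eta>) (at t within {0..})"
  unfolding has_vector_derivative_iff_tendsto tendsto_at_iff_sequentially o_def
proof (intro allI impI)
  fix X :: "nat \<Rightarrow> real" assume X: "\<forall>n. X n \<in> {0..} - {t}" "X \<longlonglongrightarrow> t"
  then have X0: "X n \<ge> 0" "X n \<noteq> t" for n by auto
  have \<eta>L: "\<eta> \<in> Ltwo" "(\<lambda>y. of_real (b y) * \<eta> y) \<in> Ltwo" using \<eta> by (auto simp: weighted_def)
  have [measurable]: "\<eta> \<in> borel_measurable borel" using \<eta>L(1) by (rule Ltwo_measurable)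
  define f' where "f' s z = - (\<i> * of_int k * (of_real (b z) * flow \<theta> s z)) + \<i> * of_int k * of_real (\<beta> z) * (exp (\<mu> * s) *\<^sub>R apply_bcontfun \<theta> (s, z))" for s z
  have d: "((\<lambda>s. flow \<theta> s z) has_vector_derivative f' s z) (at s within {0..})" if "s \<ge> 0" for s z
    unfolding f'_def by (rule flow_deriv[OF that])
  have "Bseq X" using X(2) by (intro convergent_imp_Bseq convergentI)
  then obtain T0 where T0: "\<And>n. norm (X n) \<le> T0" by (auto simp: Bseq_def)
  define T where "T = max T0 t"
  have XT: "X n \<in> {0..T}" "t \<in> {0..T}" for n using T0[of n] X0[of n] t by (auto simp: T_def)
  define E where "E z = \<kappa> * \<bar>b z\<bar> * (exp (\<mu> * T) * envelope \<theta> z) + \<kappa> * \<bar>\<beta> z\<bar> * (exp (\<mu> * T) * norm \<theta>)" for z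
  have f'E: "norm (f' s z) \<le> E z" if s: "0 \<le> s" "s \<le> T" for s z
  proof -
    have es: "exp (\<mu> * s) \<le> exp (\<mu> * T)" using s \<mu> by simp
    have "norm (f' s z) \<le> norm (\<i> * of_int k * (of_real (b z) * flow \<theta> s z)) + norm (\<i> * of_int k * of_real (\<beta> z) * (exp (\<mu> * s) *\<^sub>R apply_bcontfun \<theta> (s, z)))"
      unfolding f'_def by (rule order_trans[OF norm_triangle_ineq]) simp
    also have "\<dots> = \<kappa> * \<bar>b z\<bar> * norm (flow \<theta> s z) + \<kappa> * \<bar>\<beta> z\<bar> * (exp (\<mu> * s) * norm (apply_bcontfun \<theta> (s, z)))"
      by (simp add: norm_mult abs_k mult.assoc)
    also have "\<dots> \<le> E z" unfolding E_def
      using \<kappa> es norm_bounded[of \<theta> "(s, z)"] envelope_nonneg[of \<theta> z]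
      by (intro add_mono mult_left_mono mult_mono order_trans[OF flow_le[OF s(1)]] mult_right_mono) auto
    finally show ?thesis .
  qed
  define q where "q n z = (1 / (X n - t)) *\<^sub>R (flow \<theta> (X n) z - flow \<theta> t z)" for n z
  have [measurable]: "q n \<in> borel_measurable borel" for n unfolding q_def by measurable
  have qE: "norm (q n z) \<le> E z" for n z
  proof -
    have "norm (flow \<theta> (X n) z - flow \<theta> t z) \<le> E z * \<bar>X n - t\<bar>"
      by (rule vector_derivative_lipschitz[OF d f'E XT])
    then show ?thesis using X0(2)[of n] by (simp add: q_def divide_le_eq)
  qed
  have ql: "(\<lambda>n. q n z) \<longlonglongrightarrow> f' t z" for z
    using d[OF t, of z] X unfolding has_vector_derivative_iff_tendsto tendsto_at_iff_sequentially q_def by (auto simp: o_def)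
  have [measurable]: "(\<lambda>z. apply_bcontfun \<theta> (t, z)) \<in> borel_measurable borel"
    by (intro borel_measurable_continuous_onI continuous_on_compose2[OF continuous_on_apply_bcontfun[of UNIV \<theta>]] continuous_intros) auto
  have "(\<lambda>n. LINT z|lborel. q n z * \<eta> z) \<longlonglongrightarrow> (LINT z|lborel. f' t z * \<eta> z)"
  proof (rule integral_dominated_convergence)
    have "integrable lborel (\<lambda>z. (\<kappa> * exp (\<mu> * T)) * (norm (envelope \<theta> z) * norm (of_real (b z) * \<eta> z)) + (\<kappa> * exp (\<mu> * T) * norm \<theta>) * (norm (\<beta> z) * norm (\<eta> z)))"
      by (intro Bochner_Integration.integrable_add integrable_mult_right Ltwo_product envelope_Ltwo \<eta>L \<beta>_Ltwo)
    then show "integrable lborel (\<lambda>z. E z * norm (\<eta> z))"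
      using envelope_nonneg by (simp add: E_def norm_mult algebra_simps)
    show "AE z in lborel. (\<lambda>n. q n z * \<eta> z) \<longlonglongrightarrow> f' t z * \<eta> z" using ql by (auto intro!: tendsto_intros)
    show "AE z in lborel. norm (q n z * \<eta> z) \<le> E z * norm (\<eta> z)" for n
      using qE by (auto simp: norm_mult intro!: mult_right_mono)
    show "(\<lambda>z. f' t z * \<eta> z) \<in> borel_measurable lborel" unfolding f'_def by measurable
  qed measurable
  moreover have "(LINT z|lborel. f' t z * \<eta> z) = generator (flow \<theta> t) \<eta>"
  proof -
    \<comment> \<open>The fixed point property enters here: with the exponential weight removed, the
      driving field is the potential of the flow.\<close>
    have gr: "green \<kappa> (flow \<theta> t) z = exp (\<mu> * t) *\<^sub>R apply_bcontfun \<theta> (t, z)" for z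
    proof -
      have "apply_bcontfun \<theta> (t, z) = green \<kappa> (scaled_flow \<theta> t) z"
        using picard_apply[of \<theta> "(t, z)"] t by (simp add: fp)
      also have "\<dots> = exp (- \<mu> * t) *\<^sub>R green \<kappa> (flow \<theta> t) z"
        by (simp only: green_def conv_def scaled_flow_def[abs_def] integral_scaleR_commute scaleR_left_commute)
      finally show ?thesis by (simp flip: exp_add)
    qed
    have fL: "flow \<theta> t \<in> Ltwo" by (rule flow_Ltwo[OF t])
    have "(LINT z|lborel. f' t z * \<eta> z) = (LINT z|lborel. (- (\<i> * of_int k)) * (flow \<theta> t z * (of_real (b z) * \<eta> z)) + (\<i> * of_int k) * (memory (flow \<theta> t) z * \<eta> z))"
      unfolding f'_def memory_def gr
      by (intro Bochner_Integration.integral_cong) (auto simp: scaleR_conv_of_real algebra_simps)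
    also have "\<dots> = (- (\<i> * of_int k)) * pair (flow \<theta> t) (\<lambda>y. of_real (b y) * \<eta> y) + (\<i> * of_int k) * pair (memory (flow \<theta> t)) \<eta>"
      unfolding pair_def using Ltwo_mult(1)[OF fL \<eta>L(2)] Ltwo_mult(1)[OF memory_Ltwo(1)[OF fL] \<eta>L(1)]
      by (simp only: Bochner_Integration.integral_add integrable_mult_right integral_mult_right_zero)
    finally show ?thesis by (simp add: generator_def algebra_simps)
  qed
  moreover have "(1 / (X n - t)) *\<^sub>R (pair (flow \<theta> (X n)) \<eta> - pair (flow \<theta> t) \<eta>) = (LINT z|lborel. q n z * \<eta> z)" for n
  proof -
    have "pair (flow \<theta> (X n)) \<eta> - pair (flow \<theta> t) \<eta> = pair (\<lambda>z. flow \<theta> (X n) z - flow \<theta> t z) \<eta>"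
      by (rule pair_diff(2)[symmetric, OF \<eta>L(1) flow_Ltwo[OF X0(1)] flow_Ltwo[OF t]])
    then show ?thesis by (simp only: pair_def q_def mult_scaleR_left integral_scaleR_right)
  qed
  ultimately show "(\<lambda>n. (1 / (X n - t)) *\<^sub>R (pair (flow \<theta> (X n)) \<eta> - pair (flow \<theta> t) \<eta>)) \<longlonglongrightarrow> generator (flow \<theta> t) \<eta>"
    by simp
qed

lemma rayleigh_solution_exists: "\<exists>\<omega>. rayleigh_solution b k \<omega>in \<omega>"
proof -
  obtain \<theta> where \<theta>: "picard \<theta> = \<theta>" by (rule picard_fixpoint)
  have "rayleigh_solution b k \<omega>in (flow \<theta>)"
    unfolding rayleigh_solution_def
  proof (intro conjI allI impI flow_Ltwo flow_Ltwo_continuous)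
    show "AE y in lborel. flow \<theta> 0 y = \<omega>in y" by (simp add: flow_def duhamel_0)
    fix \<phi> and t :: real assume \<phi>: "test_function \<phi>" and t: "t \<ge> 0"
    \<comment> \<open>A vanishing imaginary part reduces the complex test function to the real one;
      written as a product with \<phi>, the zero function is recognised as a test function.\<close>
    have t0: "test_function (\<lambda>y. 0 * \<phi> y)" by (intro test_function_mult smooth_const \<phi>)
    have "((\<lambda>s. pair (flow \<theta> s) (ctest \<phi> (\<lambda>y. 0 * \<phi> y))) has_vector_derivative generator (flow \<theta> t) (ctest \<phi> (\<lambda>y. 0 * \<phi> y))) (at t within {0..})"
      by (intro flow_weak_deriv \<theta> weighted_ctest \<phi> t0 t)
    moreover have "generator (flow \<theta> t) (ctest \<phi> (\<lambda>y. 0 * \<phi> y)) = - (\<i> * of_int k * (LINT y|lborel. \<phi> y *\<^sub>R rayleigh b k (flow \<theta> t) y))"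
      unfolding pair_ctest(2)[OF flow_Ltwo[OF t] \<phi> t0] by simp
    ultimately have "((\<lambda>s. pair (flow \<theta> s) (ctest \<phi> (\<lambda>y. 0 * \<phi> y))) has_vector_derivative
        - (\<i> * of_int k * (LINT y|lborel. \<phi> y *\<^sub>R rayleigh b k (flow \<theta> t) y))) (at t within {0..})" by simp
    then show "((\<lambda>s. LINT y|lborel. \<phi> y *\<^sub>R flow \<theta> s y) has_vector_derivative
        - (\<i> * of_int k * (LINT y|lborel. \<phi> y *\<^sub>R rayleigh b k (flow \<theta> t) y))) (at t within {0..})"
      by (rule has_vector_derivative_transform[rotated 2]) (use t pair_ctest(1)[OF flow_Ltwo \<phi> t0] in auto)
  qed
  then show ?thesis by blast
qed

end

section \<open>Growth\<close>

lemma Linf_norm_scaled_indicator: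
  assumes "p < q" "l \<ge> 0"
  shows "Linf_norm (\<lambda>y. l *\<^sub>R indicator {p..q} y :: complex) = ereal l"
proof (rule antisym)
  have n: "norm (l *\<^sub>R indicator {p..q} y :: complex) = l * indicator {p..q} y" for y
    using assms(2) by (simp add: indicator_def)
  show "Linf_norm (\<lambda>y. l *\<^sub>R indicator {p..q} y :: complex) \<le> ereal l"
    unfolding Linf_norm_def n by (rule esssup_I) (use assms(2) in \<open>auto simp: indicator_def\<close>)
  show "ereal l \<le> Linf_norm (\<lambda>y. l *\<^sub>R indicator {p..q} y :: complex)"
  proof (rule ccontr)
    assume "\<not> ereal l \<le> Linf_norm (\<lambda>y. l *\<^sub>R indicator {p..q} y :: complex)"
    then have "esssup lborel (\<lambda>y. ereal (l * indicator {p..q} y)) < ereal l" unfolding Linf_norm_def n by (simp only: not_le)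
    then have "AE y in lborel. ereal (l * indicator {p..q} y) < ereal l"
      using esssup_AE[of "\<lambda>y. ereal (l * indicator {p..q} y)" lborel]
      by (elim eventually_mono) (rule le_less_trans)
    then have "AE y in lborel. y \<notin> {p..q}" by eventually_elim auto
    then have "{p..q} \<in> null_sets lborel" using AE_iff_null_sets[of "{p..q}" lborel] by simp
    then have "emeasure lborel {p..q} = 0" by (rule null_setsD1)
    then show False using assms(1) by simp
  qed
qed

text \<open>Counterpart of \<open>expk_integral_le_Ltwo\<close> under a pointwise bound, finite
  because the kernel is integrable.\<close>

lemma expk_integral_le_AE:
  fixes \<omega> :: "real \<Rightarrow> complex"
  assumes \<kappa>: "\<kappa> > 0" and \<omega>: "\<omega> \<in> Ltwo" and le: "AE y in lborel. norm (\<omega> y) \<le> M"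
  shows "(LINT z|lborel. expk \<kappa> (y - z) * norm (\<omega> z)) \<le> M * integral\<^sup>L lborel (expk \<kappa>)"
proof -
  have "(LINT z|lborel. expk \<kappa> (y - z) * norm (\<omega> z)) \<le> (LINT z|lborel. M * expk \<kappa> (y - z))"
  proof (rule integral_mono_AE)
    show "integrable lborel (\<lambda>z. expk \<kappa> (y - z) * norm (\<omega> z))"
      using integrable_norm[OF conv_integrable[OF exp_kernel_expk[OF \<kappa>] \<omega>, of y]] by simp
    show "integrable lborel (\<lambda>z. M * expk \<kappa> (y - z))"
      by (intro integrable_mult_right integrable_reflect integrable_expk \<kappa>)
    show "AE z in lborel. expk \<kappa> (y - z) * norm (\<omega> z) \<le> M * expk \<kappa> (y - z)"
      using le by eventually_elim (simp add: mult.commute mult_right_mono)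
  qed
  then show ?thesis by (simp add: integral_reflect)
qed

text \<open>A slope of at least \<open>m\<close> takes \<open>b\<close> past the level
  \<open>c\<close> within distance \<open>\<bar>c - b 0\<bar> / m\<close> of the origin. This
  locates the critical point of a real eigenvalue.\<close>

lemma linear_growth_surjective:
  fixes b b1 :: "real \<Rightarrow> real"
  assumes d: "\<And>y. (b has_real_derivative b1 y) (at y)" and m: "m > 0" "\<And>y. m \<le> b1 y"
  obtains y where "b y = c"
proof -
  define r where "r = \<bar>c - b 0\<bar> / m"
  have r: "r \<ge> 0" "m * r = \<bar>c - b 0\<bar>" using m by (auto simp: r_def)
  obtain u where "b r - b 0 = (r - 0) * b1 u" using mvt_abs[OF d] by blast
  moreover have "r * m \<le> r * b1 u" using m r by (intro mult_left_mono) auto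
  ultimately have up: "c \<le> b r" using r by (simp add: mult.commute)
  obtain v where "b (- r) - b 0 = (- r - 0) * b1 v" using mvt_abs[OF d] by blast
  moreover have "r * m \<le> r * b1 v" using m r by (intro mult_left_mono) auto
  ultimately have "b (- r) \<le> c" using r by (simp add: mult.commute)
  then have "\<exists>x. - r \<le> x \<and> x \<le> r \<and> b x = c"
    using up r by (intro IVT') (auto intro!: continuous_at_imp_continuous_on DERIV_isCont[OF d])
  then show thesis using that by blast
qed

section \<open>The regularised adjoint eigenfunction\<close>

locale rayleigh_embedded =
  rayleigh_data k b \<beta> \<kappa> + shear_eigenfunction \<kappa> m M b b1 \<beta> \<beta>1 \<beta>2 y\<^sub>c c \<omega>0
  for k :: int and \<kappa> m M :: real and b b1 \<beta> \<beta>1 \<beta>2 :: "real \<Rightarrow> real" and y\<^sub>c c :: real and \<omega>0 :: "real \<Rightarrow> complex"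
begin

definition test :: "real \<Rightarrow> real \<Rightarrow> complex" where "test \<epsilon> y = \<psi> y / den \<epsilon> y"

lemma test_measurable [measurable]: "test \<epsilon> \<in> borel_measurable borel"
  unfolding test_def[abs_def] by measurable

lemma test_le:
  assumes "\<epsilon> \<noteq> 0" shows "norm (test \<epsilon> y) \<le> norm ((1 / \<bar>\<epsilon>\<bar>) *\<^sub>R \<psi> y)"
proof -
  have "norm (\<psi> y) / norm (den \<epsilon> y) \<le> norm (\<psi> y) / \<bar>\<epsilon>\<bar>"
    using den_bounds[OF assms, of y] assms by (intro divide_left_mono mult_pos_pos) auto
  then show ?thesis by (simp add: test_def norm_divide)
qed

lemma test_Ltwo: "\<epsilon> \<noteq> 0 \<Longrightarrow> test \<epsilon> \<in> Ltwo"
  by (rule Ltwo_bound[OF _ Ltwo_scaleR[OF \<psi>_Ltwo, of "1 / \<bar>\<epsilon>\<bar>"]]) (use test_le in auto)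

lemma test_integrable: "\<epsilon> \<noteq> 0 \<Longrightarrow> integrable lborel (test \<epsilon>)"
  by (rule Bochner_Integration.integrable_bound[OF integrable_scaleR_right[OF \<psi>_integrable, of "1 / \<bar>\<epsilon>\<bar>"]])
    (use test_le in auto)

text \<open>\<open>b\<close> is \<open>den\<close> plus the constant
  \<open>Complex c \<epsilon>\<close>: the multiplier satisfies an eigenvalue equation for
  multiplication by \<open>b\<close> up to the remainder \<psi>. This also makes it
  \<open>weighted\<close>, however fast \<open>b\<close> grows.\<close>

lemma b_test:
  assumes "\<epsilon> \<noteq> 0" shows "of_real (b y) * test \<epsilon> y = \<psi> y + Complex c \<epsilon> * test \<epsilon> y"
proof -
  have "of_real (b y) = den \<epsilon> y + Complex c \<epsilon>" by (simp add: den_def complex_eq_iff)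
  then show ?thesis using den_bounds(1)[OF assms, of y] by (simp add: test_def distrib_right add_divide_distrib)
qed

lemma weighted_test: "\<epsilon> \<noteq> 0 \<Longrightarrow> weighted (test \<epsilon>)"
  unfolding weighted_def b_test
  by (intro conjI test_Ltwo Ltwo_add \<psi>_Ltwo Ltwo_bounded_mult[where C = "norm (Complex c \<epsilon>)"]) auto

lemma speed_W: "(b y - c) *\<^sub>R W y = \<beta> y *\<^sub>R \<psi> y"
  using speed_nonzero[of y] \<beta>_yc_zero by (cases "y = y\<^sub>c") (auto simp: W_def)

text \<open>The regularised resolvent of the eigenfunction nearly solves the adjoint equation; this is what
  makes the pairing with a solution obey a scalar differential equation.\<close>

lemma generator_test:
  assumes \<epsilon>: "\<epsilon> \<noteq> 0" and \<omega>: "\<omega> \<in> Ltwo"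
  shows "generator \<omega> (test \<epsilon>) = Complex (of_int k * \<epsilon>) (- (of_int k * c)) * pair \<omega> (test \<epsilon>)
    - of_int k * of_real \<epsilon> * (LINT y|lborel. green \<kappa> \<omega> y * W y / den \<epsilon> y)"
proof -
  define G where "G = green \<kappa> \<omega>"
  have G: "G \<in> Ltwo" unfolding G_def by (rule green_Ltwo[OF \<kappa> \<omega>])
  have [measurable]: "G \<in> borel_measurable borel" using G by (rule Ltwo_measurable)
  have Wd: "(\<lambda>y. W y / den \<epsilon> y) \<in> Ltwo"
  proof (rule Ltwo_bound[OF _ Ltwo_scaleR[OF W_Ltwo, of "1 / \<bar>\<epsilon>\<bar>"]])
    have "norm (W y) / norm (den \<epsilon> y) \<le> norm (W y) / \<bar>\<epsilon>\<bar>" for y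
      using den_bounds[OF \<epsilon>, of y] \<epsilon> by (intro divide_left_mono mult_pos_pos) auto
    then show "AE y in lborel. norm (W y / den \<epsilon> y) \<le> norm ((1 / \<bar>\<epsilon>\<bar>) *\<^sub>R W y)" by (simp add: norm_divide)
  qed measurable
  have i: "integrable lborel (\<lambda>y. G y * W y)" "integrable lborel (\<lambda>y. G y * (W y / den \<epsilon> y))"
      "integrable lborel (\<lambda>y. \<omega> y * \<psi> y)" "integrable lborel (\<lambda>y. \<omega> y * test \<epsilon> y)"
    by (intro Ltwo_mult(1) G W_Ltwo Wd \<omega> \<psi>_Ltwo test_Ltwo \<epsilon>)+
  define X where "X = (LINT y|lborel. \<omega> y * \<psi> y)"
  define Y where "Y = (LINT y|lborel. G y * (W y / den \<epsilon> y))"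
  have "pair \<omega> (\<lambda>y. of_real (b y) * test \<epsilon> y) = (LINT y|lborel. \<omega> y * \<psi> y + Complex c \<epsilon> * (\<omega> y * test \<epsilon> y))"
    unfolding pair_def b_test[OF \<epsilon>] by (simp add: distrib_left mult.left_commute)
  also have "\<dots> = X + Complex c \<epsilon> * pair \<omega> (test \<epsilon>)"
    unfolding pair_def X_def using i by (simp only: Bochner_Integration.integral_add integrable_mult_right integral_mult_right_zero)
  finally have 1: "pair \<omega> (\<lambda>y. of_real (b y) * test \<epsilon> y) = X + Complex c \<epsilon> * pair \<omega> (test \<epsilon>)" .
  \<comment> \<open>\<beta> \<psi> equals \<open>(b - c) W\<close>, and \<open>b - c\<close> is
    \<open>den\<close> plus \<i> \<epsilon>. The first summand is free of the singularity, the
    second keeps it but carries the factor \<epsilon>.\<close>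
  have mem: "memory \<omega> y * test \<epsilon> y = G y * W y + \<i> * of_real \<epsilon> * (G y * (W y / den \<epsilon> y))" for y
  proof -
    have "memory \<omega> y * test \<epsilon> y = G y * (\<beta> y *\<^sub>R \<psi> y) / den \<epsilon> y"
      by (simp add: memory_def G_def test_def)
    also have "\<beta> y *\<^sub>R \<psi> y = of_real (b y - c) * W y" unfolding speed_W[symmetric] by (rule scaleR_conv_of_real)
    also have "of_real (b y - c) = den \<epsilon> y + \<i> * of_real \<epsilon>" by (simp add: den_def complex_eq_iff)
    finally show ?thesis using den_bounds(1)[OF \<epsilon>, of y] by (simp add: field_simps)
  qed
  have "pair (memory \<omega>) (test \<epsilon>) = (LINT y|lborel. G y * W y) + \<i> * of_real \<epsilon> * Y"
    unfolding pair_def mem Y_def using i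
    by (simp only: Bochner_Integration.integral_add integrable_mult_right integral_mult_right_zero)
  \<comment> \<open>The Green function is symmetric and the potential of \<open>W\<close> is \<psi>,
    so this is the same \<open>X\<close> as in the transport term, and the two cancel in the
    generator.\<close>
  also have "(LINT y|lborel. G y * W y) = X"
    unfolding G_def X_def using green_pair[OF \<kappa> \<omega> W_Ltwo] by (simp add: green_W)
  finally have 2: "pair (memory \<omega>) (test \<epsilon>) = X + \<i> * of_real \<epsilon> * Y" .
  have "- (\<i> * of_int k * (Complex c \<epsilon> * P - \<i> * of_real \<epsilon> * Y)) =
      Complex (of_int k * \<epsilon>) (- (of_int k * c)) * P - of_int k * of_real \<epsilon> * Y" for P
    by (simp add: complex_eq_iff algebra_simps)
  then show ?thesis unfolding generator_def 1 2 by (simp add: Y_def G_def)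
qed

text \<open>\<open>P\<close> is the pairing with growth and oscillation divided out. Its derivative
  is at most \<open>K * r * exp (- r * s)\<close>, whose integral over all positive times is
  \<open>K\<close> whatever \<open>r\<close> is, so \<open>P\<close> falls below its initial size by
  at most \<open>K\<close>.\<close>

lemma test_pair_growth:
  assumes \<epsilon>: "of_int k * \<epsilon> > 0" and w: "weak_curve \<omega>"
    and K: "\<And>t. t > 0 \<Longrightarrow> norm (LINT y|lborel. green \<kappa> (\<omega> t) y * W y / den \<epsilon> y) \<le> K"
    and "K \<ge> 0" and t: "t > 0"
  shows "exp (of_int k * \<epsilon> * t) * (norm (pair (\<omega> 0) (test \<epsilon>)) - K) \<le> norm (pair (\<omega> t) (test \<epsilon>))"
proof -
  have \<epsilon>0: "\<epsilon> \<noteq> 0" using \<epsilon> by auto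
  define r where "r = of_int k * \<epsilon>"
  have r: "r > 0" using \<epsilon> by (simp add: r_def)
  define z where "z = Complex r (- (of_int k * c))"
  define F where "F s = pair (\<omega> s) (test \<epsilon>)" for s
  define g where "g s = (LINT y|lborel. green \<kappa> (\<omega> s) y * W y / den \<epsilon> y)" for s
  define P where "P s = exp (- (of_real s * z)) * F s" for s
  have L: "\<omega> s \<in> Ltwo" if "s \<ge> 0" for s using w that by (simp add: weak_curve_def)
  have dF: "(F has_vector_derivative z * F s - of_real r * g s) (at s within {0..})" if "s \<ge> 0" for s
  proof -
    have "(F has_vector_derivative generator (\<omega> s) (test \<epsilon>)) (at s within {0..})"
      unfolding F_def using w weighted_test[OF \<epsilon>0] that by (simp add: weak_curve_def)
    then show ?thesis unfolding generator_test[OF \<epsilon>0 L[OF that]] by (simp add: F_def g_def r_def z_def)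
  qed
  have dP: "(P has_vector_derivative - (exp (- (of_real s * z)) * (of_real r * g s))) (at s within {0..})" if "s \<ge> 0" for s
  proof -
    have "((\<lambda>s. exp (s *\<^sub>R (- z))) has_vector_derivative exp (s *\<^sub>R (- z)) * (- z)) (at s within {0..})"
      by (rule exp_scaleR_has_vector_derivative_right)
    then have "((\<lambda>s. exp (- (of_real s * z))) has_vector_derivative exp (- (of_real s * z)) * (- z)) (at s within {0..})"
      by (simp add: scaleR_conv_of_real)
    from has_vector_derivative_mult[OF this dF[OF that]]
    show ?thesis unfolding P_def[abs_def] by (simp add: algebra_simps)
  qed
  have ne: "norm (exp (- (of_real s * z))) = exp (- r * s)" for s by (simp add: z_def)
  have "norm (P t - P 0) \<le> - K * exp (- r * t) - (- K * exp (- r * 0))"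
  proof (rule differentiable_bound_general[OF t, where f' = "\<lambda>s. - (exp (- (of_real s * z)) * (of_real r * g s))" and \<phi>' = "\<lambda>s. K * (r * exp (- r * s))"])
    show "continuous_on {0..t} P" by (rule continuous_on_half_line_deriv[OF dP]) auto
    show "(P has_vector_derivative - (exp (- (of_real s * z)) * (of_real r * g s))) (at s)" if "0 < s" "s < t" for s
      using dP[of s] at_within_half_line[OF that(1)] that by simp
    show "((\<lambda>s. - K * exp (- r * s)) has_vector_derivative K * (r * exp (- r * s))) (at s)" for s
      unfolding has_real_derivative_iff_has_vector_derivative[symmetric] by (auto intro!: derivative_eq_intros)
    show "norm (- (exp (- (of_real s * z)) * (of_real r * g s))) \<le> K * (r * exp (- r * s))" if "0 < s" "s < t" for s
    proof -
      have "norm (- (exp (- (of_real s * z)) * (of_real r * g s))) = exp (- r * s) * (r * norm (g s))"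
        unfolding norm_minus_cancel norm_mult ne using r by simp
      also have "\<dots> \<le> exp (- r * s) * (r * K)" using K[OF that(1)] r by (intro mult_left_mono) (auto simp: g_def)
      finally show ?thesis by (simp add: mult_ac)
    qed
  qed (auto intro!: continuous_intros)
  also have "\<dots> \<le> K" using \<open>K \<ge> 0\<close> by simp
  finally have "norm (P 0) - K \<le> norm (P t)" using norm_triangle_ineq2[of "P 0" "P t"] by (simp add: norm_minus_commute)
  moreover have "P 0 = F 0" by (simp add: P_def)
  moreover have "norm (P t) = exp (- r * t) * norm (F t)" unfolding P_def norm_mult ne ..
  ultimately have "norm (F 0) - K \<le> exp (- r * t) * norm (F t)" by simp
  then have "exp (r * t) * (norm (F 0) - K) \<le> exp (r * t) * (exp (- r * t) * norm (F t))" by (intro mult_left_mono) auto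
  also have "\<dots> = norm (F t)" by (simp add: mult.assoc[symmetric] flip: exp_add)
  finally show ?thesis by (simp add: F_def r_def)
qed

text \<open>Height 1 / 2 on an interval of length 1 gives both norms the value 1 / 2, so their sum
  is 1. The interval starts at the critical point, so that the singular integral is one-sided and
  its logarithm does not cancel.\<close>

definition step :: "real \<Rightarrow> complex" where
  "step y = (1 / 2) *\<^sub>R indicator {y\<^sub>c..y\<^sub>c + 1} y"

lemma step_Ltwo: "step \<in> Ltwo" and Ltwo_norm_step: "Ltwo_norm step = 1 / 2"
proof -
  have eq: "(norm (step y))\<^sup>2 = (1 / 4) * indicat_real {y\<^sub>c..y\<^sub>c + 1} y" for y
    by (simp add: step_def indicator_def power2_eq_square)
  have [measurable]: "step \<in> borel_measurable borel" unfolding step_def[abs_def] by measurable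
  show "step \<in> Ltwo" by (rule LtwoI) (auto simp: eq emeasure_lborel_Icc_eq)
  show "Ltwo_norm step = 1 / 2" unfolding Ltwo_norm_def eq by (simp add: real_sqrt_divide)
qed

lemma Linf_norm_step: "Linf_norm step = ereal (1 / 2)"
  unfolding step_def[abs_def] by (rule Linf_norm_scaled_indicator) auto

lemma pair_step: "pair step (test \<epsilon>) = (1 / 2) *\<^sub>R (LINT y:{y\<^sub>c..y\<^sub>c + 1}|lborel. \<psi> y / den \<epsilon> y)"
proof -
  have "pair step (test \<epsilon>) = (LINT y|lborel. (1 / 2) *\<^sub>R (indicator {y\<^sub>c..y\<^sub>c + 1} y *\<^sub>R (\<psi> y / den \<epsilon> y)))"
    unfolding pair_def step_def test_def by (intro Bochner_Integration.integral_cong) (auto simp: indicator_def scaleR_conv_of_real)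
  then show ?thesis by (simp only: integral_scaleR_right set_lebesgue_integral_def)
qed

text \<open>\<open>T\<close> has to serve all solutions. It is found by contradiction for one
  solution, and uniqueness transfers both norms at time \<open>T\<close> to any other.\<close>

lemma growth:
  assumes R: "R > 0"
  obtains T where "T > 0" "\<And>\<omega>. rayleigh_solution b k step \<omega> \<Longrightarrow> Linf_norm (\<omega> T) \<ge> ereal R \<and> Ltwo_norm (\<omega> T) \<ge> R"
proof -
  have "\<exists>C\<ge>0. \<forall>\<epsilon> (\<omega> :: real \<Rightarrow> complex) A. \<epsilon> \<noteq> 0 \<longrightarrow> \<omega> \<in> Ltwo \<longrightarrow> (\<forall>y. (LINT z|lborel. expk \<kappa> (y - z) * norm (\<omega> z)) \<le> A) \<longrightarrow>
      norm (LINT y|lborel. green \<kappa> \<omega> y * W y / den \<epsilon> y) \<le> C * A"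
  proof (rule memory_bounded)
    fix C :: real assume C: "C \<ge> 0" "\<And>\<epsilon> (\<omega> :: real \<Rightarrow> complex) A. \<epsilon> \<noteq> 0 \<Longrightarrow> \<omega> \<in> Ltwo \<Longrightarrow> (\<And>y. (LINT z|lborel. expk \<kappa> (y - z) * norm (\<omega> z)) \<le> A) \<Longrightarrow>
      norm (LINT y|lborel. green \<kappa> \<omega> y * W y / den \<epsilon> y) \<le> C * A"
    show ?thesis by (intro exI[of _ C] conjI allI impI C) auto
  qed
  then obtain C where C: "C \<ge> 0" "\<And>\<epsilon> (\<omega> :: real \<Rightarrow> complex) A. \<epsilon> \<noteq> 0 \<Longrightarrow> \<omega> \<in> Ltwo \<Longrightarrow> (\<forall>y. (LINT z|lborel. expk \<kappa> (y - z) * norm (\<omega> z)) \<le> A) \<Longrightarrow>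
      norm (LINT y|lborel. green \<kappa> \<omega> y * W y / den \<epsilon> y) \<le> C * A"
    by auto
  \<comment> \<open>The sum of the bounds in the two cases, so that it applies whichever norm is
    small at a given time.\<close>
  define A where "A = R * integral\<^sup>L lborel (expk \<kappa>) + Ltwo_norm (expk \<kappa>) * R"
  have I0: "integral\<^sup>L lborel (expk \<kappa>) \<ge> 0" by simp
  have A: "A \<ge> 0" using R I0 by (simp add: A_def)
  \<comment> \<open>The datum has height 1 / 2, hence the factor 2; the initial pairing then exceeds
    the possible loss \<open>C * A\<close> by at least 1.\<close>
  obtain e where e: "e > 0" "\<And>\<epsilon>. \<bar>\<epsilon>\<bar> = e \<Longrightarrow> norm (LINT y:{y\<^sub>c..y\<^sub>c + 1}|lborel. \<psi> y / den \<epsilon> y) > 2 * (C * A + 1)"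
    by (rule \<psi>_singular_unbounded) (rule that)
  \<comment> \<open>The sign makes \<open>of_int k * \<epsilon>\<close> positive, so that the
    pairing grows forward in time.\<close>
  define \<epsilon> where "\<epsilon> = (if k > 0 then e else - e)"
  have \<epsilon>: "\<bar>\<epsilon>\<bar> = e" "\<epsilon> \<noteq> 0" "of_int k * \<epsilon> = \<kappa> * e" using e(1) k by (auto simp: \<epsilon>_def \<kappa>_def)
  have pos: "of_int k * \<epsilon> > 0" using \<epsilon>(3) \<kappa> e(1) by simp
  obtain \<omega> where \<omega>: "rayleigh_solution b k step \<omega>"
    using rayleigh_initial.rayleigh_solution_exists[of k b \<beta> \<kappa> step] rayleigh_data_axioms step_Ltwo
    by (auto simp: rayleigh_initial_def rayleigh_initial_axioms_def)
  have w: "weak_curve \<omega>" by (rule rayleigh_solution_weak_curve[OF \<omega>])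
  have L: "\<omega> s \<in> Ltwo" if "s \<ge> 0" for s using w that by (simp add: weak_curve_def)
  have "\<exists>T>0. Linf_norm (\<omega> T) \<ge> ereal R \<and> Ltwo_norm (\<omega> T) \<ge> R"
  proof (rule ccontr)
    assume neg: "\<not> (\<exists>T>0. Linf_norm (\<omega> T) \<ge> ereal R \<and> Ltwo_norm (\<omega> T) \<ge> R)"
    have small: "(AE y in lborel. norm (\<omega> t y) \<le> R) \<or> Ltwo_norm (\<omega> t) \<le> R" if "t > 0" for t
    proof (cases "Ltwo_norm (\<omega> t) \<ge> R")
      case True
      then have "\<not> ereal R \<le> Linf_norm (\<omega> t)" using neg that by blast
      then have "Linf_norm (\<omega> t) < ereal R" by (simp only: not_le)
      then have "AE y in lborel. norm (\<omega> t y) \<le> R"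
        using esssup_AE[of "\<lambda>y. ereal (norm (\<omega> t y))" lborel] unfolding Linf_norm_def
        by (auto elim!: eventually_mono dest: order_le_less_trans less_imp_le)
      then show ?thesis ..
    qed simp
    have bound: "(LINT z|lborel. expk \<kappa> (y - z) * norm (\<omega> t z)) \<le> A" if "t > 0" for t y
      using small[OF that]
    proof
      assume "AE y in lborel. norm (\<omega> t y) \<le> R"
      from expk_integral_le_AE[OF \<kappa> L this, of y] that
      show ?thesis using R by (auto simp: A_def intro: add_increasing2)
    next
      assume "Ltwo_norm (\<omega> t) \<le> R"
      then have "Ltwo_norm (expk \<kappa>) * Ltwo_norm (\<omega> t) \<le> Ltwo_norm (expk \<kappa>) * R" by (intro mult_left_mono) auto
      moreover have "0 \<le> R * integral\<^sup>L lborel (expk \<kappa>)" using R I0 by (intro mult_nonneg_nonneg) auto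
      ultimately show ?thesis
        using expk_integral_le_Ltwo[OF \<kappa> L[OF less_imp_le[OF that]], of y] unfolding A_def by linarith
    qed
    have mem: "norm (LINT y|lborel. green \<kappa> (\<omega> t) y * W y / den \<epsilon> y) \<le> C * A" if "t > 0" for t
      by (rule C(2)[OF \<epsilon>(2) L]) (use that bound[OF that] in auto)
    have "pair (\<omega> 0) (test \<epsilon>) = pair step (test \<epsilon>)"
    proof -
      have [measurable]: "\<omega> 0 \<in> borel_measurable borel" "step \<in> borel_measurable borel"
        using Ltwo_measurable[OF L] Ltwo_measurable[OF step_Ltwo] by auto
      have "AE y in lborel. \<omega> 0 y = step y" using \<omega> by (simp add: rayleigh_solution_def)
      then show ?thesis unfolding pair_def by (intro integral_cong_AE) (auto elim!: eventually_mono)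
    qed
    then have F0: "norm (pair (\<omega> 0) (test \<epsilon>)) - C * A \<ge> 1"
      using e(2)[OF \<epsilon>(1)] by (simp add: pair_step)
    define N where "N = R * (LINT y|lborel. norm (test \<epsilon> y)) + R * Ltwo_norm (test \<epsilon>)"
    have Ft: "norm (pair (\<omega> t) (test \<epsilon>)) \<le> N" if t: "t > 0" for t
      using small[OF t]
    proof
      assume le: "AE y in lborel. norm (\<omega> t y) \<le> R"
      have "norm (pair (\<omega> t) (test \<epsilon>)) \<le> (LINT y|lborel. norm (\<omega> t y * test \<epsilon> y))"
        unfolding pair_def by (rule integral_norm_bound)
      also have "\<dots> \<le> (LINT y|lborel. R * norm (test \<epsilon> y))"
      proof (rule integral_mono_AE)
        show "integrable lborel (\<lambda>y. norm (\<omega> t y * test \<epsilon> y))"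
          using t by (intro integrable_norm Ltwo_mult(1) L test_Ltwo \<epsilon>) auto
        show "integrable lborel (\<lambda>y. R * norm (test \<epsilon> y))"
          by (intro integrable_mult_right integrable_norm test_integrable \<epsilon>)
        show "AE y in lborel. norm (\<omega> t y * test \<epsilon> y) \<le> R * norm (test \<epsilon> y)"
          using le by eventually_elim (simp add: norm_mult mult_right_mono)
      qed
      also have "\<dots> \<le> N" using R by (simp add: N_def)
      finally show ?thesis .
    next
      assume le: "Ltwo_norm (\<omega> t) \<le> R"
      have "norm (pair (\<omega> t) (test \<epsilon>)) \<le> Ltwo_norm (\<omega> t) * Ltwo_norm (test \<epsilon>)"
        using t by (intro pair_le L test_Ltwo \<epsilon>) auto
      also have "\<dots> \<le> R * Ltwo_norm (test \<epsilon>)" using le by (intro mult_right_mono) auto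
      also have "\<dots> \<le> N" using R by (simp add: N_def)
      finally show ?thesis .
    qed
    \<comment> \<open>The exponent at this time is \<open>\<bar>N\<bar> + 1\<close>, enough for the
      exponential to exceed the bound \<open>N\<close>.\<close>
    define t where "t = (\<bar>N\<bar> + 1) / (\<kappa> * e)"
    have t: "t > 0" using \<kappa> e(1) by (simp add: t_def add_nonneg_pos)
    have "N < 1 + (\<bar>N\<bar> + 1)" by simp
    also have "\<bar>N\<bar> + 1 = of_int k * \<epsilon> * t" using \<kappa> e(1) by (simp add: t_def \<epsilon>(3))
    also have "1 + of_int k * \<epsilon> * t \<le> exp (of_int k * \<epsilon> * t)" by (rule exp_ge_add_one_self)
    also have "\<dots> \<le> exp (of_int k * \<epsilon> * t) * (norm (pair (\<omega> 0) (test \<epsilon>)) - C * A)" using F0 by simp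
    also have "\<dots> \<le> norm (pair (\<omega> t) (test \<epsilon>))"
      by (rule test_pair_growth[OF pos w mem _ t]) (use C(1) A in auto)
    also have "\<dots> \<le> N" by (rule Ft[OF t])
    finally show False by simp
  qed
  then obtain T where T: "T > 0" "Linf_norm (\<omega> T) \<ge> ereal R" "Ltwo_norm (\<omega> T) \<ge> R" by blast
  show thesis
  proof (rule that[OF T(1)])
    fix u assume u: "rayleigh_solution b k step u"
    have [measurable]: "\<omega> T \<in> borel_measurable borel" "u T \<in> borel_measurable borel"
      using \<omega> u T(1) by (auto simp: rayleigh_solution_def intro!: Ltwo_measurable)
    have eq: "AE y in lborel. \<omega> T y = u T y"
      by (rule rayleigh_solution_unique[OF \<omega> u]) (use T in simp)
    have "Ltwo_norm (\<omega> T) = Ltwo_norm (u T)" by (rule Ltwo_norm_cong_AE[OF _ _ eq]) auto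
    moreover have "Linf_norm (\<omega> T) = Linf_norm (u T)"
      unfolding Linf_norm_def by (rule esssup_AE_cong) (use eq in \<open>auto elim!: eventually_mono\<close>)
    ultimately show "Linf_norm (u T) \<ge> ereal R \<and> Ltwo_norm (u T) \<ge> R" using T by simp
  qed
qed

end

theorem theorem1p2:
  fixes k :: int and b :: "real \<Rightarrow> real" and c\<^sub>m M :: real
  assumes k: "k \<noteq> 0"
    and b_diff: "\<And>y. b differentiable (at y)" "\<And>y. deriv b differentiable (at y)"
    and c\<^sub>m: "0 < c\<^sub>m" "c\<^sub>m < 1"
    and b': "\<And>y. c\<^sub>m \<le> deriv b y \<and> deriv b y \<le> inverse c\<^sub>m"
    and b'': "deriv (deriv b) \<in> sobolev_H 4"
    and single: "\<exists>!c. embedded_eigenvalue b k c"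
    and no_other: "\<And>c. rayleigh_eigenvalue b k c \<Longrightarrow> embedded_eigenvalue b k c"
    and M: "M > 0"
  shows "\<exists>\<omega>in T. \<omega>in \<in> Ltwo \<and> T > 0 \<and> Linf_norm \<omega>in + ereal (Ltwo_norm \<omega>in) = 1 \<and>
           (\<exists>\<omega>. rayleigh_solution b k \<omega>in \<omega>) \<and>
           (\<forall>\<omega>. rayleigh_solution b k \<omega>in \<omega> \<longrightarrow>
              Linf_norm (\<omega> T) \<ge> ereal M \<and> Ltwo_norm (\<omega> T) \<ge> M)"
proof -
  define \<beta> where "\<beta> = deriv (deriv b)"
  define \<kappa> :: real where "\<kappa> = of_int \<bar>k\<bar>"
  have \<kappa>: "\<kappa> > 0" using k by (simp add: \<kappa>_def)
  have db: "(b has_real_derivative deriv b y) (at y)" "(deriv b has_real_derivative \<beta> y) (at y)" for y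
    using b_diff by (auto simp: \<beta>_def DERIV_deriv_iff_real_differentiable)
  have \<beta>L: "\<beta> \<in> Ltwo" using b'' by (simp add: \<beta>_def sobolev_H_def)
  obtain \<beta>0 \<beta>1 \<beta>2 where \<beta>0: "AE y in lborel. \<beta> y = \<beta>0 y" "\<And>y. (\<beta>0 has_real_derivative \<beta>1 y) (at y)"
      "\<And>y. (\<beta>1 has_real_derivative \<beta>2 y) (at y)" "continuous_on UNIV \<beta>2"
    using sobolev_4_twice_differentiable[OF b''[folded \<beta>_def]] by blast
  \<comment> \<open>The Sobolev hypothesis yields a differentiable function that agrees with \<beta>
    almost everywhere. Since \<beta> is a derivative, they agree at every point, so the Taylor
    bounds apply to \<open>b''\<close> itself.\<close>
  have "\<beta> = \<beta>0"
    by (rule derivative_eq_continuous_AE[OF db(2) \<beta>0(1)])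
      (auto intro!: continuous_at_imp_continuous_on DERIV_isCont[OF \<beta>0(2)])
  then have d\<beta>: "(\<beta> has_real_derivative \<beta>1 y) (at y)" for y using \<beta>0(2) by simp
  obtain z where z: "embedded_eigenvalue b k z" using single by blast
  then obtain c where c: "z = of_real c" by (auto simp: embedded_eigenvalue_def Reals_def)
  obtain \<omega>0 where \<omega>0: "\<omega>0 \<in> Ltwo" "\<not> (AE y in lborel. \<omega>0 y = 0)" "AE y in lborel. rayleigh b k \<omega>0 y = of_real c * \<omega>0 y"
    using z by (auto simp: embedded_eigenvalue_def rayleigh_eigenvalue_def c)
  obtain y\<^sub>c where y\<^sub>c: "b y\<^sub>c = c" using linear_growth_surjective[OF db(1) c\<^sub>m(1)] b' by blast
  interpret rayleigh_data k b \<beta> \<kappa>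
    by unfold_locales (use k \<beta>L DERIV_isCont[OF db(1)] in \<open>auto simp: \<kappa>_def \<beta>_def\<close>)
  have eigen: "AE y in lborel. (b y - c) *\<^sub>R \<omega>0 y = \<beta> y *\<^sub>R green \<kappa> \<omega>0 y"
    using \<omega>0(3) rayleigh_AE[OF \<omega>0(1)]
    by eventually_elim (simp add: memory_def scaleR_conv_of_real algebra_simps)
  interpret rayleigh_embedded k \<kappa> c\<^sub>m "inverse c\<^sub>m" b "deriv b" \<beta> \<beta>1 \<beta>2 y\<^sub>c c \<omega>0
    by unfold_locales
      (use \<kappa> c\<^sub>m db d\<beta> \<beta>0(3,4) b' y\<^sub>c \<omega>0(1,2) eigen \<beta>L in \<open>auto simp: continuous_on_eq_continuous_at\<close>)
  obtain T where T: "T > 0" "\<And>\<omega>. rayleigh_solution b k step \<omega> \<Longrightarrow> Linf_norm (\<omega> T) \<ge> ereal M \<and> Ltwo_norm (\<omega> T) \<ge> M"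
    using growth[OF M] by blast
  interpret rayleigh_initial k b \<beta> \<kappa> step
    by unfold_locales (rule step_Ltwo)
  have "Linf_norm step + ereal (Ltwo_norm step) = 1"
    unfolding Linf_norm_step Ltwo_norm_step by simp
  then show ?thesis
    using T step_Ltwo rayleigh_solution_exists by (intro exI[of _ step] exI[of _ T]) simp
qed

end
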